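(* Let $\mathcal{L}$ be a $d$-colex, $1\le k<d$, $c^*\in\mathbb{Z}_{d+1}$, $\mathcal{C}=\{C\subset\mathbb{Z}_{d+1}:c^*\notin C,\ |C|=k\}$, and $C^*=C\sqcup\{c^*\}$ for $C\in\mathcal{C}$. Let $\epsilon\in C_d(\mathcal{L})$ (the $Z$-error) and $\sigma=\partial_{d,k-1}\epsilon$ (its syndrome). For each $C\in\mathcal{C}$ let $\rho_C\in C_k(\mathcal{L}_{C^*})$ be any chain with $\partial^{C^*}_k\rho_C=\pi^{(0)}_{C^*}(\sigma)$, let $\rho=\sum_{C\in\mathcal{C}}\rho_C$, and for each vertex $v\in\Delta_0^{c^*}(\rho)$ let $\tau_v\subseteq\mathrm{Star}_d(v)$ be any $d$-chain with $\pi^{(1)}_{C^*}(\tau_v)=\rho_C|_v$ for all $C\in\mathcal{C}$. Set $\phi=\sum_{v\in\Delta_0^{c^*}(\rho)}\tau_v$. Then $\epsilon+\phi\in\ker\partial_{d,k-1}$. Moreover, $\epsilon+\phi\in\mathrm{im}\,\partial_{d-k-1,d}\iff\text{for all }C\in\mathcal{C}:\ \pi^{(1)}_{C^*}(\epsilon)+\rho_C\in\mathrm{im}\,\partial^{C^*}_{k+1}.$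
   Context: Conventions: all complexes are finite. For a simplicial complex $\mathcal{L}$, $\Delta_k(\mathcal{L})$ is its set of $k$-simplices, and for a simplex $\kappa$, $\Delta_l(\kappa)$ is the set of its $l$-dimensional faces. $C_k(\mathcal{L})$ is the $\mathbb{F}_2$-vector space with basis $\Delta_k(\mathcal{L})$; chains are identified with subsets. $\partial_k\kappa=\sum_{\nu\in\Delta_{k-1}(\kappa)}\nu$. For a $j$-simplex $\kappa$ and $n\ge j$, $\mathrm{Star}_n(\kappa)=\{\nu\in\Delta_n(\mathcal{L}):\kappa\in\Delta_j(\nu)\}$; for $n\le d-j-1$, $\mathrm{Link}_n(\kappa)=\{\nu\in\Delta_n(\mathcal{L}):\nu\cap\kappa=\emptyset\text{ and some }d\text{-simplex contains both}\}$, regarded as an $n$-chain. Generalized boundary maps: for $j\ne n$, $\partial_{j,n}:C_j(\mathcal{L})\to C_n(\mathcal{L})$ is linear with $\partial_{j,n}\kappa=\sum_{\nu\in\Delta_n(\kappa)}\nu$ if $j>n$ and $=\sum_{\nu\in\mathrm{Star}_n(\kappa)}\nu$ if $j<n$. (The color code of type $k$ has qubits on $d$-simplices, $X$-syndrome map $\partial_{d,k-1}$ and $Z$-stabilizers $\mathrm{im}\,\partial_{d-k-1,d}$; the toric code of type $k$ on $\mathcal{L}_D$ has chain complex $C_{k+1}(\mathcal{L}_D)\to C_k(\mathcal{L}_D)\to C_{k-1}(\mathcal{L}_D)$.) Colexes: a colorable $0$-ball is a point and a $0$-colex is a finite set of points. For $d\ge1$, a colorable $d$-ball $\mathcal{B}_v$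 is the set of $d$-simplices $\{v*\delta:\delta\in\Delta_{d-1}(K)\}$ (where $v*\delta$ is the simplex spanned by $v$ and the vertices of $\delta$) for a $(d-1)$-colex $K$ homeomorphic to the $(d-1)$-sphere and a vertex $v\notin K$; its boundary is $\partial\mathcal{B}_v=K$. For $d\ge1$, a $d$-colex (without boundary) $\mathcal{L}$ is a homogeneous simplicial $d$-complex which is a finite union of colorable $d$-balls (sharing no $d$-simplex) glued along their boundaries so that every $(d-1)$-simplex lies in the boundary of exactly two distinct balls, and whose vertices are $(d+1)$-colorable: there is $\mathrm{col}:\Delta_0(\mathcal{L})\to\mathbb{Z}_{d+1}=\{0,\dots,d\}$ assigning distinct colors to the endpoints of every edge. Standing structure: for every vertex $v$, $\mathrm{Star}_d(v)$ is the colorable $d$-ball centered at $v$, whose boundary is a $(d-1)$-colex homeomorphic to a $(d-1)$-sphere. For a simplex or chain $\alpha$, $\mathrm{col}(\alpha)$ is the set of colors of its vertices, and $\Delta_0^{c}(\alpha)$ is the set of vertices of color $c$ of simplices of $\alpha$. For an $n$-chain $\alpha$ and vertex $v$, $\alpha|_v=\alpha\cap\mathrm{Star}_n(v)$. Restricted lattice: for $D\subset\mathbb{Z}_{d+1}$ with $|D|=k+1$, $\mathcal{L}_D$ is the cell $(k+1)$-complex whose $i$-cells ($0\le i\le k$) are the $i$-simplices $\iota$ of $\mathcal{L}$ with $\mathrm{col}(\iota)\subseteq D$, and whose $(k+1)$-cells are symbols $\Xi(\delta)$, one for each $(d-k-1)$-simplex $\delta$ with $\mathrm{col}(\delta)=\mathbb{Z}_{d+1}\setminus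 D$. $C_i(\mathcal{L}_D)$ is the $\mathbb{F}_2$-space on its $i$-cells (so $C_k(\mathcal{L}_D)\subseteq C_k(\mathcal{L})$); $\partial_i^D=\partial_i$ on $C_i(\mathcal{L}_D)$ for $1\le i\le k$, and $\partial^D_{k+1}\Xi(\delta)=\mathrm{Link}_k(\delta)$. Restriction maps (linear): $\pi^{(0)}_D:C_{k-1}(\mathcal{L})\to C_{k-1}(\mathcal{L}_D)$, $\pi^{(0)}_D(\mu)=\mu$ if $\mathrm{col}(\mu)\subset D$ and $0$ otherwise; $\pi^{(1)}_D:C_d(\mathcal{L})\to C_k(\mathcal{L}_D)$, $\pi^{(1)}_D(\delta)=$ the unique $k$-face of the $d$-simplex $\delta$ with color set $D$. *)

theory Defs
  imports "HOL-Analysis.Analysis" "HOL-Library.Z2" "HOL-Library.Function_Algebras"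
begin

text \<open>A homogeneous simplicial d-complex is represented by its set of d-simplices
(facets); a simplex is a finite set of vertices. Chains are F2-valued functions on
simplices (type bit = F2), which is the same as subsets with symmetric difference.\<close>

type_synonym 'v chain = "'v set \<Rightarrow> bit"

definition simp :: "nat \<Rightarrow> 'v set set \<Rightarrow> 'v set set" where
  "simp k L = {s. card s = Suc k \<and> (\<exists>f\<in>L. s \<subseteq> f)}"

definition vertices :: "'v set set \<Rightarrow> 'v set" where
  "vertices L = \<Union>L"

definition is_chain :: "'v set set \<Rightarrow> nat \<Rightarrow> 'v chain \<Rightarrow> bool" where
  "is_chain L k \<alpha> \<longleftrightarrow> (\<forall>s. \<alpha> s \<noteq> 0 \<longrightarrow> s \<in> simp k L)"

definition gbd :: "'v set set \<Rightarrow> nat \<Rightarrow> nat \<Rightarrow> 'v chain \<Rightarrow> 'v chain" where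
  "gbd L j n \<alpha> = (\<lambda>\<nu>. if \<nu> \<in> simp n L then
      (if n < j then (\<Sum>\<kappa>\<in>{\<kappa>\<in>simp j L. \<nu> \<subseteq> \<kappa>}. \<alpha> \<kappa>)
       else if j < n then (\<Sum>\<kappa>\<in>{\<kappa>\<in>simp j L. \<kappa> \<subseteq> \<nu>}. \<alpha> \<kappa>)
       else 0)
    else 0)"

definition bd :: "'v set set \<Rightarrow> nat \<Rightarrow> 'v chain \<Rightarrow> 'v chain" where
  "bd L k \<alpha> = gbd L k (k - 1) \<alpha>"

definition in_image :: "'v set set \<Rightarrow> nat \<Rightarrow> nat \<Rightarrow> 'v chain \<Rightarrow> bool" where
  "in_image L j n \<gamma> \<longleftrightarrow> (\<exists>\<beta>. is_chain L j \<beta> \<and> gbd L j n \<beta> = \<gamma>)"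

definition link :: "'v set set \<Rightarrow> nat \<Rightarrow> 'v set \<Rightarrow> 'v set set" where
  "link L n \<kappa> = {\<nu>\<in>simp n L. \<nu> \<inter> \<kappa> = {} \<and> (\<exists>f\<in>L. \<nu> \<union> \<kappa> \<subseteq> f)}"

text \<open>Restricted lattice L_D, |D| = k+1 (colours are natural numbers 0..d).
The (k+1)-cells Xi(delta) are indexed by the (d-k-1)-simplices delta with colour set
the complement of D; a (k+1)-chain of L_D is an F2-function on these delta.\<close>
definition xi_cells :: "'v set set \<Rightarrow> ('v \<Rightarrow> nat) \<Rightarrow> nat \<Rightarrow> nat set \<Rightarrow> 'v set set" where
  "xi_cells L col d D = {\<delta>\<in>simp (d - card D) L. col ` \<delta> = {..d} - D}"

definition restr_chain :: "'v set set \<Rightarrow> ('v \<Rightarrow> nat) \<Rightarrow> nat \<Rightarrow> nat set \<Rightarrow> 'v chain \<Rightarrow> bool" where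
  "restr_chain L col i D \<alpha> \<longleftrightarrow> (\<forall>s. \<alpha> s \<noteq> 0 \<longrightarrow> s \<in> simp i L \<and> col ` s \<subseteq> D)"

text \<open>partial^D_{k+1} Xi(delta) = Link_k(delta), where k = |D| - 1.\<close>
definition bdXi :: "'v set set \<Rightarrow> ('v \<Rightarrow> nat) \<Rightarrow> nat \<Rightarrow> nat set \<Rightarrow> 'v chain \<Rightarrow> 'v chain" where
  "bdXi L col d D \<xi> = (\<lambda>\<nu>. \<Sum>\<delta>\<in>{\<delta>\<in>xi_cells L col d D. \<nu> \<in> link L (card D - 1) \<delta>}. \<xi> \<delta>)"

definition in_image_Xi :: "'v set set \<Rightarrow> ('v \<Rightarrow> nat) \<Rightarrow> nat \<Rightarrow> nat set \<Rightarrow> 'v chain \<Rightarrow> bool" where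
  "in_image_Xi L col d D \<gamma> \<longleftrightarrow>
     (\<exists>\<xi>. (\<forall>\<delta>. \<xi> \<delta> \<noteq> 0 \<longrightarrow> \<delta> \<in> xi_cells L col d D) \<and> bdXi L col d D \<xi> = \<gamma>)"

definition pi0 :: "('v \<Rightarrow> nat) \<Rightarrow> nat set \<Rightarrow> 'v chain \<Rightarrow> 'v chain" where
  "pi0 col D \<mu> = (\<lambda>s. if col ` s \<subseteq> D then \<mu> s else 0)"

text \<open>pi^(1)_D : C_d(L) -> C_k(L_D), a d-simplex goes to its unique k-face with colour set D.\<close>
definition pi1 :: "'v set set \<Rightarrow> ('v \<Rightarrow> nat) \<Rightarrow> nat \<Rightarrow> nat set \<Rightarrow> 'v chain \<Rightarrow> 'v chain" where
  "pi1 L col d D \<alpha> = (\<lambda>\<nu>. if \<nu> \<in> simp (card D - 1) L \<and> col ` \<nu> = D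
       then (\<Sum>\<delta>\<in>{\<delta>\<in>simp d L. \<nu> \<subseteq> \<delta>}. \<alpha> \<delta>) else 0)"

definition restrict_at :: "'v chain \<Rightarrow> 'v \<Rightarrow> 'v chain" where
  "restrict_at \<alpha> v = (\<lambda>s. if v \<in> s then \<alpha> s else 0)"

definition verts_of_colour :: "('v \<Rightarrow> nat) \<Rightarrow> nat \<Rightarrow> 'v chain \<Rightarrow> 'v set" where
  "verts_of_colour col c \<alpha> = {v. col v = c \<and> (\<exists>s. \<alpha> s \<noteq> 0 \<and> v \<in> s)}"

text \<open>Geometric realization (in the product topology on 'v => real, which agrees with
the standard topology for finite complexes) and homeomorphism to the n-sphere.\<close>
definition realization :: "'v set set \<Rightarrow> ('v \<Rightarrow> real) set" where
  "realization K = {x. (\<forall>v. 0 \<le> x v) \<and> (\<exists>f\<in>K. (\<forall>v. v \<notin> f \<longrightarrow> x v = 0) \<and> sum x f = 1)}"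

definition homeo_sphere :: "nat \<Rightarrow> 'v set set \<Rightarrow> bool" where
  "homeo_sphere n K \<longleftrightarrow>
     subtopology (powertop_real UNIV) (realization K) homeomorphic_space nsphere n"

text \<open>The colorable ball with centre v and boundary complex K (facets).\<close>
definition cball_set :: "'v \<Rightarrow> 'v set set \<Rightarrow> 'v set set" where
  "cball_set v K = {insert v \<delta> | \<delta>. \<delta> \<in> K}"

definition proper_colouring :: "nat \<Rightarrow> 'v set set \<Rightarrow> ('v \<Rightarrow> nat) \<Rightarrow> bool" where
  "proper_colouring d L col \<longleftrightarrow> (\<forall>f\<in>L. col ` f \<subseteq> {..d} \<and> inj_on col f)"

fun colex :: "nat \<Rightarrow> 'v set set \<Rightarrow> bool" where
  "colex 0 L \<longleftrightarrow> finite L \<and> (\<forall>f\<in>L. card f = 1)"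
| "colex (Suc n) L \<longleftrightarrow> finite L \<and> (\<forall>f\<in>L. card f = Suc (Suc n)) \<and>
     (\<exists>B :: ('v \<times> 'v set set) set. finite B \<and>
        (\<forall>(v,K)\<in>B. colex n K \<and> homeo_sphere n K \<and> v \<notin> vertices K) \<and>
        L = (\<Union>(v,K)\<in>B. cball_set v K) \<and>
        (\<forall>b1\<in>B. \<forall>b2\<in>B. b1 \<noteq> b2 \<longrightarrow>
            cball_set (fst b1) (snd b1) \<inter> cball_set (fst b2) (snd b2) = {}) \<and>
        (\<forall>\<sigma>. (\<exists>b\<in>B. \<sigma> \<in> snd b) \<longrightarrow> card {b\<in>B. \<sigma> \<in> snd b} = 2)) \<and>
     (\<exists>col. proper_colouring (Suc n) L col)"

definition star_bdry :: "'v set set \<Rightarrow> 'v \<Rightarrow> 'v set set" where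
  "star_bdry L v = {f - {v} | f. f \<in> L \<and> v \<in> f}"

end

theory Submission
  imports "HOL-Homology.Homology" Defs
begin

text \<open>
Every \<open>k\<close>-simplex of \<open>\<rho>\<close> has exactly one vertex of colour \<open>cs\<close>, so \<open>\<phi>\<close> has the same restrictions as \<open>\<rho>\<close>:
with \<open>\<gamma> = \<epsilon> + \<phi>\<close> one gets \<open>pi1 \<gamma> = pi1 \<epsilon> + \<rho> C\<close>. The colour set of any \<open>(k-1)\<close>-simplex can be
enlarged by one colour to a set containing \<open>cs\<close>; summing over the vertices of that colour yields the first claim. In the equivalence, the forward direction uses that a
simplex that is not a facet lies in an even number of facets. For the converse, one subtracts the stabilizer given by the
cells \<open>Xi\<close>; what remains splits over the vertices \<open>v\<close> of colour \<open>cs\<close> into cycles of the colour codes on the link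
spheres of these vertices, and on a sphere of dimension at least \<open>k\<close> every such cycle is a stabilizer.

The last fact follows by induction on the dimension from two properties of the sphere and of all links of its simplices:
\<open>k\<close>-cycles bound below the top dimension, and a top cycle is zero or fundamental. Both reduce to the
acyclicity of the subcomplex of simplices not containing a given simplex \<open>\<sigma>\<close>. The sphere minus the barycentre \<open>x\<close> of \<open>\<sigma>\<close>
is contractible and covered by the open sets \<open>{y. y w > x w}\<close>, whose nerve lies in that subcomplex; a cycle is bounded
by a singular chain, which is subdivided and pushed into the nerve, and a Sperner argument shows that this
process fixes simplicial chains mod 2.
\<close>

text \<open>Only the links of single vertices of \<open>L\<close> are given as spheres; nothing is
  known about the topology of links of larger simplices, so the induction cannot use sphericity of
  links. \<open>links_spherical\<close> therefore records homology only, and the homology of the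
  link of \<open>\<sigma>\<close> is read off from the surrounding sphere: a cycle of the link is
  joined with \<open>\<sigma>\<close>, completed to a cycle of the sphere and filled there. One
  degree \<open>k\<close> suffices because passing to a link lowers the dimension and leaves
  \<open>k\<close> fixed, until \<open>k\<close> is the top degree. \<open>L\<close> itself may have
  homology. Hence \<open>face_generated_localize\<close> assumes that the coloured parts of the
  facet sums are sums of links: for \<open>L\<close> this is the right side of the equivalence, in a
  sphere it is a consequence of the vanishing syndrome. The condition \<open>1 \<le> k\<close> keeps
  all cycles in positive dimension, where reduced and ordinary cycles agree.\<close>

section \<open>Mod 2 chains on coloured complexes\<close>

(* By default + and * on bit are rewritten to bitwise operations. *)
declare add_bit_eq_xor [simp del] mult_bit_eq_and [simp del] bit_not_zero_iff [simp del]

lemma bit_add_self [simp]: "(a::bit) + a = 0"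
  by (cases a) auto

text \<open>Each unordered pair of distinct elements is counted twice. This is the cancellation that
  makes the boundary square to zero.\<close>

lemma sum_symmetric_bit:
  fixes g :: "'a \<Rightarrow> 'a \<Rightarrow> bit"
  assumes "finite A" "\<And>u v. g u v = g v u"
  shows "(\<Sum>v\<in>A. \<Sum>u\<in>A - {v}. g u v) = 0"
  using assms(1)
proof (induction A)
  case (insert x A)
  have "(\<Sum>v\<in>A. \<Sum>u\<in>insert x A - {v}. g u v) = (\<Sum>v\<in>A. g x v + (\<Sum>u\<in>A - {v}. g u v))"
  proof (rule sum.cong)
    fix v assume v: "v \<in> A"
    then have "insert x A - {v} = insert x (A - {v})" using insert by auto
    then show "(\<Sum>u\<in>insert x A - {v}. g u v) = g x v + (\<Sum>u\<in>A - {v}. g u v)"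
      using insert by auto
  qed auto
  also have "\<dots> = (\<Sum>v\<in>A. g x v)"
    using insert by (simp add: sum.distrib)
  finally show ?case using insert assms(2) by (simp add: assms(2)[of x])
qed auto

text \<open>No complex appears here: \<open>V\<close> only has to contain all vertices in play, so
  one operator serves a complex, its subcomplexes and its links. At \<open>{}\<close> it is the
  augmentation.\<close>

definition chain_bd :: "'v set \<Rightarrow> 'v chain \<Rightarrow> 'v chain" where
  "chain_bd V z t = (\<Sum>v\<in>V - t. z (insert v t))"

lemma chain_bd_chain_bd: "finite V \<Longrightarrow> chain_bd V (chain_bd V z) t = 0"
proof -
  assume V: "finite V"
  have "chain_bd V (chain_bd V z) t = (\<Sum>v\<in>V-t. \<Sum>u\<in>(V-t)-{v}. z (insert u (insert v t)))"
    unfolding chain_bd_def by (intro sum.cong) auto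
  also have "\<dots> = 0"
    using V by (intro sum_symmetric_bit) (auto simp: insert_commute)
  finally show ?thesis .
qed

lemma chain_bd_add: "chain_bd V (\<lambda>s. a s + b s) t = chain_bd V a t + chain_bd V b t"
  by (simp add: chain_bd_def sum.distrib)

lemma chain_bd_sum: "chain_bd V (\<lambda>s. \<Sum>x\<in>X. a x s) t = (\<Sum>x\<in>X. chain_bd V (a x) t)"
  unfolding chain_bd_def by (rule sum.swap)

definition chain_on :: "'v set set \<Rightarrow> nat \<Rightarrow> 'v chain \<Rightarrow> bool" where
  "chain_on K m z \<longleftrightarrow> (\<forall>s. z s \<noteq> 0 \<longrightarrow> s \<in> K \<and> card s = m)"

lemma chain_onD: "chain_on K m z \<Longrightarrow> z s \<noteq> 0 \<Longrightarrow> s \<in> K \<and> card s = m"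
  by (simp add: chain_on_def)

text \<open>Vanishing of reduced mod 2 homology in dimension \<open>m - 1\<close>; the index
  \<open>m\<close> counts vertices.\<close>

definition cycles_bound :: "'v set \<Rightarrow> 'v set set \<Rightarrow> nat \<Rightarrow> bool" where
  "cycles_bound V K m \<longleftrightarrow> (\<forall>z. chain_on K m z \<and> (\<forall>t. chain_bd V z t = 0) \<longrightarrow>
     (\<exists>w. chain_on K (Suc m) w \<and> (\<forall>t. chain_bd V w t = z t)))"

definition faces :: "'v set set \<Rightarrow> 'v set set" where
  "faces M = {s. \<exists>f\<in>M. s \<subseteq> f}"

text \<open>\<open>M\<close> is a set of facets, so the link as a complex is
  \<open>faces (lk M s)\<close>. The empty simplex is a face as soon as \<open>M\<close> is
  nonempty.\<close>

definition lk :: "'v set set \<Rightarrow> 'v set \<Rightarrow> 'v set set" where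
  "lk M s = (\<lambda>f. f - s) ` {f\<in>M. s \<subseteq> f}"

lemma faces_lk: "t \<in> faces (lk M s) \<longleftrightarrow> t \<inter> s = {} \<and> t \<union> s \<in> faces M"
  unfolding faces_def lk_def by auto

lemma faces_mono: "t \<in> faces M \<Longrightarrow> s \<subseteq> t \<Longrightarrow> s \<in> faces M"
  by (auto simp: faces_def)

lemma lk_lk: "s \<inter> t = {} \<Longrightarrow> lk (lk M s) t = lk M (s \<union> t)"
proof -
  assume "s \<inter> t = {}"
  then have "{f \<in> lk M s. t \<subseteq> f} = (\<lambda>f. f - s) ` {f\<in>M. s \<union> t \<subseteq> f}"
    unfolding lk_def by blast
  then show ?thesis unfolding lk_def[of "lk M s"] unfolding lk_def[of M "s \<union> t"]
    by (simp add: image_image Diff_Diff_Int set_diff_eq conj_commute) (auto intro!: image_cong)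
qed

lemma lk_empty [simp]: "lk M {} = M"
  by (auto simp: lk_def)

text \<open>\<open>r\<close> is the cardinality of the facets. This is the part in degree \<open>k\<close> and in top degree of being a mod 2 homology sphere, for all links.\<close>
definition links_spherical :: "'v set \<Rightarrow> 'v set set \<Rightarrow> nat \<Rightarrow> nat \<Rightarrow> bool" where
  "links_spherical V M k r \<longleftrightarrow> (\<forall>s\<in>faces M.
     (card s + k + 1 < r \<longrightarrow> cycles_bound V (faces (lk M s)) (Suc k)) \<and>
     (card s + k + 1 = r \<longrightarrow> (\<forall>z. chain_on (faces (lk M s)) (Suc k) z \<and> (\<forall>t. chain_bd V z t = 0) \<longrightarrow>
         (\<forall>t. z t = 0) \<or> (\<forall>t\<in>lk M s. z t = 1))))"

text \<open>\<open>V\<close> is an ambient set that stays the same when passing to links; only the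
  colour set \<open>N\<close>, which every facet uses exactly once, shrinks.\<close>

definition balanced :: "'v set \<Rightarrow> ('v \<Rightarrow> nat) \<Rightarrow> nat set \<Rightarrow> 'v set set \<Rightarrow> bool" where
  "balanced V col N M \<longleftrightarrow> finite V \<and> finite N \<and> (\<forall>f\<in>M. f \<subseteq> V \<and> bij_betw col f N)"

lemma balanced_finite: "balanced V col N M \<Longrightarrow> finite M"
  unfolding balanced_def by (meson PowI finite_Pow_iff finite_subset subsetI)

lemma balanced_face:
  assumes "balanced V col N M" "s \<in> faces M"
  shows "finite s" "s \<subseteq> V" "inj_on col s" "col ` s \<subseteq> N" "card (col ` s) = card s"
proof -
  obtain f where f: "f \<in> M" "s \<subseteq> f" using assms(2) by (auto simp: faces_def)
  then have *: "f \<subseteq> V" "inj_on col f" "col ` f = N" "finite V"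
    using assms(1) by (auto simp: balanced_def bij_betw_def)
  show "finite s" "s \<subseteq> V" using f * by (auto intro: finite_subset)
  show "inj_on col s" "col ` s \<subseteq> N" using f * by (auto intro: inj_on_subset)
  then show "card (col ` s) = card s" by (simp add: card_image)
qed

lemma balanced_facet:
  assumes "balanced V col N M" "f \<in> M"
  shows "finite f" "f \<subseteq> V" "inj_on col f" "col ` f = N" "card f = card N"
  using assms balanced_face[of V col N M f] by (auto simp: balanced_def faces_def bij_betw_def card_image)

lemma balanced_lk:
  assumes "balanced V col N M" "col v = c"
  shows "balanced V col (N - {c}) (lk M {v})"
  unfolding balanced_def
proof (intro conjI ballI)
  show "finite V" "finite (N - {c})" using assms by (auto simp: balanced_def)
  fix f assume "f \<in> lk M {v}"
  then obtain g where g: "g \<in> M" "v \<in> g" "f = g - {v}" by (auto simp: lk_def)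
  note b = balanced_facet[OF assms(1) g(1)]
  show "f \<subseteq> V" using b g by auto
  have "col ` f = N - {c}" using b g assms(2) by (auto simp: inj_on_def)
  moreover have "inj_on col f" using b g by (auto intro: inj_on_subset)
  ultimately show "bij_betw col f (N - {c})" by (simp add: bij_betw_def)
qed

text \<open>A link in the link of \<open>v\<close> is the link in \<open>M\<close> of a simplex with
  one more vertex, which matches the drop of \<open>r\<close> by one.\<close>

lemma links_spherical_lk:
  assumes "balanced V col N M" "links_spherical V M k (Suc r)"
  shows "links_spherical V (lk M {v}) k r"
  unfolding links_spherical_def
proof (intro ballI)
  fix s assume s: "s \<in> faces (lk M {v})"
  then have s': "v \<notin> s" "insert v s \<in> faces M" by (auto simp: faces_lk)
  then have "card (insert v s) = Suc (card s)" using balanced_face[OF assms(1) s'(2)] by auto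
  moreover have "lk (lk M {v}) s = lk M (insert v s)" using s' by (simp add: lk_lk)
  ultimately show "(card s + k + 1 < r \<longrightarrow> cycles_bound V (faces (lk (lk M {v}) s)) (Suc k)) \<and>
     (card s + k + 1 = r \<longrightarrow> (\<forall>z. chain_on (faces (lk (lk M {v}) s)) (Suc k) z \<and> (\<forall>t. chain_bd V z t = 0) \<longrightarrow>
         (\<forall>t. z t = 0) \<or> (\<forall>t\<in>lk (lk M {v}) s. z t = 1)))"
    using assms(2) s' unfolding links_spherical_def by fastforce
qed

section \<open>Filling cycles with few colours\<close>

definition colour_selected :: "('v \<Rightarrow> nat) \<Rightarrow> nat set \<Rightarrow> 'v set set \<Rightarrow> 'v set set" where
  "colour_selected col E K = {s\<in>K. col ` s \<subseteq> E}"

text \<open>Removing \<open>v\<close> from the simplices that contain it commutes with the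
  boundary.\<close>

lemma cycle_link:
  assumes "finite V" "\<And>t. v \<in> t \<Longrightarrow> chain_bd V w t = 0" "v \<in> V"
  shows "chain_bd V (\<lambda>s. if v \<in> s then 0 else w (insert v s)) t = 0"
proof (cases "v \<in> t")
  case True
  then show ?thesis by (simp add: chain_bd_def)
next
  case False
  have "chain_bd V (\<lambda>s. if v \<in> s then 0 else w (insert v s)) t
      = (\<Sum>x\<in>(V - insert v t) \<union> (V \<inter> {v}). if v = x then 0 else w (insert x (insert v t)))"
    unfolding chain_bd_def using False by (intro sum.cong) (auto simp: insert_commute)
  also have "\<dots> = (\<Sum>x\<in>V - insert v t. w (insert x (insert v t)))"
    using assms(1) by (intro sum.mono_neutral_cong_right) auto
  also have "\<dots> = 0" using assms(2)[of "insert v t"] by (simp add: chain_bd_def)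
  finally show ?thesis .
qed

text \<open>Colours are deleted one at a time: the part of a bounding chain at a vertex \<open>v\<close> of the deleted colour is a cone
over a cycle in the link of \<open>v\<close>, and is replaced by a filling of that cycle.\<close>
lemma colour_selected_cycles_bound:
  assumes "balanced V col N M" "links_spherical V M k (card N)" "E \<subseteq> N" "k + 2 \<le> card E"
  shows "cycles_bound V (colour_selected col E (faces M)) (Suc k)"
  using assms
\<comment> \<open>The outer induction serves the links, which have one colour less. The inner one
  puts missing colours back into \<open>E\<close> until \<open>E = N\<close>, where the assumption
  on \<open>M\<close> itself applies.\<close>
proof (induction "card N" arbitrary: N M E rule: less_induct)
  case less
  note outer = less.hyps
  have fin: "finite V" "finite N" using less.prems by (auto simp: balanced_def)
  from less.prems(3,4) show ?case
  proof (induction "card (N - E)" arbitrary: E rule: less_induct)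
    case (less E)
    note inner = less.hyps
    show ?case
    proof (cases "E = N")
      case True
      have "colour_selected col E (faces M) = faces M"
        using balanced_face(4)[OF \<open>balanced V col N M\<close>] True by (auto simp: colour_selected_def)
      moreover have "cycles_bound V (faces M) (Suc k)"
      proof (cases "M = {}")
        case True
        then show ?thesis by (auto simp: cycles_bound_def chain_on_def faces_def chain_bd_def)
      next
        case False
        then have "{} \<in> faces M" by (auto simp: faces_def)
        with \<open>links_spherical V M k (card N)\<close>
        have "card ({}::'a set) + k + 1 < card N \<longrightarrow> cycles_bound V (faces (lk M {})) (Suc k)"
          unfolding links_spherical_def by blast
        then show ?thesis using less.prems \<open>E = N\<close> by simp
      qed
      ultimately show ?thesis by simp
    next
      case False
      then obtain b where b: "b \<in> N" "b \<notin> E" using less.prems by auto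
      have finE: "finite E" using fin less.prems finite_subset by auto
      let ?E' = "insert b E"
      have "card (N - ?E') < card (N - E)" using b fin by (intro psubset_card_mono) auto
      then have ac: "cycles_bound V (colour_selected col ?E' (faces M)) (Suc k)"
        using inner[of ?E'] b less.prems finE by auto
      show ?thesis
        unfolding cycles_bound_def
      proof (intro allI impI, elim conjE)
        fix z assume z: "chain_on (colour_selected col E (faces M)) (Suc k) z" and cz: "\<forall>t. chain_bd V z t = 0"
        then have "chain_on (colour_selected col ?E' (faces M)) (Suc k) z"
          by (force simp: chain_on_def colour_selected_def)
        with ac cz obtain w where w: "chain_on (colour_selected col ?E' (faces M)) (Suc (Suc k)) w"
          and cw: "\<And>t. chain_bd V w t = z t" unfolding cycles_bound_def by blast
        define u where "u v = (\<lambda>s. if v \<in> s then 0 else w (insert v s))" for v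
        have "\<exists>y. chain_on (colour_selected col E (faces (lk M {v}))) (Suc (Suc k)) y \<and> (\<forall>t. chain_bd V y t = u v t)"
          if v: "v \<in> V" "col v = b" for v
        proof -
          have "cycles_bound V (colour_selected col E (faces (lk M {v}))) (Suc k)"
          proof (rule outer)
            have "card N = Suc (card (N - {b}))" using b fin by (intro card.remove) auto
            then show "card (N - {b}) < card N" "links_spherical V (lk M {v}) k (card (N - {b}))"
              using links_spherical_lk[OF \<open>balanced V col N M\<close>] \<open>links_spherical V M k (card N)\<close> by auto
            show "balanced V col (N - {b}) (lk M {v})"
              using balanced_lk[OF \<open>balanced V col N M\<close>] v by auto
            show "E \<subseteq> N - {b}" "k + 2 \<le> card E" using b less.prems by auto
          qed
          moreover have "chain_on (colour_selected col E (faces (lk M {v}))) (Suc k) (u v)"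
            unfolding chain_on_def
          proof (intro allI impI)
            fix s assume "u v s \<noteq> 0"
            then have s: "v \<notin> s" "w (insert v s) \<noteq> 0" by (auto simp: u_def split: if_splits)
            then have s': "insert v s \<in> faces M" "col ` insert v s \<subseteq> ?E'" "card (insert v s) = Suc (Suc k)"
              using chain_onD[OF w] by (auto simp: colour_selected_def)
            note bf = balanced_face[OF \<open>balanced V col N M\<close> s'(1)]
            have "b \<notin> col ` s" using bf(3) s(1) v(2) by (auto simp: inj_on_def)
            show "s \<in> colour_selected col E (faces (lk M {v})) \<and> card s = Suc k"
            proof -
              have "col ` s \<subseteq> E" using s'(2) \<open>b \<notin> col ` s\<close> by (metis image_mono subset_insert subset_insertI subset_trans)
              moreover have "s \<in> faces (lk M {v})" using s(1) s'(1) by (simp add: faces_lk)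
              moreover have "card s = Suc k" using s(1) s'(3) bf(1) by simp
              ultimately show ?thesis by (simp add: colour_selected_def)
            qed
          qed
          \<comment> \<open>The cycle \<open>z\<close> avoids the colour \<open>b\<close>, so its
            filling has no boundary at simplices through \<open>v\<close>.\<close>
          moreover have "chain_bd V w t = 0" if "v \<in> t" for t
          proof (rule ccontr)
            assume "chain_bd V w t \<noteq> 0"
            then have "col ` t \<subseteq> E" using chain_onD[OF z, of t] by (simp add: cw colour_selected_def)
            then show False using that v b by auto
          qed
          then have "\<forall>t. chain_bd V (u v) t = 0"
            unfolding u_def using cycle_link[OF fin(1) _ v(1), of w] by blast
          ultimately show ?thesis unfolding cycles_bound_def by blast
        qed
        then obtain y where y: "\<And>v. v \<in> V \<Longrightarrow> col v = b \<Longrightarrow> chain_on (colour_selected col E (faces (lk M {v}))) (Suc (Suc k)) (y v)"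
          and cy: "\<And>v t. v \<in> V \<Longrightarrow> col v = b \<Longrightarrow> chain_bd V (y v) t = u v t" by metis
        let ?B = "{v\<in>V. col v = b}"
        \<comment> \<open>The simplices of \<open>w\<close> through \<open>v\<close> form the cone
          from \<open>v\<close> over the cycle \<open>u v\<close>. The cone and \<open>y v\<close>
          both have boundary \<open>u v\<close>, so the exchange keeps the total boundary.\<close>
        define w' where "w' s = (if col ` s \<subseteq> E then w s else 0) + (\<Sum>v\<in>?B. y v s)" for s
        have "chain_on (colour_selected col E (faces M)) (Suc (Suc k)) w'"
          unfolding chain_on_def
        proof (intro allI impI)
          fix s assume "w' s \<noteq> 0"
          then consider "(if col ` s \<subseteq> E then w s else 0) \<noteq> 0" | "(\<Sum>v\<in>?B. y v s) \<noteq> 0"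
            unfolding w'_def by fastforce
          then consider "col ` s \<subseteq> E" "w s \<noteq> 0" | v where "v \<in> ?B" "y v s \<noteq> 0"
            by cases (auto split: if_splits elim: sum.not_neutral_contains_not_neutral)
          then show "s \<in> colour_selected col E (faces M) \<and> card s = Suc (Suc k)"
          proof cases
            case 1
            then show ?thesis using chain_onD[OF w] by (auto simp: colour_selected_def)
          next
            case 2
            then show ?thesis using chain_onD[OF y, of v s]
              by (auto simp: colour_selected_def faces_lk intro: faces_mono)
          qed
        qed
        moreover have "chain_bd V w' t = z t" for t
        proof -
          have "chain_bd V w' t = chain_bd V (\<lambda>s. if col ` s \<subseteq> E then w s else 0) t + (\<Sum>v\<in>?B. u v t)"
            unfolding w'_def by (simp add: chain_bd_add chain_bd_sum cy)
          moreover have "(\<Sum>v\<in>?B. u v t) = (\<Sum>v\<in>V - t. if col v = b then w (insert v t) else 0)"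
            unfolding u_def using fin
            by (intro sum.mono_neutral_cong) auto
          moreover have "chain_bd V (\<lambda>s. if col ` s \<subseteq> E then w s else 0) t
              = (\<Sum>v\<in>V - t. if col ` insert v t \<subseteq> E then w (insert v t) else 0)"
            by (simp add: chain_bd_def)
          ultimately have eq: "chain_bd V w' t = (\<Sum>v\<in>V - t. (if col ` insert v t \<subseteq> E then w (insert v t) else 0)
             + (if col v = b then w (insert v t) else 0))"
            by (simp add: sum.distrib)
          show ?thesis
          proof (cases "col ` t \<subseteq> E")
            case True
            have "chain_bd V w' t = chain_bd V w t"
              unfolding eq unfolding chain_bd_def
            proof (intro sum.cong refl)
              fix v assume "v \<in> V - t"
              show "(if col ` insert v t \<subseteq> E then w (insert v t) else 0)
                  + (if col v = b then w (insert v t) else 0) = w (insert v t)"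
                using chain_onD[OF w, of "insert v t"] b True by (auto simp: colour_selected_def)
            qed
            then show ?thesis by (simp add: cw)
          next
            case False
            then have "z t = 0" using chain_onD[OF z, of t] by (auto simp: colour_selected_def)
            moreover have "chain_bd V w' t = (\<Sum>v\<in>V - t. 0)"
              unfolding eq
            proof (intro sum.cong refl)
              fix v assume v: "v \<in> V - t"
              have "w (insert v t) = 0" if "col v = b"
              proof (rule ccontr)
                assume "w (insert v t) \<noteq> 0"
                then have s': "insert v t \<in> faces M" "col ` insert v t \<subseteq> ?E'"
                  using chain_onD[OF w] by (auto simp: colour_selected_def)
                note bf = balanced_face[OF \<open>balanced V col N M\<close> s'(1)]
                have "b \<notin> col ` t" using bf(3) v that by (auto simp: inj_on_def)
                then show False using False s'(2) by (metis image_mono subset_insert subset_insertI subset_trans)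
              qed
              then show "(if col ` insert v t \<subseteq> E then w (insert v t) else 0)
                  + (if col v = b then w (insert v t) else 0) = 0"
                using False by auto
            qed
            ultimately show ?thesis by simp
          qed
        qed
        ultimately show "\<exists>w. chain_on (colour_selected col E (faces M)) (Suc (Suc k)) w \<and> (\<forall>t. chain_bd V w t = z t)"
          by blast
      qed
    qed
  qed
qed

section \<open>Coloured cycles as sums of links\<close>

definition facet_sum :: "'v set set \<Rightarrow> 'v chain \<Rightarrow> 'v chain" where
  "facet_sum M \<gamma> t = (\<Sum>f\<in>{f\<in>M. t \<subseteq> f}. \<gamma> f)"

text \<open>On a facet this is the unique face with colour set \<open>B\<close>. A function
  \<open>\<xi>\<close> of \<open>colour_part col (N - D) f\<close> is thus a chain of cells Xi
  pulled back to the facets, and its \<open>facet_sum\<close> at simplices of colour set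
  \<open>D\<close> is the boundary of that chain.\<close>

definition colour_part :: "('v \<Rightarrow> nat) \<Rightarrow> nat set \<Rightarrow> 'v set \<Rightarrow> 'v set" where
  "colour_part col B f = {x\<in>f. col x \<in> B}"

lemma facet_sum_eq_0_if_not_face: "t \<notin> faces M \<Longrightarrow> facet_sum M \<gamma> t = 0"
  by (auto simp: facet_sum_def faces_def intro: sum.neutral)

lemma facet_sum_lk: "v \<notin> t \<Longrightarrow> facet_sum (lk M {v}) \<gamma> t = (\<Sum>f\<in>{f\<in>M. insert v t \<subseteq> f}. \<gamma> (f - {v}))"
  unfolding facet_sum_def lk_def
  by (rule sum.reindex_bij_betw[symmetric, of "\<lambda>f. f - {v}"])
     (auto simp: bij_betw_def inj_on_def)

lemma obtain_vertex_of_colour: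
  assumes "balanced V col N M" "f \<in> M" "c \<in> N"
  obtains v where "v \<in> f" "col v = c" "v \<in> V" "\<And>x. x \<in> f \<Longrightarrow> col x = c \<longleftrightarrow> x = v"
  using balanced_facet[OF assms(1,2)] assms(3) by (auto simp: inj_on_def)

text \<open>Every facet has exactly one vertex of colour \<open>c\<close>, and for a facet through
  \<open>t\<close> this vertex lies outside \<open>t\<close>.\<close>

lemma facet_sum_split_colour:
  assumes b: "balanced V col N M" and c: "c \<in> N" "c \<notin> col ` t"
  shows "facet_sum M \<gamma> t = (\<Sum>x\<in>{x\<in>V. col x = c}. facet_sum M \<gamma> (insert x t))"
proof -
  have fin: "finite M" "finite V" using b balanced_finite by (auto simp: balanced_def)
  have "(\<Sum>x\<in>{x\<in>V. col x = c}. facet_sum M \<gamma> (insert x t))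
      = (\<Sum>x\<in>{x\<in>V. col x = c}. \<Sum>f\<in>{f\<in>M. t \<subseteq> f}. if x \<in> f then \<gamma> f else 0)"
    unfolding facet_sum_def using fin by (intro sum.cong sum.mono_neutral_cong_left) auto
  also have "\<dots> = (\<Sum>f\<in>{f\<in>M. t \<subseteq> f}. \<Sum>x\<in>{x\<in>V. col x = c}. if x \<in> f then \<gamma> f else 0)"
    by (rule sum.swap)
  also have "\<dots> = facet_sum M \<gamma> t"
    unfolding facet_sum_def
  proof (rule sum.cong)
    fix f assume "f \<in> {f\<in>M. t \<subseteq> f}"
    then obtain v where v: "v \<in> f" "col v = c" "v \<in> V" "\<And>x. x \<in> f \<Longrightarrow> col x = c \<longleftrightarrow> x = v"
      using obtain_vertex_of_colour[OF b _ c(1)] by (metis (mono_tags, lifting) mem_Collect_eq)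
    then have "(\<Sum>x\<in>{x\<in>V. col x = c}. if x \<in> f then \<gamma> f else 0) = (\<Sum>x\<in>{v}. \<gamma> f)"
      using fin by (intro sum.mono_neutral_cong_right) auto
    then show "(\<Sum>x\<in>{x\<in>V. col x = c}. if x \<in> f then \<gamma> f else 0) = \<gamma> f" by simp
  qed simp
  finally show ?thesis by simp
qed

text \<open>A filling of \<open>z\<close> that uses one further colour \<open>b\<close> consists of
  simplices carrying all colours of \<open>insert b D\<close>. It splits into cones over cycles of
  colour \<open>D\<close> in the links of the vertices of colour \<open>b\<close>, where induction
  applies. The descent ends at \<open>D = N\<close>: there \<open>z\<close> is a top cycle, hence
  constant on the facets.\<close>

lemma coloured_cycle_sum_of_links:
  assumes "balanced V col N M" "links_spherical V M k (card N)" "D \<subseteq> N" "card D = Suc k"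
    and "chain_on (faces M) (Suc k) z" "\<And>s. z s \<noteq> 0 \<Longrightarrow> col ` s = D" "\<And>t. chain_bd V z t = 0"
  shows "\<exists>\<xi>. \<forall>\<nu>. col ` \<nu> = D \<longrightarrow> z \<nu> = facet_sum M (\<lambda>f. \<xi> (colour_part col (N - D) f)) \<nu>"
  using assms
proof (induction "card N" arbitrary: N M z rule: less_induct)
  case less
  note b = less.prems(1) and g = less.prems(2) and D = less.prems(3,4) and z = less.prems(5,6,7)
  have fin: "finite V" "finite N" "finite D" using b D by (auto simp: balanced_def intro: finite_subset)
  show ?case
  proof (cases "D = N")
    case True
    show ?thesis
    proof (cases "M = {}")
      case True
      then show ?thesis using chain_onD[OF z(1)] by (intro exI[of _ "\<lambda>_. 0"]) (force simp: facet_sum_def faces_def)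
    next
      case False
      then have "{} \<in> faces M" by (auto simp: faces_def)
      with g have "card ({}::'a set) + k + 1 = card N \<longrightarrow> (\<forall>z. chain_on (faces (lk M {})) (Suc k) z \<and> (\<forall>t. chain_bd V z t = 0) \<longrightarrow>
         (\<forall>t. z t = 0) \<or> (\<forall>t\<in>lk M {}. z t = 1))"
        unfolding links_spherical_def by blast
      then have "(\<forall>t. z t = 0) \<or> (\<forall>t\<in>M. z t = 1)"
        using D True z by simp
      then obtain a where a: "\<And>t. t \<in> M \<Longrightarrow> z t = a" by auto
      have "z \<nu> = facet_sum M (\<lambda>_. a) \<nu>" if "col ` \<nu> = D" for \<nu>
      proof (cases "\<nu> \<in> faces M")
        case True
        have *: "f = \<nu>" if "f \<in> M" "\<nu> \<subseteq> f" for f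
          using balanced_facet[OF b that(1)] that \<open>col ` \<nu> = D\<close> \<open>D = N\<close>
          by (metis inj_on_image_eq_iff subset_refl)
        then have "{f \<in> M. \<nu> \<subseteq> f} = {\<nu>}" "\<nu> \<in> M" using True by (auto simp: faces_def)
        then show ?thesis using a by (simp add: facet_sum_def)
      next
        case False
        then show ?thesis using chain_onD[OF z(1)] by (auto simp: facet_sum_eq_0_if_not_face)
      qed
      then show ?thesis by (intro exI[of _ "\<lambda>_. a"]) simp
    qed
  next
    case False
    then obtain b where bb: "b \<in> N" "b \<notin> D" using D by auto
    let ?E = "insert b D"
    have "cycles_bound V (colour_selected col ?E (faces M)) (Suc k)"
      using colour_selected_cycles_bound[OF b g, of ?E] bb D fin by auto
    moreover have "chain_on (colour_selected col ?E (faces M)) (Suc k) z"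
      using z by (force simp: chain_on_def colour_selected_def)
    ultimately obtain w where w: "chain_on (colour_selected col ?E (faces M)) (Suc (Suc k)) w"
      and cw: "\<And>t. chain_bd V w t = z t" using z(3) unfolding cycles_bound_def by blast
    have wE: "col ` s = ?E \<and> s \<in> faces M \<and> card s = Suc (Suc k)" if "w s \<noteq> 0" for s
    proof -
      have s: "s \<in> faces M" "col ` s \<subseteq> ?E" "card s = Suc (Suc k)"
        using chain_onD[OF w that] by (auto simp: colour_selected_def)
      moreover have "col ` s = ?E"
        using s balanced_face[OF b s(1)] fin D bb by (intro card_subset_eq) auto
      ultimately show ?thesis by simp
    qed
    define u where "u v = (\<lambda>s. if v \<in> s then 0 else w (insert v s))" for v
    have cardN: "card N = Suc (card (N - {b}))" using bb fin by (intro card.remove) auto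
    have "\<exists>\<xi>. \<forall>\<nu>. col ` \<nu> = D \<longrightarrow> u v \<nu> = facet_sum (lk M {v}) (\<lambda>f. \<xi> (colour_part col (N - {b} - D) f)) \<nu>"
      if v: "v \<in> V" "col v = b" for v
    proof (rule less.hyps)
      show "card (N - {b}) < card N" "links_spherical V (lk M {v}) k (card (N - {b}))"
        using links_spherical_lk[OF b] g cardN by auto
      show "balanced V col (N - {b}) (lk M {v})" using balanced_lk[OF b] v by auto
      show "D \<subseteq> N - {b}" "card D = Suc k" using bb D by auto
      have us: "s \<in> faces (lk M {v}) \<and> card s = Suc k \<and> col ` s = D" if "u v s \<noteq> 0" for s
      proof -
        have s: "v \<notin> s" "w (insert v s) \<noteq> 0" using that by (auto simp: u_def split: if_splits)
        note s' = wE[OF s(2)]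
        note bf = balanced_face[OF b conjunct1[OF conjunct2[OF s']]]
        have "b \<notin> col ` s" using bf(3) s(1) v(2) by (auto simp: inj_on_def)
        moreover have "insert b (col ` s) = insert b D" using s' v by auto
        ultimately have "col ` s = D" using bb by (metis insert_ident)
        then show ?thesis using s s' bf by (auto simp: faces_lk)
      qed
      then show "chain_on (faces (lk M {v})) (Suc k) (u v)" "\<And>s. u v s \<noteq> 0 \<Longrightarrow> col ` s = D"
        by (auto simp: chain_on_def)
      show "chain_bd V (u v) t = 0" for t
      proof -
        have "chain_bd V w t = 0" if "v \<in> t" for t
          using z(2)[of t] that v bb by (auto simp: cw)
        then show ?thesis
          unfolding u_def using cycle_link[OF fin(1) _ v(1), of w] by blast
      qed
    qed
    then obtain \<xi> where \<xi>: "\<And>v \<nu>. v \<in> V \<Longrightarrow> col v = b \<Longrightarrow> col ` \<nu> = D \<Longrightarrow>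
        u v \<nu> = facet_sum (lk M {v}) (\<lambda>f. \<xi> v (colour_part col (N - {b} - D) f)) \<nu>" by metis
    \<comment> \<open>In a facet, the face with colours \<open>N - D\<close> has one vertex of
      colour \<open>b\<close>, and its value is taken from the solution in the link of that vertex.
      The sum merely selects this vertex.\<close>
    define \<zeta> where "\<zeta> \<delta> = (\<Sum>x\<in>{x\<in>\<delta>. col x = b}. \<xi> x (\<delta> - {x}))" for \<delta>
    have "z \<nu> = facet_sum M (\<lambda>f. \<zeta> (colour_part col (N - D) f)) \<nu>" if \<nu>: "col ` \<nu> = D" for \<nu>
    proof -
      have "z \<nu> = (\<Sum>x\<in>V-\<nu>. w (insert x \<nu>))" by (simp add: cw[symmetric] chain_bd_def)
      also have "\<dots> = (\<Sum>x\<in>{x\<in>V. col x = b}. u x \<nu>)"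
        unfolding u_def
      proof (rule sum.mono_neutral_cong)
        fix i assume "i \<in> (V - \<nu>) - {x \<in> V. col x = b}"
        then have i: "i \<in> V" "i \<notin> \<nu>" "col i \<noteq> b" by auto
        show "w (insert i \<nu>) = 0"
        proof (rule ccontr)
          assume "w (insert i \<nu>) \<noteq> 0"
          from wE[OF this] \<nu> i bb show False by auto
        qed
      qed (use \<nu> bb fin in auto)
      also have "\<dots> = (\<Sum>x\<in>{x\<in>V. col x = b}. facet_sum M (\<lambda>f. \<zeta> (colour_part col (N - D) f)) (insert x \<nu>))"
      proof (intro sum.cong refl)
        fix x assume "x \<in> {x\<in>V. col x = b}"
        then have x: "x \<in> V" "col x = b" "x \<notin> \<nu>" using \<nu> bb by auto
        have "u x \<nu> = facet_sum (lk M {x}) (\<lambda>f. \<xi> x (colour_part col (N - {b} - D) f)) \<nu>"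
          using \<xi> x \<nu> by auto
        also have "\<dots> = facet_sum M (\<lambda>f. \<zeta> (colour_part col (N - D) f)) (insert x \<nu>)"
          unfolding facet_sum_lk[OF x(3)] unfolding facet_sum_def
        proof (intro sum.cong refl)
          fix f assume f: "f \<in> {f \<in> M. insert x \<nu> \<subseteq> f}"
          then have inj: "inj_on col f" using balanced_facet[OF b] by auto
          then have "{y \<in> colour_part col (N - D) f. col y = b} = {x}"
            using f x bb by (auto simp: colour_part_def inj_on_def)
          moreover have "colour_part col (N - {b} - D) (f - {x}) = colour_part col (N - D) f - {x}"
            using f x bb inj by (auto simp: colour_part_def inj_on_def)
          ultimately show "\<xi> x (colour_part col (N - {b} - D) (f - {x})) = \<zeta> (colour_part col (N - D) f)"
            by (simp add: \<zeta>_def)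
        qed
        finally show "u x \<nu> = facet_sum M (\<lambda>f. \<zeta> (colour_part col (N - D) f)) (insert x \<nu>)" .
      qed
      also have "\<dots> = facet_sum M (\<lambda>f. \<zeta> (colour_part col (N - D) f)) \<nu>"
        using facet_sum_split_colour[OF b bb(1)] \<nu> bb by simp
      finally show ?thesis .
    qed
    then show ?thesis by (intro exI[of _ \<zeta>]) simp
  qed
qed

section \<open>Even complexes and chains generated by faces\<close>

definition even_complex :: "'v set set \<Rightarrow> bool" where
  "even_complex M \<longleftrightarrow> (\<forall>t. t \<notin> M \<longrightarrow> even (card {f\<in>M. t \<subseteq> f}))"

lemma even_complex_lk:
  assumes "even_complex M" shows "even_complex (lk M {v})"
  unfolding even_complex_def
proof (intro allI impI)
  fix t assume t: "t \<notin> lk M {v}"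
  show "even (card {f \<in> lk M {v}. t \<subseteq> f})"
  proof (cases "v \<in> t")
    case True
    then have "{f \<in> lk M {v}. t \<subseteq> f} = {}" by (auto simp: lk_def)
    then show ?thesis by (simp only: card.empty even_zero)
  next
    case False
    have "insert v t \<notin> M"
    proof
      assume "insert v t \<in> M"
      then have "insert v t - {v} \<in> lk M {v}" unfolding lk_def by blast
      then show False using False t by simp
    qed
    then have "even (card {f\<in>M. insert v t \<subseteq> f})"
      by (rule assms[unfolded even_complex_def, rule_format])
    moreover have bij: "bij_betw (\<lambda>f. f - {v}) {f\<in>M. insert v t \<subseteq> f} {f \<in> lk M {v}. t \<subseteq> f}"
      using False by (auto simp: bij_betw_def inj_on_def lk_def)
    ultimately show ?thesis using bij_betw_same_card[OF bij] by metis
  qed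
qed

text \<open>The facets through \<open>\<nu>\<close> are grouped by their face
  \<open>\<delta>\<close> with colours \<open>B\<close>, on which the summand depends. A group
  consists of all facets containing \<open>\<nu> \<union> \<delta>\<close>; this set misses a
  colour, so it is no facet and the group is even.\<close>

lemma facet_sum_colour_part_eq_0:
  assumes b: "balanced V col N M" and e: "even_complex M" and "B \<subseteq> N" "col ` \<nu> \<union> B \<noteq> N"
  shows "facet_sum M (\<lambda>f. h (colour_part col B f)) \<nu> = 0"
proof -
  let ?A = "{f\<in>M. \<nu> \<subseteq> f}"
  have finA: "finite ?A" using balanced_finite[OF b] by auto
  have "facet_sum M (\<lambda>f. h (colour_part col B f)) \<nu> = (\<Sum>\<delta>\<in>colour_part col B ` ?A. \<Sum>f\<in>{f\<in>?A. colour_part col B f = \<delta>}. h (colour_part col B f))"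
    unfolding facet_sum_def by (rule sum.image_gen[OF finA])
  also have "\<dots> = (\<Sum>\<delta>\<in>colour_part col B ` ?A. 0)"
  proof (rule sum.cong[OF refl])
    fix \<delta> assume "\<delta> \<in> colour_part col B ` ?A"
    then obtain g where g: "g \<in> M" "\<nu> \<subseteq> g" "\<delta> = colour_part col B g" by auto
    note bg = balanced_facet[OF b g(1)]
    have c\<delta>: "col ` \<delta> = B" using g bg assms(3) by (auto simp: colour_part_def)
    have eq: "{f\<in>?A. colour_part col B f = \<delta>} = {f\<in>M. \<nu> \<union> \<delta> \<subseteq> f}"
    proof (intro equalityI subsetI)
      fix f assume f: "f \<in> {f\<in>M. \<nu> \<union> \<delta> \<subseteq> f}"
      then have bf: "inj_on col f" using balanced_facet[OF b] by auto
      have "colour_part col B f = \<delta>"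
      proof (rule inj_on_image_eq_iff[OF bf, THEN iffD1])
        show "col ` colour_part col B f = col ` \<delta>" using c\<delta> f assms(3) by (auto simp: colour_part_def)
      qed (use f in \<open>auto simp: colour_part_def\<close>)
      then show "f \<in> {f\<in>?A. colour_part col B f = \<delta>}" using f by auto
    qed (auto simp: colour_part_def)
    have "col ` (\<nu> \<union> \<delta>) \<noteq> N" using assms(4) c\<delta> by (simp add: image_Un)
    then have "\<nu> \<union> \<delta> \<notin> M" using balanced_facet(4)[OF b] by metis
    then have "even (card {f\<in>M. \<nu> \<union> \<delta> \<subseteq> f})" using e by (auto simp: even_complex_def)
    then have "of_nat (card {f\<in>M. \<nu> \<union> \<delta> \<subseteq> f}) = (0::bit)" by (auto elim!: evenE)
    moreover have "(\<Sum>f\<in>{f\<in>?A. colour_part col B f = \<delta>}. h (colour_part col B f))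
        = (\<Sum>f\<in>{f\<in>M. \<nu> \<union> \<delta> \<subseteq> f}. h \<delta>)"
      unfolding eq[symmetric] by (intro sum.cong) auto
    ultimately show "(\<Sum>f\<in>{f\<in>?A. colour_part col B f = \<delta>}. h (colour_part col B f)) = 0"
      by simp
  qed
  finally show ?thesis by simp
qed

text \<open>The colours on a facet are distinct, so its faces with \<open>m\<close> vertices
  correspond to sets of \<open>m\<close> colours.\<close>

lemma sum_subsets_by_colour:
  fixes h :: "'v set \<Rightarrow> bit"
  assumes "balanced V col N M" "f \<in> M"
  shows "(\<Sum>\<kappa>\<in>{\<kappa>. \<kappa> \<subseteq> f \<and> card \<kappa> = m}. h \<kappa>) = (\<Sum>B\<in>{B. B \<subseteq> N \<and> card B = m}. h (colour_part col B f))"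
proof -
  note bf = balanced_facet[OF assms]
  have "bij_betw (\<lambda>B. colour_part col B f) {B. B \<subseteq> N \<and> card B = m} {\<kappa>. \<kappa> \<subseteq> f \<and> card \<kappa> = m}"
  proof (rule bij_betw_byWitness[where f' = "image col"])
    have *: "col ` colour_part col B f = B" if "B \<subseteq> N" for B using bf that by (auto simp: colour_part_def)
    then show "\<forall>a\<in>{B. B \<subseteq> N \<and> card B = m}. col ` colour_part col a f = a" by auto
    show "\<forall>a'\<in>{\<kappa>. \<kappa> \<subseteq> f \<and> card \<kappa> = m}. colour_part col (col ` a') f = a'"
      using bf(3) by (auto simp: colour_part_def inj_on_def)
    have "card (colour_part col B f) = card B" if "B \<subseteq> N" for B
    proof -
      have "inj_on col (colour_part col B f)" using bf(3) by (auto simp: colour_part_def inj_on_def)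
      then show ?thesis using *[OF that] card_image by metis
    qed
    then show "(\<lambda>B. colour_part col B f) ` {B. B \<subseteq> N \<and> card B = m} \<subseteq> {\<kappa>. \<kappa> \<subseteq> f \<and> card \<kappa> = m}"
      by (auto simp: colour_part_def)
    show "image col ` {\<kappa>. \<kappa> \<subseteq> f \<and> card \<kappa> = m} \<subseteq> {B. B \<subseteq> N \<and> card B = m}"
      using bf by (auto simp: card_image inj_on_subset)
  qed
  from sum.reindex_bij_betw[OF this, of h] show ?thesis by simp
qed

text \<open>The image of the generalized boundary map from simplices with \<open>m\<close> vertices
  to facets. Only the values of \<open>\<gamma>\<close> on facets count, and \<open>\<beta>\<close>
  needs no support condition because a facet sees only its own subsets.\<close>

definition face_generated :: "'v set set \<Rightarrow> nat \<Rightarrow> 'v chain \<Rightarrow> bool" where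
  "face_generated M m \<gamma> \<longleftrightarrow> (\<exists>\<beta>. \<forall>f\<in>M. \<gamma> f = (\<Sum>\<kappa>\<in>{\<kappa>. \<kappa> \<subseteq> f \<and> card \<kappa> = m}. \<beta> \<kappa>))"

text \<open>Subtracting the generators given by the \<open>\<xi>\<close> leaves a chain whose facet
  sums vanish on all faces with \<open>k + 1\<close> vertices that use the colour \<open>c\<close>.
  Its parts on the stars of the vertices of colour \<open>c\<close> are then independent problems in
  the links, each solved by \<open>loc\<close>. The lemma serves both \<open>L\<close> itself and,
  recursively, the link spheres.\<close>

lemma face_generated_localize:
  assumes b: "balanced V col N M" and e: "even_complex M" and c: "c \<in> N" and k: "k + 2 \<le> card N"
    and \<xi>: "\<And>D. c \<in> D \<Longrightarrow> D \<subseteq> N \<Longrightarrow> card D = Suc k \<Longrightarrow>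
      \<exists>\<xi>. \<forall>\<nu>. col ` \<nu> = D \<longrightarrow> facet_sum M \<gamma> \<nu> = facet_sum M (\<lambda>f. \<xi> (colour_part col (N - D) f)) \<nu>"
    and loc: "\<And>v \<gamma>'. col v = c \<Longrightarrow> (\<And>t. card t = k \<Longrightarrow> t \<in> faces (lk M {v}) \<Longrightarrow> facet_sum (lk M {v}) \<gamma>' t = 0) \<Longrightarrow>
       face_generated (lk M {v}) (card N - k - 2) \<gamma>'"
  shows "face_generated M (card N - k - 1) \<gamma>"
proof -
  have fin: "finite V" "finite N" using b by (auto simp: balanced_def)
  let ?DD = "{D. c \<in> D \<and> D \<subseteq> N \<and> card D = Suc k}"
  have finDD: "finite ?DD" using fin by (auto intro: finite_subset[of _ "Pow N"])
  have "\<forall>D\<in>?DD. \<exists>\<xi>. \<forall>\<nu>. col ` \<nu> = D \<longrightarrow> facet_sum M \<gamma> \<nu> = facet_sum M (\<lambda>f. \<xi> (colour_part col (N - D) f)) \<nu>"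
    using \<xi> by simp
  then obtain \<xi> where "\<forall>D\<in>?DD. \<forall>\<nu>. col ` \<nu> = D \<longrightarrow> facet_sum M \<gamma> \<nu> = facet_sum M (\<lambda>f. \<xi> D (colour_part col (N - D) f)) \<nu>"
    using bchoice[of ?DD "\<lambda>D \<xi>. \<forall>\<nu>. col ` \<nu> = D \<longrightarrow> facet_sum M \<gamma> \<nu> = facet_sum M (\<lambda>f. \<xi> (colour_part col (N - D) f)) \<nu>"] by blast
  then have \<xi>: "facet_sum M \<gamma> \<nu> = facet_sum M (\<lambda>f. \<xi> D (colour_part col (N - D) f)) \<nu>" if "D \<in> ?DD" "col ` \<nu> = D" for D \<nu>
    using that by blast
  define g where "g f = (\<Sum>D\<in>?DD. \<xi> D (colour_part col (N - D) f))" for f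
  define \<gamma>0 where "\<gamma>0 f = \<gamma> f + g f" for f
  have \<gamma>0: "facet_sum M \<gamma>0 \<nu> = 0" if "\<nu> \<in> faces M" "card \<nu> = Suc k" "c \<in> col ` \<nu>" for \<nu>
  proof -
    note bf = balanced_face[OF b that(1)]
    have D: "col ` \<nu> \<in> ?DD" using bf that by auto
    have "facet_sum M g \<nu> = (\<Sum>D\<in>?DD. facet_sum M (\<lambda>f. \<xi> D (colour_part col (N - D) f)) \<nu>)"
      unfolding facet_sum_def g_def by (rule sum.swap)
    also have "\<dots> = (\<Sum>D\<in>{col ` \<nu>}. facet_sum M (\<lambda>f. \<xi> D (colour_part col (N - D) f)) \<nu>)"
    proof (rule sum.mono_neutral_right[OF finDD])
      show "\<forall>D\<in>?DD - {col ` \<nu>}. facet_sum M (\<lambda>f. \<xi> D (colour_part col (N - D) f)) \<nu> = 0"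
      proof
        fix D assume D': "D \<in> ?DD - {col ` \<nu>}"
        \<comment> \<open>All \<open>D\<close> have the same size, so a different \<open>D\<close>
          contains a colour that is neither in \<open>\<nu>\<close> nor in \<open>N - D\<close>, and
          evenness removes its term.\<close>
        have "col ` \<nu> \<union> (N - D) \<noteq> N"
        proof
          assume "col ` \<nu> \<union> (N - D) = N"
          then have "D \<subseteq> col ` \<nu>" using D' by auto
          then have "D = col ` \<nu>" using D D' fin by (intro card_subset_eq) (auto intro: finite_subset)
          then show False using D' by auto
        qed
        then show "facet_sum M (\<lambda>f. \<xi> D (colour_part col (N - D) f)) \<nu> = 0"
          by (intro facet_sum_colour_part_eq_0[OF b e]) auto
      qed
    qed (use D in auto)
    also have "\<dots> = facet_sum M \<gamma> \<nu>" using \<xi>[OF D] by simp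
    finally show ?thesis by (simp add: \<gamma>0_def facet_sum_def sum.distrib)
  qed
  have "face_generated (lk M {v}) (card N - k - 2) (\<lambda>f. \<gamma>0 (insert v f))" if v: "col v = c" for v
  proof (rule loc[OF v])
    fix t assume t: "card t = k" "t \<in> faces (lk M {v})"
    then have t': "v \<notin> t" "insert v t \<in> faces M" by (auto simp: faces_lk)
    have "facet_sum (lk M {v}) (\<lambda>f. \<gamma>0 (insert v f)) t = facet_sum M \<gamma>0 (insert v t)"
      unfolding facet_sum_lk[OF t'(1)] unfolding facet_sum_def by (intro sum.cong) (auto simp: insert_absorb)
    also have "\<dots> = 0" using \<gamma>0[OF t'(2)] t t' v balanced_face(1)[OF b t'(2)] by auto
    finally show "facet_sum (lk M {v}) (\<lambda>f. \<gamma>0 (insert v f)) t = 0" .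
  qed
  then obtain \<beta>v where \<beta>v: "\<And>v f. col v = c \<Longrightarrow> f \<in> lk M {v} \<Longrightarrow> \<gamma>0 (insert v f) =
      (\<Sum>\<kappa>\<in>{\<kappa>. \<kappa> \<subseteq> f \<and> card \<kappa> = card N - k - 2}. \<beta>v v \<kappa>)"
    unfolding face_generated_def by metis
  \<comment> \<open>A face through the vertex \<open>v\<close> of colour \<open>c\<close> carries
    the local solution on its other \<open>card N - k - 2\<close> vertices. A face without colour
    \<open>c\<close> has colour set \<open>N - D\<close> for a single \<open>D\<close> containing
    \<open>c\<close> and carries \<open>\<xi> D\<close>.\<close>
  define \<beta> where "\<beta> \<kappa> = (if c \<in> col ` \<kappa> then (\<Sum>v\<in>{v\<in>\<kappa>. col v = c}. \<beta>v v (\<kappa> - {v})) else \<xi> (N - col ` \<kappa>) \<kappa>)" for \<kappa>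
  let ?m = "card N - k - 1"
  have "\<gamma> f = (\<Sum>\<kappa>\<in>{\<kappa>. \<kappa> \<subseteq> f \<and> card \<kappa> = ?m}. \<beta> \<kappa>)" if f: "f \<in> M" for f
  proof -
    note bf = balanced_facet[OF b f]
    obtain v where v: "v \<in> f" "col v = c" "v \<in> V" "\<And>x. x \<in> f \<Longrightarrow> col x = c \<longleftrightarrow> x = v"
      using obtain_vertex_of_colour[OF b f c] by metis
    have fin': "finite {\<kappa>. \<kappa> \<subseteq> f \<and> card \<kappa> = ?m}" using bf by auto
    have "(\<Sum>\<kappa>\<in>{\<kappa>. \<kappa> \<subseteq> f \<and> card \<kappa> = ?m}. \<beta> \<kappa>)
        = (\<Sum>\<kappa>\<in>{\<kappa>. \<kappa> \<subseteq> f \<and> card \<kappa> = ?m} \<inter> {\<kappa>. v \<in> \<kappa>}. \<beta> \<kappa>)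
          + (\<Sum>\<kappa>\<in>{\<kappa>. \<kappa> \<subseteq> f \<and> card \<kappa> = ?m} \<inter> - {\<kappa>. v \<in> \<kappa>}. \<beta> \<kappa>)"
      using fin' by (subst sum.union_disjoint[symmetric]) (auto intro!: sum.cong)
    also have "(\<Sum>\<kappa>\<in>{\<kappa>. \<kappa> \<subseteq> f \<and> card \<kappa> = ?m} \<inter> {\<kappa>. v \<in> \<kappa>}. \<beta> \<kappa>) = \<gamma>0 f"
    proof -
      have fl: "f - {v} \<in> lk M {v}" using f v by (auto simp: lk_def)
      have "\<gamma>0 f = (\<Sum>\<kappa>\<in>{\<kappa>. \<kappa> \<subseteq> f - {v} \<and> card \<kappa> = card N - k - 2}. \<beta>v v \<kappa>)"
        using \<beta>v[OF v(2) fl] v(1) by (simp add: insert_absorb)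
      also have "\<dots> = (\<Sum>\<kappa>\<in>{\<kappa>. \<kappa> \<subseteq> f \<and> card \<kappa> = ?m} \<inter> {\<kappa>. v \<in> \<kappa>}. \<beta> \<kappa>)"
      proof (rule sum.reindex_bij_witness[where i = "\<lambda>\<kappa>. \<kappa> - {v}" and j = "insert v"])
        fix a assume a: "a \<in> {\<kappa>. \<kappa> \<subseteq> f - {v} \<and> card \<kappa> = card N - k - 2}"
        then have fa: "finite a" "v \<notin> a" using bf by (auto intro: finite_subset)
        then show "insert v a - {v} = a" by auto
        show "insert v a \<in> {\<kappa>. \<kappa> \<subseteq> f \<and> card \<kappa> = ?m} \<inter> {\<kappa>. v \<in> \<kappa>}"
          using a fa v k by auto
        have "{x \<in> insert v a. col x = c} = {v}" using a v by auto
        then show "\<beta> (insert v a) = \<beta>v v a" using fa v by (auto simp: \<beta>_def)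
      next
        fix a assume a: "a \<in> {\<kappa>. \<kappa> \<subseteq> f \<and> card \<kappa> = ?m} \<inter> {\<kappa>. v \<in> \<kappa>}"
        then have fa: "finite a" using bf by (auto intro: finite_subset)
        then show "a - {v} \<in> {\<kappa>. \<kappa> \<subseteq> f - {v} \<and> card \<kappa> = card N - k - 2}" using a by auto
        show "insert v (a - {v}) = a" using a by auto
      qed
      finally show ?thesis by simp
    qed
    also have "(\<Sum>\<kappa>\<in>{\<kappa>. \<kappa> \<subseteq> f \<and> card \<kappa> = ?m} \<inter> - {\<kappa>. v \<in> \<kappa>}. \<beta> \<kappa>) = g f"
    proof -
      have "(\<Sum>\<kappa>\<in>{\<kappa>. \<kappa> \<subseteq> f \<and> card \<kappa> = ?m} \<inter> - {\<kappa>. v \<in> \<kappa>}. \<beta> \<kappa>)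
          = (\<Sum>\<kappa>\<in>{\<kappa>. \<kappa> \<subseteq> f \<and> card \<kappa> = ?m}. if c \<in> col ` \<kappa> then 0 else \<xi> (N - col ` \<kappa>) \<kappa>)"
        using v fin' by (intro sum.mono_neutral_cong_left) (auto simp: \<beta>_def)
      also have "\<dots> = (\<Sum>B\<in>{B. B \<subseteq> N \<and> card B = ?m}.
           if c \<in> col ` colour_part col B f then 0 else \<xi> (N - col ` colour_part col B f) (colour_part col B f))"
        by (rule sum_subsets_by_colour[OF b f])
      also have "\<dots> = (\<Sum>B\<in>{B. B \<subseteq> N \<and> card B = ?m}. if c \<in> B then 0 else \<xi> (N - B) (colour_part col B f))"
      proof (intro sum.cong refl)
        fix B assume "B \<in> {B. B \<subseteq> N \<and> card B = ?m}"
        then have "col ` colour_part col B f = B" using bf by (auto simp: colour_part_def)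
        then show "(if c \<in> col ` colour_part col B f then 0 else \<xi> (N - col ` colour_part col B f) (colour_part col B f))
          = (if c \<in> B then 0 else \<xi> (N - B) (colour_part col B f))" by simp
      qed
      also have "\<dots> = (\<Sum>B\<in>{B. B \<subseteq> N - {c} \<and> card B = ?m}. \<xi> (N - B) (colour_part col B f))"
        using fin by (intro sum.mono_neutral_cong_right) auto
      also have "\<dots> = g f"
        unfolding g_def
      proof (rule sum.reindex_bij_witness[where i = "\<lambda>D. N - D" and j = "\<lambda>B. N - B"])
        fix B assume B: "B \<in> {B. B \<subseteq> N - {c} \<and> card B = ?m}"
        then have "card (N - B) = card N - card B" using fin by (intro card_Diff_subset) (auto intro: finite_subset)
        then show "N - B \<in> ?DD" using B c k by auto
        show "N - (N - B) = B" using B by auto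
        then show "\<xi> (N - B) (colour_part col (N - (N - B)) f) = \<xi> (N - B) (colour_part col B f)" by simp
      next
        fix D assume D: "D \<in> ?DD"
        then have "card (N - D) = card N - card D" using fin by (intro card_Diff_subset) (auto intro: finite_subset)
        then show "N - D \<in> {B. B \<subseteq> N - {c} \<and> card B = ?m}" using D by auto
        show "N - (N - D) = D" using D by auto
      qed
      finally show ?thesis .
    qed
    finally show ?thesis by (simp add: \<gamma>0_def add.assoc)
  qed
  then show ?thesis unfolding face_generated_def by blast
qed

text \<open>The local statement: in a spherical complex a zero syndrome forces a stabilizer. The
  part of \<open>facet_sum M \<gamma>\<close> with colour set \<open>D\<close> is a cycle, since its
  boundary at a simplex \<open>t\<close> lacking one colour of \<open>D\<close> is a sum over the
  vertices of that colour and collapses to \<open>facet_sum M \<gamma> t\<close>. Hence it is a sum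
  of links, and localizing at any colour reduces the claim to smaller links.\<close>

lemma face_generated_if_facet_sum_0:
  assumes "balanced V col N M" "links_spherical V M k (card N)" "even_complex M" "k + 1 \<le> card N"
    and "\<And>t. card t = k \<Longrightarrow> t \<in> faces M \<Longrightarrow> facet_sum M \<gamma> t = 0"
  shows "face_generated M (card N - k - 1) \<gamma>"
  using assms
proof (induction "card N" arbitrary: N M \<gamma> rule: less_induct)
  case less
  note b = less.prems(1) and g = less.prems(2) and e = less.prems(3) and k = less.prems(4) and \<gamma> = less.prems(5)
  have fin: "finite V" "finite N" using b by (auto simp: balanced_def)
  have \<xi>: "\<exists>\<xi>. \<forall>\<nu>. col ` \<nu> = D \<longrightarrow> facet_sum M \<gamma> \<nu> = facet_sum M (\<lambda>f. \<xi> (colour_part col (N - D) f)) \<nu>"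
    if D: "D \<subseteq> N" "card D = Suc k" for D
  proof -
    define z where "z \<nu> = (if col ` \<nu> = D then facet_sum M \<gamma> \<nu> else 0)" for \<nu>
    have zf: "s \<in> faces M \<and> card s = Suc k \<and> col ` s = D" if "z s \<noteq> 0" for s
    proof -
      have "col ` s = D" "s \<in> faces M" using that facet_sum_eq_0_if_not_face by (auto simp: z_def split: if_splits)
      then show ?thesis using balanced_face[OF b] D by metis
    qed
    have "chain_bd V z t = 0" for t
    proof (cases "\<exists>x\<in>V - t. z (insert x t) \<noteq> 0")
      case False
      then show ?thesis unfolding chain_bd_def by (intro sum.neutral) auto
    next
      case True
      then obtain x where x: "x \<in> V - t" "z (insert x t) \<noteq> 0" by auto
      note zx = zf[OF x(2)]
      note bx = balanced_face[OF b conjunct1[OF zx]]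
      have xt: "col x \<notin> col ` t" using bx(3) x(1) by (auto simp: inj_on_def)
      have t: "card t = k" "t \<in> faces M" using zx bx x by (auto intro: faces_mono)
      have it: "i \<notin> t" if "col i = col x" for i using xt that by (metis imageI)
      have D': "D = insert (col x) (col ` t)" using zx by auto
      have "chain_bd V z t = (\<Sum>y\<in>{y\<in>V. col y = col x}. facet_sum M \<gamma> (insert y t))"
        unfolding chain_bd_def
      proof (rule sum.mono_neutral_cong)
        fix i assume "i \<in> (V - t) - {y \<in> V. col y = col x}"
        then show "z (insert i t) = 0" using D' xt by (auto simp: z_def)
      next
        fix i assume "i \<in> (V - t) \<inter> {y \<in> V. col y = col x}"
        then show "z (insert i t) = facet_sum M \<gamma> (insert i t)" using D' by (auto simp: z_def)
      qed (use it fin in auto)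
      also have "\<dots> = facet_sum M \<gamma> t"
        using facet_sum_split_colour[OF b _ xt] D D' by auto
      also have "\<dots> = 0" using \<gamma> t by auto
      finally show ?thesis .
    qed
    then have "\<exists>\<xi>. \<forall>\<nu>. col ` \<nu> = D \<longrightarrow> z \<nu> = facet_sum M (\<lambda>f. \<xi> (colour_part col (N - D) f)) \<nu>"
      using zf by (intro coloured_cycle_sum_of_links[OF b g D]) (auto simp: chain_on_def)
    then show ?thesis by (simp add: z_def)
  qed
  show ?case
  proof (cases "card N = Suc k")
    case True
    from \<xi>[OF subset_refl True] obtain \<xi> where \<xi>: "\<And>\<nu>. col ` \<nu> = N \<Longrightarrow> facet_sum M \<gamma> \<nu> = facet_sum M (\<lambda>f. \<xi> (colour_part col {} f)) \<nu>"
      by auto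
    \<comment> \<open>Here \<open>card N - k - 1 = 0\<close>: the chain is constant on the facets
      and generated by the empty simplex.\<close>
    have "\<gamma> f = \<xi> {}" if f: "f \<in> M" for f
    proof -
      have "f' = f" if "f' \<in> M" "f \<subseteq> f'" for f'
        using card_subset_eq[OF balanced_facet(1)[OF b that(1)] that(2)] balanced_facet(5)[OF b] f that(1) by simp
      then have "{f'\<in>M. f \<subseteq> f'} = {f}" using f by blast
      then show ?thesis using \<xi>[of f] f balanced_facet[OF b f] by (simp add: facet_sum_def colour_part_def)
    qed
    moreover have "{\<kappa>. \<kappa> \<subseteq> f \<and> card \<kappa> = 0} = {{}}" if "f \<in> M" for f
      using finite_subset[OF _ balanced_facet(1)[OF b that]] by auto
    ultimately show ?thesis unfolding face_generated_def using True by (intro exI[of _ \<xi>]) simp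
  next
    case False
    then obtain c where c: "c \<in> N" using k by fastforce
    have cardN: "card N = Suc (card (N - {c}))" using c fin by (intro card.remove) auto
    show ?thesis
    proof (rule face_generated_localize[OF b e c])
      show "k + 2 \<le> card N" using k False by auto
    next
      fix D assume "c \<in> D" "D \<subseteq> N" "card D = Suc k"
      then show "\<exists>\<xi>. \<forall>\<nu>. col ` \<nu> = D \<longrightarrow> facet_sum M \<gamma> \<nu> = facet_sum M (\<lambda>f. \<xi> (colour_part col (N - D) f)) \<nu>"
        using \<xi> by blast
    next
      fix v \<gamma>'
      assume v: "col v = c" and \<gamma>': "\<And>t. card t = k \<Longrightarrow> t \<in> faces (lk M {v}) \<Longrightarrow> facet_sum (lk M {v}) \<gamma>' t = 0"
      have "face_generated (lk M {v}) (card (N - {c}) - k - 1) \<gamma>'"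
      proof (rule less.hyps)
        show "card (N - {c}) < card N" "k + 1 \<le> card (N - {c})" using cardN k False by linarith+
        show "balanced V col (N - {c}) (lk M {v})" by (rule balanced_lk[OF b v])
        show "links_spherical V (lk M {v}) k (card (N - {c}))" using links_spherical_lk[OF b] g cardN by metis
        show "even_complex (lk M {v})" by (rule even_complex_lk[OF e])
      qed (rule \<gamma>')
      moreover have "card (N - {c}) - k - 1 = card N - k - 2" using cardN by linarith
      ultimately show "face_generated (lk M {v}) (card N - k - 2) \<gamma>'" by metis
    qed
  qed
qed

section \<open>Punctured spheres\<close>

text \<open>The segment from \<open>q\<close> to the antipode of \<open>p\<close> is projected back
  to the sphere. If a point of it were \<open>s * p\<close> with \<open>s \<ge> 0\<close>, then
  \<open>(1 - t) * q = (s + t) * p\<close>; comparing norms gives \<open>1 - t = s + t\<close>,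
  which is then positive, so \<open>q = p\<close>.\<close>

lemma contractible_nsphere_minus_point:
  assumes p: "p \<in> topspace (nsphere n)"
  shows "contractible_space (subtopology (nsphere n) (- {p}))"
proof -
  have p': "(\<Sum>i\<le>n. (p i)\<^sup>2) = 1" "\<And>i. i > n \<Longrightarrow> p i = 0" using p by (auto simp: nsphere)
  let ?Y = "subtopology (nsphere n) (- {p})"
  let ?g = "\<lambda>x i. x i / sqrt (\<Sum>j\<le>n. (x j)\<^sup>2)"
  let ?h = "\<lambda>(t,q) i. (1 - t) * q i - t * p i"
  \<comment> \<open>\<open>?Z\<close> is Euclidean space of dimension \<open>n + 1\<close> without
    the closed ray from the origin through \<open>p\<close>; normalization is continuous there and
    never takes the value \<open>p\<close>.\<close>
  let ?Z = "subtopology (powertop_real UNIV)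
     {x. (\<forall>i>n. x i = 0) \<and> (\<exists>i\<le>n. x i \<noteq> 0) \<and> (\<forall>s\<ge>0. x \<noteq> (\<lambda>i. s * p i))}"
  have scal: "s = t" if "(\<lambda>i. s * q i) = (\<lambda>i. t * r i)" "(\<Sum>i\<le>n. (q i)\<^sup>2) = 1" "(\<Sum>i\<le>n. (r i)\<^sup>2) = 1" "s \<ge> 0" "t \<ge> 0"
    for s t :: real and q r :: "nat \<Rightarrow> real"
  proof -
    have "(\<Sum>i\<le>n. (s * q i)\<^sup>2) = (\<Sum>i\<le>n. (t * r i)\<^sup>2)"
      using that(1) by (metis (no_types, lifting))
    then have "s\<^sup>2 = t\<^sup>2" using that(2,3) by (simp add: power_mult_distrib flip: sum_distrib_left)
    then show ?thesis using that(4,5) by (simp add: power2_eq_iff_nonneg)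
  qed
  have nz: "\<forall>s\<ge>0. (\<lambda>i. (1 - t) * q i - t * p i) \<noteq> (\<lambda>i. s * p i)"
    if q: "(\<Sum>i\<le>n. (q i)\<^sup>2) = 1" "q \<noteq> p" and t: "0 \<le> t" "t \<le> 1" for q t
  proof (intro allI impI notI)
    fix s :: real assume s: "s \<ge> 0" "(\<lambda>i. (1 - t) * q i - t * p i) = (\<lambda>i. s * p i)"
    then have eq: "(\<lambda>i. (1 - t) * q i) = (\<lambda>i. (s + t) * p i)"
      by (auto simp: fun_eq_iff algebra_simps)
    then have "1 - t = s + t" using scal[OF eq q(1) p'(1)] s t by auto
    then have "1 - t > 0" "\<And>i. (1 - t) * q i = (1 - t) * p i" using s t eq by (auto simp: fun_eq_iff)
    then have "q = p" by (auto simp: fun_eq_iff)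
    then show False using q by simp
  qed
  have ex: "\<exists>i\<le>n. (1 - t) * q i - t * p i \<noteq> 0"
    if q: "(\<Sum>i\<le>n. (q i)\<^sup>2) = 1" "\<forall>i>n. q i = 0" "q \<noteq> p" and t: "0 \<le> t" "t \<le> 1" for q t
  proof (rule ccontr)
    assume "\<not> ?thesis"
    then have "\<And>i. (1 - t) * q i - t * p i = 0 * p i" using q(2) p'(2) by (metis diff_self mult_zero_left mult_zero_right not_le)
    then have "(\<lambda>i. (1 - t) * q i - t * p i) = (\<lambda>i. 0 * p i)" by (rule ext)
    then show False using nz[OF q(1,3) t, rule_format, of 0] by simp
  qed
  have "continuous_map (prod_topology (top_of_set {0..1}) ?Y) ?Y (?g \<circ> ?h)"
  proof (rule continuous_map_compose)
    show "continuous_map (prod_topology (top_of_set {0..1}) ?Y) ?Z ?h"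
      unfolding continuous_map_in_subtopology
    proof
      show "continuous_map (prod_topology (top_of_set {0..1}) ?Y) (powertop_real UNIV) ?h"
        unfolding continuous_map_componentwise_UNIV case_prod_unfold
      proof
        fix k
        have 1: "continuous_map (prod_topology (top_of_set {0..1}) ?Y) euclideanreal fst"
          by (metis continuous_map_fst continuous_map_in_subtopology)
        have 2: "continuous_map (prod_topology (top_of_set {0..1}) ?Y) euclideanreal ((\<lambda>x. x k) \<circ> snd)"
          by (rule continuous_map_compose[OF continuous_map_snd])
             (intro continuous_map_from_subtopology continuous_map_nsphere_projection)
        show "continuous_map (prod_topology (top_of_set {0..1}) ?Y) euclideanreal (\<lambda>x. (1 - fst x) * snd x k - fst x * p k)"
          using 2 unfolding o_def by (intro continuous_intros 1)
      qed
      show "?h \<in> topspace (prod_topology (top_of_set {0..1}) ?Y) \<rightarrow> {x. (\<forall>i>n. x i = 0) \<and> (\<exists>i\<le>n. x i \<noteq> 0) \<and> (\<forall>s\<ge>0. x \<noteq> (\<lambda>i. s * p i))}"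
        using nz ex p' by (auto simp: nsphere)
    qed
  next
    have pos: "(\<Sum>j\<le>n. (x j)\<^sup>2) > 0" if "\<exists>i\<le>n. x i \<noteq> 0" for x :: "nat \<Rightarrow> real"
      using that by (metis atMost_iff finite_atMost sum_pos2 zero_le_power2 zero_less_power2)
    have "continuous_map ?Z (powertop_real UNIV) ?g"
      unfolding continuous_map_componentwise_UNIV
    proof
      fix k
      have c: "continuous_map ?Z euclideanreal (\<lambda>x. x i)" for i
        by (intro continuous_map_from_subtopology continuous_map_product_projection) simp
      show "continuous_map ?Z euclideanreal (\<lambda>x. x k / sqrt (\<Sum>j\<le>n. (x j)\<^sup>2))"
        using pos by (intro continuous_intros c) fastforce+
    qed
    moreover have "?g x \<in> {x. (\<Sum>i\<le>n. (x i)\<^sup>2) = 1 \<and> (\<forall>i>n. x i = 0)} \<inter> - {p}"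
      if x: "x \<in> topspace ?Z" for x
    proof -
      have *: "\<forall>i>n. x i = 0" "\<exists>i\<le>n. x i \<noteq> 0" "\<And>s. s \<ge> 0 \<Longrightarrow> x \<noteq> (\<lambda>i. s * p i)" using x by auto
      note ps = pos[OF *(2)]
      have "(\<Sum>i\<le>n. (?g x i)\<^sup>2) = 1"
        using ps by (simp add: power_divide flip: sum_divide_distrib)
      moreover have "?g x \<noteq> p"
      proof
        assume "?g x = p"
        then have "x i / sqrt (\<Sum>j\<le>n. (x j)\<^sup>2) = p i" for i by (rule fun_cong)
        then have "x i = sqrt (\<Sum>j\<le>n. (x j)\<^sup>2) * p i" for i
          using ps by (metis nonzero_mult_div_cancel_left order_less_irrefl real_sqrt_gt_0_iff times_divide_eq_right)
        then have "x = (\<lambda>i. sqrt (\<Sum>j\<le>n. (x j)\<^sup>2) * p i)" by (rule ext)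
        then show False using *(3)[of "sqrt (\<Sum>j\<le>n. (x j)\<^sup>2)"] ps by (simp add: less_imp_le)
      qed
      ultimately show ?thesis using * by auto
    qed
    ultimately show "continuous_map ?Z ?Y ?g"
      unfolding nsphere subtopology_subtopology continuous_map_in_subtopology by blast
  qed
  moreover have "(?g \<circ> ?h) (0, x) = x" if "x \<in> topspace ?Y" for x
    using that by (simp add: nsphere)
  moreover have "(?g \<circ> ?h) (1, x) = (\<lambda>i. - p i)" for x
    using p' by simp
  ultimately have "homotopic_with (\<lambda>_. True) ?Y ?Y id (\<lambda>_ i. - p i)"
    by (subst homotopic_with; (intro exI[of _ "?g \<circ> ?h"])?) simp_all
  then show ?thesis unfolding contractible_space_def by (intro exI[of _ "\<lambda>i. - p i"])
qed

lemma contractible_homeomorphic_nsphere_minus_point: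
  assumes "X homeomorphic_space nsphere n" "x \<in> topspace X"
  shows "contractible_space (subtopology X (- {x}))"
proof -
  obtain f g where fg: "homeomorphic_maps X (nsphere n) f g"
    using assms(1) by (auto simp: homeomorphic_space_def)
  have fx: "f x \<in> topspace (nsphere n)"
    using fg assms(2) by (auto simp: homeomorphic_maps_def continuous_map_def)
  have gf: "g (f y) = y" if "y \<in> topspace X" for y
    using fg that unfolding homeomorphic_maps_def by blast
  have fg': "f (g y) = y" if "y \<in> topspace (nsphere n)" for y
    using fg that unfolding homeomorphic_maps_def by blast
  have "f ` (topspace X \<inter> - {x}) \<subseteq> - {f x}"
  proof
    fix z assume "z \<in> f ` (topspace X \<inter> - {x})"
    then obtain y where "y \<in> topspace X" "y \<noteq> x" "z = f y" by auto
    then show "z \<in> - {f x}" using gf assms(2) by (metis ComplI singletonD)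
  qed
  moreover have "g ` (topspace (nsphere n) \<inter> - {f x}) \<subseteq> - {x}" using fg' by auto
  ultimately have "subtopology X (- {x}) homeomorphic_space subtopology (nsphere n) (- {f x})"
    unfolding homeomorphic_space_def using homeomorphic_maps_subtopologies_alt[OF fg] by blast
  then show ?thesis
    using contractible_nsphere_minus_point[OF fx] homeomorphic_space_contractibility by blast
qed

section \<open>From singular to simplicial chains mod 2\<close>

text \<open>Evaluation on an integral chain of the mod 2 cochain with value \<open>\<phi> f\<close>
  on the generator \<open>f\<close>.\<close>

definition mod2 :: "('a \<Rightarrow> bit) \<Rightarrow> ('a \<Rightarrow>\<^sub>0 int) \<Rightarrow> bit" where
  "mod2 \<phi> c = (\<Sum>f\<in>Poly_Mapping.keys c. of_int (poly_mapping.lookup c f) * \<phi> f)"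

lemma mod2_superset:
  assumes "finite F" "Poly_Mapping.keys c \<subseteq> F"
  shows "mod2 \<phi> c = (\<Sum>f\<in>F. of_int (poly_mapping.lookup c f) * \<phi> f)"
  unfolding mod2_def using assms
  by (intro sum.mono_neutral_left) (auto simp: in_keys_iff)

lemma mod2_0 [simp]: "mod2 \<phi> 0 = 0"
  by (simp add: mod2_def)

lemma mod2_of [simp]: "mod2 \<phi> (frag_of f) = \<phi> f"
  by (simp add: mod2_def)

lemma mod2_add: "mod2 \<phi> (a + b) = mod2 \<phi> a + mod2 \<phi> b"
proof -
  let ?F = "Poly_Mapping.keys a \<union> Poly_Mapping.keys b"
  have "Poly_Mapping.keys (a + b) \<subseteq> ?F" by (rule keys_add)
  then show ?thesis
    using mod2_superset[of ?F] by (simp add: lookup_add distrib_right sum.distrib)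
qed

lemma mod2_cmul: "mod2 \<phi> (frag_cmul k a) = of_int k * mod2 \<phi> a"
  using mod2_superset[of "Poly_Mapping.keys a" "frag_cmul k a" \<phi>] keys_cmul[of k a]
  by (simp add: mod2_def sum_distrib_left mult.assoc)

lemma mod2_diff: "mod2 \<phi> (a - b) = mod2 \<phi> a + mod2 \<phi> b"
  using mod2_add[of \<phi> a "frag_cmul (-1) b"] mod2_cmul[of \<phi> "-1" b] by simp

lemma mod2_sum: "mod2 \<phi> (\<Sum>i\<in>I. c i) = (\<Sum>i\<in>I. mod2 \<phi> (c i))"
  by (induction I rule: infinite_finite_induct) (simp_all add: mod2_add)

text \<open>Keeping the support makes \<open>w\<close> a singular chain in every space that carries
  \<open>c\<close>.\<close>

lemma frag_even_imp_double:
  assumes "\<And>f. even (poly_mapping.lookup c f)"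
  shows "\<exists>w. c = frag_cmul 2 w \<and> Poly_Mapping.keys w = Poly_Mapping.keys c"
proof -
  have "finite {f. poly_mapping.lookup c f div 2 \<noteq> 0}"
    by (rule finite_subset[OF _ finite_keys[of c]]) (auto simp: in_keys_iff)
  then have l: "poly_mapping.lookup (Abs_poly_mapping (\<lambda>f. poly_mapping.lookup c f div 2)) f = poly_mapping.lookup c f div 2" for f
    by (simp add: lookup_Abs_poly_mapping)
  have "c = frag_cmul 2 (Abs_poly_mapping (\<lambda>f. poly_mapping.lookup c f div 2))"
    using assms by (intro poly_mapping_eqI) (simp add: l)
  moreover have "Poly_Mapping.keys (Abs_poly_mapping (\<lambda>f. poly_mapping.lookup c f div 2)) = Poly_Mapping.keys c"
  proof -
    have h: "poly_mapping.lookup c f div 2 = 0 \<longleftrightarrow> poly_mapping.lookup c f = 0" for f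
    using assms[of f] by (elim evenE) simp
    show ?thesis by (rule Set.set_eqI) (simp only: in_keys_iff l h not_False_eq_True)
  qed
  ultimately show ?thesis by blast
qed

text \<open>The coface map that skips \<open>k\<close>.\<close>

definition face_index :: "nat \<Rightarrow> nat \<Rightarrow> nat" where
  "face_index k i = (if i < k then i else Suc i)"

lemma bij_face_index: "k \<le> Suc p \<Longrightarrow> bij_betw (face_index k) {..p} ({..Suc p} - {k})"
  by (rule bij_betw_byWitness[where f' = "\<lambda>j. if j < k then j else j - 1"])
     (auto simp: face_index_def)

text \<open>The simplex spanned by the vertices \<open>a 0, \<dots>, a p\<close> as a mod 2 chain, evaluated at \<open>s\<close>; degenerate simplices are zero.\<close>
definition vertex_set_val :: "nat \<Rightarrow> (nat \<Rightarrow> 'v) \<Rightarrow> 'v set \<Rightarrow> bit" where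
  "vertex_set_val p a s = of_bool (inj_on a {..p} \<and> a ` {..p} = s)"

text \<open>If the vertices are distinct, the faces are the sets with one vertex removed. If
  \<open>a i = a j\<close>, every face except those omitting \<open>i\<close> or \<open>j\<close> is
  degenerate, and these two have the same value, so they cancel mod 2.\<close>

lemma vertex_set_val_boundary:
  assumes "finite V" "a ` {..Suc p} \<subseteq> V"
  shows "(\<Sum>k\<le>Suc p. vertex_set_val p (a \<circ> face_index k) t)
       = (\<Sum>v\<in>V-t. vertex_set_val (Suc p) a (insert v t))"
proof -
  have val: "vertex_set_val p (a \<circ> face_index k) t = of_bool (inj_on a ({..Suc p} - {k}) \<and> a ` ({..Suc p} - {k}) = t)"
    if "k \<le> Suc p" for k
  proof -
    note bij = bij_face_index[OF that]
    have im: "face_index k ` {..p} = {..Suc p} - {k}" using bij by (simp add: bij_betw_def)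
    have "inj_on (a \<circ> face_index k) {..p} \<longleftrightarrow> inj_on a ({..Suc p} - {k})"
      using comp_inj_on_iff[of "face_index k" "{..p}" a] bij im by (simp add: bij_betw_def)
    moreover have "(a \<circ> face_index k) ` {..p} = a ` ({..Suc p} - {k})"
      by (metis im image_comp)
    ultimately show ?thesis by (simp add: vertex_set_val_def)
  qed
  show ?thesis
  proof (cases "inj_on a {..Suc p}")
    case True
    have "(\<Sum>k\<le>Suc p. vertex_set_val p (a \<circ> face_index k) t)
        = (\<Sum>k\<le>Suc p. of_bool (a ` {..Suc p} = insert (a k) t \<and> a k \<notin> t))"
    proof (intro sum.cong refl)
      fix k assume k: "k \<in> {..Suc p}"
      have "inj_on a ({..Suc p} - {k})" using True by (rule inj_on_subset) auto
      moreover have "a ` ({..Suc p} - {k}) = a ` {..Suc p} - {a k}"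
        using True k by (subst inj_on_image_set_diff[OF True]) auto
      ultimately show "vertex_set_val p (a \<circ> face_index k) t = of_bool (a ` {..Suc p} = insert (a k) t \<and> a k \<notin> t)"
        using k by (subst val) auto
    qed
    also have "\<dots> = (\<Sum>v\<in>a ` {..Suc p}. of_bool (a ` {..Suc p} = insert v t \<and> v \<notin> t))"
      by (simp add: sum.reindex[OF True])
    also have "\<dots> = (\<Sum>v\<in>V-t. vertex_set_val (Suc p) a (insert v t))"
      using assms True by (intro sum.mono_neutral_cong) (auto simp: vertex_set_val_def)
    finally show ?thesis .
  next
    case False
    then obtain i j where ij: "i \<le> Suc p" "j \<le> Suc p" "i \<noteq> j" "a i = a j"
      by (auto simp: inj_on_def)
    have "vertex_set_val p (a \<circ> face_index k) t = 0" if k: "k \<le> Suc p" "k \<noteq> i" "k \<noteq> j" for k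
    proof -
      have "\<not> inj_on a ({..Suc p} - {k})" using ij k by (auto simp: inj_on_def)
      then show ?thesis using val[OF k(1)] by simp
    qed
    then have "(\<Sum>k\<le>Suc p. vertex_set_val p (a \<circ> face_index k) t)
        = (\<Sum>k\<in>{i,j}. vertex_set_val p (a \<circ> face_index k) t)"
      using ij by (intro sum.mono_neutral_right) auto
    also have "\<dots> = vertex_set_val p (a \<circ> face_index i) t + vertex_set_val p (a \<circ> face_index j) t"
      using ij by simp
    also have "vertex_set_val p (a \<circ> face_index i) t = vertex_set_val p (a \<circ> face_index j) t"
    proof -
      have im: "a ` ({..Suc p} - {i}) = a ` ({..Suc p} - {j})"
      proof -
        have "a ` ({..Suc p} - {x}) = a ` {..Suc p}" if "x = i \<or> x = j" for x
        proof -
          have "a x \<in> a ` ({..Suc p} - {x})" 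
          proof -
            obtain y where "y \<in> {..Suc p} - {x}" "a y = a x" using \<open>x = i \<or> x = j\<close> ij by (metis Diff_iff atMost_iff singletonD)
            then show ?thesis by (metis imageI)
          qed
          then have "a ` insert x ({..Suc p} - {x}) = a ` ({..Suc p} - {x})" by auto
          moreover have "insert x ({..Suc p} - {x}) = {..Suc p}" using that ij by auto
          ultimately show ?thesis by metis
        qed
        then show ?thesis by simp
      qed
      have "card ({..Suc p} - {i}) = card ({..Suc p} - {j})" using ij by (simp add: card_Diff_singleton)
      then have "inj_on a ({..Suc p} - {i}) \<longleftrightarrow> inj_on a ({..Suc p} - {j})"
        using im by (simp add: inj_on_iff_eq_card)
      then show ?thesis using im val ij by simp
    qed
    finally have "(\<Sum>k\<le>Suc p. vertex_set_val p (a \<circ> face_index k) t) = 0" by (simp only: bit_add_self)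
    moreover have "(\<Sum>v\<in>V-t. vertex_set_val (Suc p) a (insert v t)) = 0"
      using False by (simp add: vertex_set_val_def)
    ultimately show ?thesis by (simp only:)
  qed
qed

definition vertex_image :: "('a \<Rightarrow> 'v) \<Rightarrow> ((nat \<Rightarrow> real) \<Rightarrow> 'a) \<Rightarrow> nat \<Rightarrow> 'v" where
  "vertex_image lam f i = lam (f (\<lambda>j. if j = i then 1 else 0))"

text \<open>Pushes a singular chain to a simplicial one by labelling the corners through
  \<open>lam\<close> and dropping simplices with repeated labels. Since signs disappear mod 2, this
  commutes with the boundary.\<close>

definition simplicial_val :: "('a \<Rightarrow> 'v) \<Rightarrow> nat \<Rightarrow> (((nat \<Rightarrow> real) \<Rightarrow> 'a) \<Rightarrow>\<^sub>0 int) \<Rightarrow> 'v set \<Rightarrow> bit" where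
  "simplicial_val lam p c s = mod2 (\<lambda>f. vertex_set_val p (vertex_image lam f) s) c"

lemma vertex_image_singular_face:
  assumes "i \<le> p"
  shows "vertex_image lam (singular_face (Suc p) k f) i = vertex_image lam f (face_index k i)"
proof -
  have "simplical_face k (\<lambda>j. if j = i then 1 else 0) = (\<lambda>j. if j = face_index k i then 1 else (0::real))"
    by (intro ext) (auto simp: simplical_face_def face_index_def)
  then show ?thesis
    using assms by (simp add: vertex_image_def singular_face_def)
qed

lemma simplicial_val_boundary:
  assumes "finite V" "\<And>f i. f \<in> Poly_Mapping.keys c \<Longrightarrow> i \<le> Suc p \<Longrightarrow> vertex_image lam f i \<in> V"
  shows "simplicial_val lam p (chain_boundary (Suc p) c) t = chain_bd V (simplicial_val lam (Suc p) c) t"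
proof -
  have "Poly_Mapping.keys c \<subseteq> {f. \<forall>i\<le>Suc p. vertex_image lam f i \<in> V}" using assms(2) by auto
  then show ?thesis
  proof (induction c rule: frag_induction)
    case zero
    then show ?case by (simp add: simplicial_val_def chain_bd_def)
  next
    case (one f)
    have one_power: "of_int ((- 1) ^ k) = (1::bit)" for k :: nat by simp
    have "simplicial_val lam p (chain_boundary (Suc p) (frag_of f)) t
        = (\<Sum>k\<le>Suc p. vertex_set_val p (vertex_image lam (singular_face (Suc p) k f)) t)"
      unfolding simplicial_val_def
      by (simp add: chain_boundary_of mod2_sum mod2_cmul mod2_add one_power del: sum.atMost_Suc)
    also have "\<dots> = (\<Sum>k\<le>Suc p. vertex_set_val p (vertex_image lam f \<circ> face_index k) t)"
    proof (intro sum.cong refl)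
      fix k
      have "inj_on (vertex_image lam (singular_face (Suc p) k f)) {..p} \<longleftrightarrow> inj_on (vertex_image lam f \<circ> face_index k) {..p}"
        by (intro inj_on_cong) (simp add: vertex_image_singular_face)
      moreover have "vertex_image lam (singular_face (Suc p) k f) ` {..p} = (vertex_image lam f \<circ> face_index k) ` {..p}"
        by (intro image_cong) (simp_all add: vertex_image_singular_face)
      ultimately show "vertex_set_val p (vertex_image lam (singular_face (Suc p) k f)) t
          = vertex_set_val p (vertex_image lam f \<circ> face_index k) t"
        by (simp add: vertex_set_val_def)
    qed
    also have "\<dots> = chain_bd V (simplicial_val lam (Suc p) (frag_of f)) t"
      using one by (subst vertex_set_val_boundary[OF assms(1)]) (auto simp: chain_bd_def simplicial_val_def)
    finally show ?case .
  next
    case (diff a b)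
    then show ?case
      by (simp add: simplicial_val_def chain_boundary_diff mod2_diff chain_bd_def sum.distrib)
  qed
qed

lemma contractible_cycle_homologous_const:
  assumes "homotopic_with (\<lambda>h. True) Y Y id (\<lambda>x. a)" "singular_relcycle q Y {} c"
  shows "homologous_rel q Y {} c (chain_map q (\<lambda>x. a) c)"
proof -
  have "homotopic_with (\<lambda>h. h \<in> {} \<rightarrow> {}) Y Y id (\<lambda>x. a)"
    using assms(1) by simp
  from homotopic_imp_homologous_rel_chain_maps[OF this assms(2)]
  moreover have "chain_map q id c = c" using assms(2) by (meson chain_map_ident singular_relcycle)
  ultimately show ?thesis by metis
qed

text \<open>The cycle is homologous to its image at the point \<open>a\<close>, and on a point
  cycles of positive degree bound.\<close>

lemma contractible_cycle_boundary:
  assumes h: "homotopic_with (\<lambda>h. True) Y Y id (\<lambda>x. a)" and a: "a \<in> topspace Y"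
    and c: "singular_relcycle q Y {} c" and q: "1 \<le> q"
  shows "singular_relboundary q Y {} c"
proof -
  let ?A = "subtopology Y {a}"
  have top: "topspace ?A = {a}" using a by auto
  have "singular_relcycle q ?A {} (chain_map q (\<lambda>x. a) c)"
    by (rule singular_relcycle_chain_map[OF c]) (use a in \<open>auto simp: continuous_map_in_subtopology\<close>)
  then have "singular_relboundary q ?A {} (chain_map q (\<lambda>x. a) c)"
    using singular_boundary_eq_cycle_singleton[OF top q] by blast
  then have "singular_relboundary q Y {} (chain_map q (\<lambda>x. a) c)"
    using singular_boundary_mono[of "{a}" UNIV q Y] by simp
  then show ?thesis
    using contractible_cycle_homologous_const[OF h c] unfolding homologous_rel_def
    by (metis diff_add_cancel singular_relboundary_add)
qed

text \<open>Lifts mod 2 cycles past the integral coefficients of the singular homology library.\<close>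
lemma contractible_mod2_cycle:
  assumes "contractible_space Y" and c: "singular_chain (Suc p) Y c"
    and w: "chain_boundary (Suc p) c = frag_cmul 2 w" "singular_chain p Y w"
  obtains e u where "singular_chain (Suc (Suc p)) Y e"
    "chain_boundary (Suc (Suc p)) e = c - frag_cmul 2 u"
proof (cases "topspace Y = {}")
  case True
  then have "c = 0" using c singular_chain_empty by blast
  then show ?thesis using that[of 0 0] by simp
next
  case False
  obtain a where h: "homotopic_with (\<lambda>h. True) Y Y id (\<lambda>x. a)"
    using assms(1) by (auto simp: contractible_space_def)
  then have "continuous_map Y Y (\<lambda>x. a)" using homotopic_with_imp_continuous_maps by blast
  then have a: "a \<in> topspace Y" using False by (auto simp: continuous_map_def)
  let ?A = "subtopology Y {a}"
  have top: "topspace ?A = {a}" using a by auto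
  have cont: "continuous_map Y ?A (\<lambda>x. a)" using a by (auto simp: continuous_map_in_subtopology)
  \<comment> \<open>Integral chains have no torsion, so this makes \<open>w\<close> a cycle.\<close>
  have "frag_cmul 2 (chain_boundary p w) = 0"
    using chain_boundary_boundary_alt[OF c] w by (simp flip: chain_boundary_cmul)
  then have wc: "singular_relcycle p Y {} w" using w(2) by (simp add: singular_cycle)
  have "singular_relboundary p Y {} w"
  proof (cases "p = 0")
    case False
    then show ?thesis using contractible_cycle_boundary[OF h a wc] by simp
  next
    case True
    \<comment> \<open>In degree 0 a cycle need not bound. But twice \<open>w\<close> is a boundary,
      and boundaries of 1-chains vanish on a point, so the image of \<open>w\<close> at
      \<open>a\<close> is zero.\<close>
    have "frag_cmul 2 (chain_map 0 (\<lambda>x. a) w) = chain_map 0 (\<lambda>x. a) (chain_boundary (Suc 0) c)"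
      using w True by simp
    also have "\<dots> = chain_boundary (Suc 0) (chain_map (Suc 0) (\<lambda>x. a) c)"
      using chain_boundary_chain_map[OF c, of "\<lambda>x. a"] True by simp
    also have "\<dots> = 0"
      using chain_boundary_of_singleton[OF top singular_chain_chain_map[OF c[unfolded True] cont]] by simp
    finally have "chain_map p (\<lambda>x. a) w = 0" using True by simp
    then show ?thesis
      using contractible_cycle_homologous_const[OF h wc] by (simp add: homologous_rel_def)
  qed
  then obtain u where u: "singular_chain (Suc p) Y u" "chain_boundary (Suc p) u = w"
    by (auto simp: singular_boundary)
  \<comment> \<open>Both \<open>c\<close> and twice \<open>u\<close> have boundary twice
    \<open>w\<close>; the correction is invisible mod 2.\<close>
  have "singular_relcycle (Suc p) Y {} (c - frag_cmul 2 u)"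
    using c u w by (auto simp: singular_cycle chain_boundary_diff chain_boundary_cmul
        intro!: singular_chain_diff singular_chain_cmul)
  then have "singular_relboundary (Suc p) Y {} (c - frag_cmul 2 u)"
    by (intro contractible_cycle_boundary[OF h a]) auto
  then show ?thesis using that by (auto simp: singular_boundary)
qed

section \<open>Ordered simplices and their affine realizations\<close>

definition rank_in :: "('v \<Rightarrow> nat) \<Rightarrow> 'v set \<Rightarrow> 'v \<Rightarrow> nat" where
  "rank_in ord \<kappa> v = card {u\<in>\<kappa>. ord u < ord v}"

text \<open>Lists \<open>\<kappa>\<close> in increasing \<open>ord\<close>. With one order for all
  vertices, the faces of the affine simplex of \<open>\<kappa>\<close> are literally the affine
  simplices of the faces of \<open>\<kappa>\<close>, without permutations.\<close>

definition enum_by :: "('v \<Rightarrow> nat) \<Rightarrow> 'v set \<Rightarrow> nat \<Rightarrow> 'v" where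
  "enum_by ord \<kappa> = inv_into \<kappa> (rank_in ord \<kappa>)"

lemma rank_in_less_iff:
  assumes "finite \<kappa>" "v \<in> \<kappa>" "w \<in> \<kappa>"
  shows "rank_in ord \<kappa> v < rank_in ord \<kappa> w \<longleftrightarrow> ord v < ord w"
proof
  assume "ord v < ord w"
  then have "{u\<in>\<kappa>. ord u < ord v} \<subset> {u\<in>\<kappa>. ord u < ord w}" using assms by auto
  then show "rank_in ord \<kappa> v < rank_in ord \<kappa> w"
    unfolding rank_in_def using assms by (intro psubset_card_mono) auto
next
  assume r: "rank_in ord \<kappa> v < rank_in ord \<kappa> w"
  show "ord v < ord w"
  proof (rule ccontr)
    assume "\<not> ord v < ord w"
    then have "{u\<in>\<kappa>. ord u < ord w} \<subseteq> {u\<in>\<kappa>. ord u < ord v}" by auto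
    then have "rank_in ord \<kappa> w \<le> rank_in ord \<kappa> v"
      unfolding rank_in_def using assms by (intro card_mono) auto
    then show False using r by simp
  qed
qed

lemma bij_rank_in:
  assumes "finite \<kappa>" "inj_on ord \<kappa>"
  shows "bij_betw (rank_in ord \<kappa>) \<kappa> {..<card \<kappa>}"
proof -
  have inj: "inj_on (rank_in ord \<kappa>) \<kappa>"
  proof (rule inj_onI)
    fix v w assume "v \<in> \<kappa>" "w \<in> \<kappa>" "rank_in ord \<kappa> v = rank_in ord \<kappa> w"
    then show "v = w" using rank_in_less_iff[OF assms(1), of v w ord] rank_in_less_iff[OF assms(1), of w v ord] assms(2)
      by (metis inj_onD less_irrefl linorder_neqE_nat)
  qed
  have "rank_in ord \<kappa> v < card \<kappa>" if "v \<in> \<kappa>" for v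
  proof -
    have "{u\<in>\<kappa>. ord u < ord v} \<subset> \<kappa>" using that by auto
    then show ?thesis unfolding rank_in_def using assms(1) by (intro psubset_card_mono) auto
  qed
  then have "rank_in ord \<kappa> ` \<kappa> = {..<card \<kappa>}"
    using inj by (intro card_subset_eq) (auto simp: card_image)
  then show ?thesis using inj by (simp add: bij_betw_def)
qed

lemma bij_enum_by:
  assumes "finite \<kappa>" "inj_on ord \<kappa>" "card \<kappa> = Suc p"
  shows "bij_betw (enum_by ord \<kappa>) {..p} \<kappa>"
  using bij_betw_inv_into[OF bij_rank_in[OF assms(1,2)]] assms(3)
  by (simp add: enum_by_def lessThan_Suc_atMost)

lemma enum_by_remove:
  assumes "finite \<kappa>" "inj_on ord \<kappa>" "card \<kappa> = Suc (Suc p)" "k \<le> Suc p" "i \<le> p"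
  shows "enum_by ord (\<kappa> - {enum_by ord \<kappa> k}) i = enum_by ord \<kappa> (face_index k i)"
proof -
  note bij = bij_enum_by[OF assms(1-3)]
  have rank: "rank_in ord \<kappa> (enum_by ord \<kappa> j) = j" if "j \<le> Suc p" for j
    unfolding enum_by_def using bij_rank_in[OF assms(1,2)] that assms(3)
    by (intro f_inv_into_f) (auto simp: bij_betw_def)
  define w where "w = enum_by ord \<kappa> k"
  define v where "v = enum_by ord \<kappa> (face_index k i)"
  have fi: "face_index k i \<le> Suc p" "face_index k i \<noteq> k" using assms by (auto simp: face_index_def)
  have w: "w \<in> \<kappa>" "rank_in ord \<kappa> w = k"
    using bij assms rank by (auto simp: w_def bij_betw_def)
  have v: "v \<in> \<kappa>" "rank_in ord \<kappa> v = face_index k i"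
    using bij fi rank by (auto simp: v_def bij_betw_def)
  have vw: "v \<noteq> w" using v w fi by auto
  have "rank_in ord (\<kappa> - {w}) v = i"
  proof (cases "ord w < ord v")
    case True
    then have "k < face_index k i" using rank_in_less_iff[OF assms(1) w(1) v(1), of ord] v w by simp
    then have "face_index k i = Suc i" by (auto simp: face_index_def split: if_splits)
    moreover have "{u\<in>\<kappa> - {w}. ord u < ord v} = {u\<in>\<kappa>. ord u < ord v} - {w}" by auto
    moreover have "w \<in> {u\<in>\<kappa>. ord u < ord v}" using True w by auto
    ultimately show ?thesis using v(2) assms(1) by (simp add: rank_in_def card_Diff_singleton)
  next
    case False
    then have "\<not> k < face_index k i" using rank_in_less_iff[OF assms(1) w(1) v(1), of ord] v w by simp
    then have "face_index k i = i" by (auto simp: face_index_def split: if_splits)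
    moreover have "{u\<in>\<kappa> - {w}. ord u < ord v} = {u\<in>\<kappa>. ord u < ord v}" using False by auto
    ultimately show ?thesis using v(2) by (simp add: rank_in_def)
  qed
  moreover have "inj_on (rank_in ord (\<kappa> - {w})) (\<kappa> - {w})"
    using bij_rank_in[of "\<kappa> - {w}" ord] assms(1,2) by (auto simp: bij_betw_def intro: inj_on_subset)
  ultimately have "enum_by ord (\<kappa> - {w}) i = v"
    unfolding enum_by_def using v(1) vw by (metis Diff_iff inv_into_f_f singletonD)
  then show ?thesis by (simp add: v_def w_def)
qed

text \<open>The \<open>i\<close>-th corner goes to the unit vector at \<open>a i\<close>, so values
  are barycentric coordinates. The restriction is there because singular simplices are extensional
  on the standard simplex.\<close>

definition affine_simplex :: "(nat \<Rightarrow> 'v) \<Rightarrow> nat \<Rightarrow> (nat \<Rightarrow> real) \<Rightarrow> 'v \<Rightarrow> real" where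
  "affine_simplex a p = restrict (\<lambda>t w. \<Sum>i\<le>p. if a i = w then t i else 0) (standard_simplex p)"

lemma affine_simplex_cong:
  "(\<And>i. i \<le> p \<Longrightarrow> a i = b i) \<Longrightarrow> affine_simplex a p = affine_simplex b p"
  unfolding affine_simplex_def by (intro ext) (auto simp: restrict_def intro!: sum.cong)

lemma singular_face_affine_simplex:
  assumes "k \<le> Suc p"
  shows "singular_face (Suc p) k (affine_simplex a (Suc p)) = affine_simplex (a \<circ> face_index k) p"
proof
  fix t
  show "singular_face (Suc p) k (affine_simplex a (Suc p)) t = affine_simplex (a \<circ> face_index k) p t"
  proof (cases "t \<in> standard_simplex p")
    case True
    then have in_simplex: "simplical_face k t \<in> standard_simplex (Suc p)"
      using simplical_face_in_standard_simplex[of "Suc p" k t] assms by simp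
    have "(\<Sum>i\<le>Suc p. if a i = w then simplical_face k t i else 0)
        = (\<Sum>i\<le>p. if a (face_index k i) = w then t i else 0)" for w
    proof -
      have "(\<Sum>i\<le>Suc p. if a i = w then simplical_face k t i else 0)
          = (\<Sum>i\<in>{..Suc p} - {k}. if a i = w then simplical_face k t i else 0)"
        by (intro sum.mono_neutral_right) (auto simp: simplical_face_def)
      also have "\<dots> = (\<Sum>i\<in>{..p}. if a (face_index k i) = w then simplical_face k t (face_index k i) else 0)"
        by (rule sum.reindex_bij_betw[OF bij_face_index[OF assms], symmetric])
      also have "\<dots> = (\<Sum>i\<le>p. if a (face_index k i) = w then t i else 0)"
        by (intro sum.cong) (auto simp: face_index_def simplical_face_def)
      finally show ?thesis .
    qed
    then show ?thesis using True in_simplex by (simp add: singular_face_def affine_simplex_def o_def del: sum.atMost_Suc)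
  next
    case False
    then show ?thesis by (simp add: singular_face_def affine_simplex_def)
  qed
qed

lemma singular_simplex_affine_simplex: "singular_simplex p (powertop_real UNIV) (affine_simplex a p)"
  unfolding singular_simplex_def affine_simplex_def
proof
  have "continuous_map (subtopology (powertop_real UNIV) (standard_simplex p)) (powertop_real UNIV)
     (\<lambda>t w. \<Sum>i\<le>p. if a i = w then t i else 0)"
    unfolding continuous_map_componentwise_UNIV
  proof
    fix w
    have "continuous_map (subtopology (powertop_real UNIV) (standard_simplex p)) euclideanreal
       (\<lambda>t. if a i = w then t i else 0)" for i
      by (cases "a i = w") (auto intro: continuous_map_from_subtopology continuous_map_product_projection)
    then show "continuous_map (subtopology (powertop_real UNIV) (standard_simplex p)) euclideanreal
       (\<lambda>t. \<Sum>i\<le>p. if a i = w then t i else 0)"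
      by (intro continuous_map_sum) auto
  qed
  then show "continuous_map (subtopology (powertop_real UNIV) (standard_simplex p)) (powertop_real UNIV)
     (\<lambda>t\<in>standard_simplex p. \<lambda>w. \<Sum>i\<le>p. if a i = w then t i else 0)"
    by (rule continuous_map_eq) auto
qed auto

lemma affine_simplex_sum:
  assumes "t \<in> standard_simplex p" "a ` {..p} \<subseteq> F" "finite F"
  shows "sum (affine_simplex a p t) F = 1"
proof -
  have "sum (affine_simplex a p t) F = (\<Sum>i\<le>p. \<Sum>w\<in>F. if a i = w then t i else 0)"
    using assms(1) unfolding affine_simplex_def by (simp add: sum.swap[of _ _ F])
  also have "\<dots> = (\<Sum>i\<le>p. t i)"
    using assms by (intro sum.cong) (auto simp: sum.delta)
  also have "\<dots> = 1" using assms(1) by (simp add: standard_simplex_def)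
  finally show ?thesis .
qed

lemma affine_simplex_nonneg: "t \<in> standard_simplex p \<Longrightarrow> 0 \<le> affine_simplex a p t w"
  unfolding affine_simplex_def by (auto simp: standard_simplex_def intro!: sum_nonneg)

lemma affine_simplex_support:
  "t \<in> standard_simplex p \<Longrightarrow> w \<notin> a ` {..p} \<Longrightarrow> affine_simplex a p t w = 0"
  unfolding affine_simplex_def by (auto intro!: sum.neutral)

section \<open>Iterated subdivision and Sperner labelling\<close>

abbreviation sd_iter :: "nat \<Rightarrow> nat \<Rightarrow> (((nat \<Rightarrow> real) \<Rightarrow> 'a) \<Rightarrow>\<^sub>0 int) \<Rightarrow> (((nat \<Rightarrow> real) \<Rightarrow> 'a) \<Rightarrow>\<^sub>0 int)" where
  "sd_iter p N \<equiv> singular_subdivision p ^^ N"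

lemma sd_iter_cmul: "sd_iter p N (frag_cmul k c) = frag_cmul k (sd_iter p N c)"
  by (induction N) (auto simp: singular_subdivision_def frag_extend_cmul)

lemma sd_iter_add: "sd_iter p N (a + b) = sd_iter p N a + sd_iter p N b"
  by (induction N) (auto simp: singular_subdivision_add)

lemma sd_iter_sum: "sd_iter p N (\<Sum>i\<in>I. c i) = (\<Sum>i\<in>I. sd_iter p N (c i))"
  by (induction I rule: infinite_finite_induct) (simp_all add: sd_iter_add)

lemma singular_chain_sd_iter: "singular_chain p X c \<Longrightarrow> singular_chain p X (sd_iter p N c)"
  by (induction N) (auto simp: singular_chain_singular_subdivision)

lemma chain_boundary_sd_iter:
  "singular_chain (Suc p) X c \<Longrightarrow> chain_boundary (Suc p) (sd_iter (Suc p) N c) = sd_iter p N (chain_boundary (Suc p) c)"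
proof (induction N)
  case (Suc N)
  then show ?case
    using chain_boundary_singular_subdivision[OF singular_chain_sd_iter[OF Suc.prems, of N]] by simp
qed simp

lemma sd_iter_0_dim: "singular_simplex 0 X f \<Longrightarrow> sd_iter 0 N (frag_of f) = frag_of f"
  by (induction N) (simp_all add: singular_subdivision_def singular_simplex_chain_map_id del: chain_map_of)

lemma vertex_image_in:
  assumes "singular_chain p (subtopology Y A) c" "f \<in> Poly_Mapping.keys c" "i \<le> p"
    and "\<And>y. y \<in> topspace Y \<Longrightarrow> y \<in> A \<Longrightarrow> lam y \<in> B"
  shows "vertex_image lam f i \<in> B"
proof -
  have "singular_simplex p (subtopology Y A) f" using assms(1,2) by (auto simp: singular_chain_def)
  then have "f \<in> standard_simplex p \<rightarrow> topspace (subtopology Y A)"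
    by (auto simp: singular_simplex_def continuous_map_def)
  then have "f (\<lambda>j. if j = i then 1 else 0) \<in> topspace (subtopology Y A)"
    using assms(3) basis_in_standard_simplex[of i p] by blast
  then show ?thesis using assms(4) by (auto simp: vertex_image_def)
qed

text \<open>Sperner: by the support condition only \<open>\<kappa>\<close> itself can occur, and the boundary determines its coefficient.\<close>
lemma simplicial_val_sd_affine:
  assumes "inj_on ord V" "finite V" and K: "\<And>\<kappa>. \<kappa> \<in> K \<Longrightarrow> \<kappa> \<subseteq> V" "\<And>\<kappa> v. \<kappa> \<in> K \<Longrightarrow> \<kappa> - {v} \<in> K"
    and aff: "\<And>\<kappa> p. \<kappa> \<in> K \<Longrightarrow> card \<kappa> = Suc p \<Longrightarrow>
        singular_simplex p (subtopology Y {y. \<forall>w. w \<notin> \<kappa> \<longrightarrow> y w = 0}) (affine_simplex (enum_by ord \<kappa>) p)"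
    and lam: "\<And>y \<kappa>. y \<in> topspace Y \<Longrightarrow> \<forall>w. w \<notin> \<kappa> \<longrightarrow> y w = (0::real) \<Longrightarrow> lam y \<in> \<kappa>"
  shows "\<kappa> \<in> K \<Longrightarrow> card \<kappa> = Suc p \<Longrightarrow>
     simplicial_val lam p (sd_iter p N (frag_of (affine_simplex (enum_by ord \<kappa>) p))) s = of_bool (s = \<kappa>)"
proof (induction p arbitrary: \<kappa> s)
  case 0
  from aff[OF 0] have ss: "singular_simplex 0 (subtopology Y {y. \<forall>w. w \<notin> \<kappa> \<longrightarrow> y w = 0}) (affine_simplex (enum_by ord \<kappa>) 0)" .
  then have "singular_chain 0 (subtopology Y {y. \<forall>w. w \<notin> \<kappa> \<longrightarrow> y w = 0}) (frag_of (affine_simplex (enum_by ord \<kappa>) 0))"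
    by (simp add: singular_chain_of)
  then have "vertex_image lam (affine_simplex (enum_by ord \<kappa>) 0) 0 \<in> \<kappa>"
    by (rule vertex_image_in) (use lam in auto)
  moreover obtain v where "\<kappa> = {v}" using 0 by (auto simp: card_Suc_eq)
  ultimately show ?case
    unfolding sd_iter_0_dim[OF ss] by (auto simp: simplicial_val_def vertex_set_val_def)
next
  case (Suc p)
  let ?A = "{y. \<forall>w. w \<notin> \<kappa> \<longrightarrow> y w = 0}"
  let ?a = "\<lambda>\<kappa> p. frag_of (affine_simplex (enum_by ord \<kappa>) p)"
  let ?c = "sd_iter (Suc p) N (?a \<kappa> (Suc p))"
  have fin: "finite \<kappa>" "inj_on ord \<kappa>" using K(1)[OF Suc.prems(1)] assms(1,2) by (auto intro: finite_subset inj_on_subset)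
  have ca: "singular_chain (Suc p) (subtopology Y ?A) (?a \<kappa> (Suc p))"
    using aff[OF Suc.prems] by (simp add: singular_chain_of)
  have c: "singular_chain (Suc p) (subtopology Y ?A) ?c" by (rule singular_chain_sd_iter[OF ca])
  have vi: "vertex_image lam f i \<in> \<kappa>" if "f \<in> Poly_Mapping.keys ?c" "i \<le> Suc p" for f i
    by (rule vertex_image_in[OF c that]) (use lam in auto)
  \<comment> \<open>The pieces stay in the span of \<open>\<kappa>\<close>, so all their labels lie
    in \<open>\<kappa>\<close>, and a piece with distinct labels uses every one of them.\<close>
  have zero: "simplicial_val lam (Suc p) ?c s = 0" if "s \<noteq> \<kappa>" for s
    unfolding simplicial_val_def mod2_def
  proof (intro sum.neutral ballI)
    fix f assume f: "f \<in> Poly_Mapping.keys ?c"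
    have "vertex_image lam f ` {..Suc p} = \<kappa>" if inj: "inj_on (vertex_image lam f) {..Suc p}"
      using vi[OF f] inj fin Suc.prems by (intro card_subset_eq) (auto simp: card_image)
    then have "vertex_set_val (Suc p) (vertex_image lam f) s = 0" using that by (auto simp: vertex_set_val_def)
    then show "of_int (poly_mapping.lookup ?c f) * vertex_set_val (Suc p) (vertex_image lam f) s = 0" by simp
  qed
  note bij = bij_enum_by[OF fin Suc.prems(2)]
  let ?e = "enum_by ord \<kappa>"
  let ?t = "\<kappa> - {?e 0}"
  have e0: "?e 0 \<in> \<kappa>" using bij by (auto simp: bij_betw_def)
  \<comment> \<open>Inside \<open>\<kappa>\<close> only \<open>\<kappa>\<close> itself contains
    \<open>?t\<close> with one more vertex, so its coefficient is the boundary coefficient at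
    \<open>?t\<close>.\<close>
  have "simplicial_val lam p (chain_boundary (Suc p) ?c) ?t = chain_bd \<kappa> (simplicial_val lam (Suc p) ?c) ?t"
    by (rule simplicial_val_boundary[OF fin(1) vi])
  also have "\<dots> = simplicial_val lam (Suc p) ?c \<kappa>"
  proof -
    have "\<kappa> - ?t = {?e 0}" "insert (?e 0) ?t = \<kappa>" using e0 by auto
    then show ?thesis by (simp add: chain_bd_def)
  qed
  finally have 1: "simplicial_val lam (Suc p) ?c \<kappa> = simplicial_val lam p (chain_boundary (Suc p) ?c) ?t" by simp
  have "chain_boundary (Suc p) (?a \<kappa> (Suc p)) = (\<Sum>k\<le>Suc p. frag_cmul ((-1) ^ k) (?a (\<kappa> - {?e k}) p))"
  proof -
    have "affine_simplex (?e \<circ> face_index k) p = affine_simplex (enum_by ord (\<kappa> - {?e k})) p" if "k \<le> Suc p" for k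
      using enum_by_remove[OF fin Suc.prems(2) that] by (intro affine_simplex_cong) simp
    then show ?thesis
      by (simp add: chain_boundary_of singular_face_affine_simplex del: sum.atMost_Suc)
  qed
  then have "simplicial_val lam p (chain_boundary (Suc p) ?c) ?t
      = (\<Sum>k\<le>Suc p. simplicial_val lam p (sd_iter p N (?a (\<kappa> - {?e k}) p)) ?t)"
    unfolding chain_boundary_sd_iter[OF ca] simplicial_val_def
    by (simp add: sd_iter_sum sd_iter_cmul mod2_sum mod2_cmul del: sum.atMost_Suc)
  \<comment> \<open>By induction each face contributes only at itself, and \<open>?t\<close> is the
    face opposite to \<open>?e 0\<close> alone.\<close>
  also have "\<dots> = (\<Sum>k\<le>Suc p. of_bool (k = 0))"
  proof (intro sum.cong refl)
    fix k assume k: "k \<in> {..Suc p}"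
    then have ek: "?e k \<in> \<kappa>" using bij by (auto simp: bij_betw_def)
    then have "card (\<kappa> - {?e k}) = Suc p" using fin Suc.prems by simp
    then have "simplicial_val lam p (sd_iter p N (?a (\<kappa> - {?e k}) p)) ?t = of_bool (?t = \<kappa> - {?e k})"
      by (intro Suc.IH K(2) Suc.prems(1))
    moreover have "?t = \<kappa> - {?e k} \<longleftrightarrow> k = 0"
    proof
      assume "?t = \<kappa> - {?e k}"
      then have "?e 0 = ?e k" using ek e0 by auto
      then show "k = 0" using bij k by (auto simp: bij_betw_def inj_on_def)
    qed simp
    ultimately show "simplicial_val lam p (sd_iter p N (?a (\<kappa> - {?e k}) p)) ?t = of_bool (k = 0)" by simp
  qed
  also have "\<dots> = (1::bit)" by (simp add: of_bool_def del: sum.atMost_Suc)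
  finally show ?case using 1 zero by auto
qed

lemma mod2_point: "mod2 (\<lambda>f. of_bool (f = g)) c = of_int (poly_mapping.lookup c g)"
proof -
  have "mod2 (\<lambda>f. of_bool (f = g)) c = (\<Sum>f\<in>insert g (Poly_Mapping.keys c). of_int (poly_mapping.lookup c f) * of_bool (f = g))"
    by (rule mod2_superset) auto
  also have "\<dots> = (\<Sum>f\<in>{g}. of_int (poly_mapping.lookup c f) * of_bool (f = g))"
    by (rule sum.mono_neutral_right) auto
  finally show ?thesis by simp
qed

lemma of_int_bit_eq_0_iff: "of_int a = (0::bit) \<longleftrightarrow> even a"
  by (cases "even a") (auto elim!: evenE oddE)

text \<open>Double counting of pairs of a simplex and one of its vertices. With \<open>h\<close> the
  indicator of a fixed singular simplex, it shows that a mod 2 cycle becomes an integral chain with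
  even boundary.\<close>

lemma sum_faces_eq_chain_bd:
  assumes "finite V" "\<And>s. z s \<noteq> 0 \<Longrightarrow> s \<subseteq> V"
  shows "(\<Sum>\<kappa>\<in>{\<kappa>. z \<kappa> \<noteq> 0}. \<Sum>v\<in>\<kappa>. h (\<kappa> - {v})) = (\<Sum>t\<in>Pow V. chain_bd V z t * h t)"
proof -
  have fin: "finite {\<kappa>. z \<kappa> \<noteq> 0}" using assms by (auto intro: finite_subset[of _ "Pow V"])
  have "(\<Sum>t\<in>Pow V. chain_bd V z t * h t) = (\<Sum>t\<in>Pow V. \<Sum>v\<in>V-t. z (insert v t) * h t)"
    by (simp add: chain_bd_def sum_distrib_right)
  also have "\<dots> = (\<Sum>(t,v)\<in>(SIGMA t:Pow V. V - t). z (insert v t) * h t)"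
    using assms(1) by (intro sum.Sigma) auto
  also have "\<dots> = (\<Sum>(\<kappa>,v)\<in>(SIGMA \<kappa>:Pow V. \<kappa>). z \<kappa> * h (\<kappa> - {v}))"
    by (rule sum.reindex_bij_witness[where i = "\<lambda>(\<kappa>,v). (\<kappa> - {v}, v)" and j = "\<lambda>(t,v). (insert v t, v)"])
       (auto simp: insert_absorb)
  also have "\<dots> = (\<Sum>\<kappa>\<in>Pow V. \<Sum>v\<in>\<kappa>. z \<kappa> * h (\<kappa> - {v}))"
    using assms(1) by (intro sum.Sigma[symmetric]) (auto intro: finite_subset)
  also have "\<dots> = (\<Sum>\<kappa>\<in>{\<kappa>. z \<kappa> \<noteq> 0}. \<Sum>v\<in>\<kappa>. h (\<kappa> - {v}))"
  proof (rule sum.mono_neutral_cong_right)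
    fix \<kappa> assume "\<kappa> \<in> {\<kappa>. z \<kappa> \<noteq> 0}"
    then have "z \<kappa> = 1" using bit_not_zero_iff by simp
    then show "(\<Sum>v\<in>\<kappa>. z \<kappa> * h (\<kappa> - {v})) = (\<Sum>v\<in>\<kappa>. h (\<kappa> - {v}))" by simp
  qed (use assms in auto)
  finally show ?thesis by simp
qed

text \<open>\<open>F w\<close> is the set where the label \<open>w\<close> is allowed, and
  \<open>lam\<close> chooses an allowed label. The cycle becomes a singular chain that bounds mod 2
  in \<open>Y\<close>. After fine subdivision the labels turn the bounding chain into a chain of
  \<open>K\<close>, by \<open>nerve\<close>, and return the cycle itself on the boundary, by
  \<open>lam_support\<close>.\<close>

lemma cycles_bound_of_contractible_cover:
  fixes Y :: "('v \<Rightarrow> real) topology"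
  assumes contr: "contractible_space Y" and V: "finite V"
    and K: "\<And>\<kappa>. \<kappa> \<in> K \<Longrightarrow> \<kappa> \<subseteq> V" "\<And>\<kappa> t. \<kappa> \<in> K \<Longrightarrow> t \<subseteq> \<kappa> \<Longrightarrow> t \<in> K"
    and aff: "\<And>\<kappa> p a. \<kappa> \<in> K \<Longrightarrow> bij_betw a {..p} \<kappa> \<Longrightarrow> singular_simplex p Y (affine_simplex a p)"
    and closed: "\<And>w. w \<in> V \<Longrightarrow> closedin Y (F w)"
    and lam_F: "\<And>y. y \<in> topspace Y \<Longrightarrow> lam y \<in> V \<and> y \<in> F (lam y)"
    and lam_support: "\<And>y. y \<in> topspace Y \<Longrightarrow> y (lam y) \<noteq> 0"
    and nerve: "\<And>y. y \<in> topspace Y \<Longrightarrow> {w\<in>V. y \<in> F w} \<in> K"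
  shows "cycles_bound V K (Suc (Suc q))"
  unfolding cycles_bound_def
proof (intro allI impI, elim conjE)
  fix z assume z: "chain_on K (Suc (Suc q)) z" and cz: "\<forall>t. chain_bd V z t = 0"
  obtain ord :: "'v \<Rightarrow> nat" where ord: "inj_on ord V"
    using finite_imp_inj_to_nat_seg[OF V] by auto
  let ?e = "enum_by ord"
  let ?a = "\<lambda>\<kappa> p. frag_of (affine_simplex (?e \<kappa>) p)"
  have zV: "s \<subseteq> V" "card s = Suc (Suc q)" "s \<in> K" if "z s \<noteq> 0" for s
    using chain_onD[OF z that] K by auto
  have fin\<kappa>: "finite \<kappa>" "inj_on ord \<kappa>" if "\<kappa> \<in> K" for \<kappa>
    using K(1)[OF that] V ord by (auto intro: finite_subset inj_on_subset)
  let ?Z = "{\<kappa>. z \<kappa> \<noteq> 0}"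
  have finZ: "finite ?Z" using zV V by (auto intro: finite_subset[of _ "Pow V"])
  have affK: "singular_simplex p Y (affine_simplex (?e \<kappa>) p)" if "\<kappa> \<in> K" "card \<kappa> = Suc p" for \<kappa> p
    by (rule aff[OF that(1) bij_enum_by[OF fin\<kappa>[OF that(1)] that(2)]])
  have affK': "singular_simplex p (subtopology Y {y. \<forall>w. w \<notin> \<kappa> \<longrightarrow> y w = 0}) (affine_simplex (?e \<kappa>) p)"
    if "\<kappa> \<in> K" "card \<kappa> = Suc p" for \<kappa> p
    unfolding singular_simplex_subtopology
    using affK[OF that] affine_simplex_support[of _ p _ "?e \<kappa>"] bij_enum_by[OF fin\<kappa>[OF that(1)] that(2)]
    by (auto simp: bij_betw_def)
  define c where "c = (\<Sum>\<kappa>\<in>?Z. ?a \<kappa> (Suc q))"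
  have c: "singular_chain (Suc q) Y c"
    unfolding c_def using affK zV by (intro singular_chain_sum) (auto simp: singular_chain_of)
  have "even (poly_mapping.lookup (chain_boundary (Suc q) c) g)" for g
  proof -
    have bd: "mod2 (\<lambda>f. of_bool (f = g)) (chain_boundary (Suc q) (?a \<kappa> (Suc q)))
        = (\<Sum>v\<in>\<kappa>. of_bool (affine_simplex (?e (\<kappa> - {v})) q = g))" if "\<kappa> \<in> ?Z" for \<kappa>
    proof -
      have \<kappa>: "\<kappa> \<in> K" "card \<kappa> = Suc (Suc q)" using zV that by auto
      have "mod2 (\<lambda>f. of_bool (f = g)) (chain_boundary (Suc q) (?a \<kappa> (Suc q)))
          = (\<Sum>k\<le>Suc q. of_bool (affine_simplex (?e \<kappa> \<circ> face_index k) q = g))"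
        by (simp add: chain_boundary_of singular_face_affine_simplex mod2_sum mod2_cmul del: sum.atMost_Suc)
      also have "\<dots> = (\<Sum>k\<le>Suc q. of_bool (affine_simplex (?e (\<kappa> - {?e \<kappa> k})) q = g))"
      proof (intro sum.cong refl)
        fix k assume "k \<in> {..Suc q}"
        then have "affine_simplex (?e \<kappa> \<circ> face_index k) q = affine_simplex (?e (\<kappa> - {?e \<kappa> k})) q"
          using enum_by_remove[OF fin\<kappa>[OF \<kappa>(1)] \<kappa>(2)] by (intro affine_simplex_cong) simp
        then show "of_bool (affine_simplex (?e \<kappa> \<circ> face_index k) q = g) = of_bool (affine_simplex (?e (\<kappa> - {?e \<kappa> k})) q = g)"
          by simp
      qed
      also have "\<dots> = (\<Sum>v\<in>\<kappa>. of_bool (affine_simplex (?e (\<kappa> - {v})) q = g))"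
        by (rule sum.reindex_bij_betw[OF bij_enum_by[OF fin\<kappa>[OF \<kappa>(1)] \<kappa>(2)]])
      finally show ?thesis .
    qed
    have "of_int (poly_mapping.lookup (chain_boundary (Suc q) c) g) = (\<Sum>\<kappa>\<in>?Z. \<Sum>v\<in>\<kappa>. (of_bool :: bool \<Rightarrow> bit) (affine_simplex (?e (\<kappa> - {v})) q = g))"
    proof -
      have "mod2 (\<lambda>f. of_bool (f = g)) (chain_boundary (Suc q) c)
          = (\<Sum>\<kappa>\<in>?Z. mod2 (\<lambda>f. of_bool (f = g)) (chain_boundary (Suc q) (?a \<kappa> (Suc q))))"
        unfolding c_def chain_boundary_sum mod2_sum o_def ..
      then show ?thesis using bd by (simp add: mod2_point)
    qed
    also have "\<dots> = (\<Sum>t\<in>Pow V. chain_bd V z t * of_bool (affine_simplex (?e t) q = g))"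
      by (rule sum_faces_eq_chain_bd[OF V zV(1)])
    also have "\<dots> = (0::bit)" using cz by simp
    finally show ?thesis by (simp add: of_int_bit_eq_0_iff)
  qed
  then obtain w where w: "chain_boundary (Suc q) c = frag_cmul 2 w" "Poly_Mapping.keys w = Poly_Mapping.keys (chain_boundary (Suc q) c)"
    using frag_even_imp_double by metis
  have "singular_chain q Y w"
    using singular_chain_boundary_alt[OF c] w(2) by (simp add: singular_chain_def)
  then obtain e u where e: "singular_chain (Suc (Suc q)) Y e" "chain_boundary (Suc (Suc q)) e = c - frag_cmul 2 u"
    using contractible_mod2_cycle[OF contr c w(1)] by blast
  \<comment> \<open>All \<open>F w\<close> that miss \<open>y\<close> are removed, so a simplex
    inside \<open>O' y\<close> receives only labels allowed at \<open>y\<close>. The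
    \<open>F w\<close> being closed and finite in number makes this set open.\<close>
  define O' where "O' y = topspace Y - (\<Union>w\<in>{w\<in>V. y \<notin> F w}. F w)" for y
  have "openin Y U" if "U \<in> O' ` topspace Y" for U
    using that V closed unfolding O'_def by (auto intro!: openin_diff closedin_Union)
  moreover have "topspace Y \<subseteq> \<Union>(O' ` topspace Y)" by (auto simp: O'_def)
  ultimately obtain N where N: "\<And>m f. N \<le> m \<Longrightarrow> f \<in> Poly_Mapping.keys (sd_iter (Suc (Suc q)) m e) \<Longrightarrow>
      \<exists>U\<in>O' ` topspace Y. f \<in> standard_simplex (Suc (Suc q)) \<rightarrow> U"
    using sufficient_iterated_singular_subdivision_exists[OF _ _ e(1)] by metis
  let ?c = "sd_iter (Suc (Suc q)) N e"
  let ?y = "simplicial_val lam (Suc (Suc q)) ?c"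
  have small: "\<exists>y\<in>topspace Y. \<forall>i\<le>Suc (Suc q). vertex_image lam f i \<in> {w\<in>V. y \<in> F w}"
    if f: "f \<in> Poly_Mapping.keys ?c" for f
  proof -
    obtain y where y: "y \<in> topspace Y" "f \<in> standard_simplex (Suc (Suc q)) \<rightarrow> O' y"
      using N[OF order_refl f] by auto
    have "vertex_image lam f i \<in> {w\<in>V. y \<in> F w}" if "i \<le> Suc (Suc q)" for i
    proof -
      let ?x = "f (\<lambda>j. if j = i then 1 else 0)"
      have "?x \<in> O' y" using y(2) that basis_in_standard_simplex[of i "Suc (Suc q)"] by blast
      then have "?x \<in> topspace Y" "lam ?x \<in> V" "y \<in> F (lam ?x)"
        using lam_F[of ?x] by (auto simp: O'_def)
      then show ?thesis by (simp add: vertex_image_def)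
    qed
    then show ?thesis using y(1) by blast
  qed
  have "chain_on K (Suc (Suc (Suc q))) ?y"
    unfolding chain_on_def
  proof (intro allI impI)
    fix s assume "?y s \<noteq> 0"
    then obtain f where f: "f \<in> Poly_Mapping.keys ?c" "vertex_set_val (Suc (Suc q)) (vertex_image lam f) s \<noteq> 0"
      unfolding simplicial_val_def mod2_def by (metis (no_types, lifting) mult_zero_right sum.neutral)
    then have s: "inj_on (vertex_image lam f) {..Suc (Suc q)}" "s = vertex_image lam f ` {..Suc (Suc q)}"
      by (auto simp: vertex_set_val_def split: if_splits)
    then have "card s = Suc (Suc (Suc q))" by (simp add: card_image)
    moreover obtain y where y: "y \<in> topspace Y" "\<forall>i\<le>Suc (Suc q). vertex_image lam f i \<in> {w\<in>V. y \<in> F w}"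
      using small[OF f(1)] by blast
    then have "s \<subseteq> {w\<in>V. y \<in> F w}" using s by auto
    then have "s \<in> K" using K(2) nerve[OF y(1)] by blast
    ultimately show "s \<in> K \<and> card s = Suc (Suc (Suc q))" by simp
  qed
  moreover have "chain_bd V ?y t = z t" for t
  proof -
    have "chain_bd V ?y t = simplicial_val lam (Suc q) (chain_boundary (Suc (Suc q)) ?c) t"
      using small by (intro simplicial_val_boundary[symmetric, OF V]) blast
    also have "\<dots> = simplicial_val lam (Suc q) (sd_iter (Suc q) N (c - frag_cmul 2 u)) t"
      unfolding chain_boundary_sd_iter[OF e(1)] e(2) ..
    also have "\<dots> = simplicial_val lam (Suc q) (sd_iter (Suc q) N c) t"
      by (simp add: singular_subdivision_power_diff sd_iter_cmul simplicial_val_def mod2_diff mod2_cmul)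
    also have "\<dots> = (\<Sum>\<kappa>\<in>?Z. simplicial_val lam (Suc q) (sd_iter (Suc q) N (?a \<kappa> (Suc q))) t)"
      unfolding c_def sd_iter_sum simplicial_val_def mod2_sum ..
    also have "\<dots> = (\<Sum>\<kappa>\<in>?Z. of_bool (t = \<kappa>))"
    proof (intro sum.cong refl)
      fix \<kappa> assume "\<kappa> \<in> ?Z"
      then have \<kappa>: "\<kappa> \<in> K" "card \<kappa> = Suc (Suc q)" using zV by auto
      show "simplicial_val lam (Suc q) (sd_iter (Suc q) N (?a \<kappa> (Suc q))) t = of_bool (t = \<kappa>)"
      proof (rule simplicial_val_sd_affine[OF ord V K(1) _ affK' _ \<kappa>])
        fix y \<kappa> assume "y \<in> topspace Y" "\<forall>w. w \<notin> \<kappa> \<longrightarrow> y w = 0"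
        then show "lam y \<in> \<kappa>" using lam_support by blast
      qed (use K(2) in auto)
    qed
    also have "\<dots> = z t"
    proof (cases "z t = 0")
      case True
      then show ?thesis by (auto intro: sum.neutral)
    next
      case False
      then have "(\<Sum>\<kappa>\<in>?Z. of_bool (t = \<kappa>)) = (\<Sum>\<kappa>\<in>{t}. (1::bit))"
        using finZ by (intro sum.mono_neutral_cong_right) auto
      then show ?thesis using False bit_not_zero_iff by simp
    qed
    finally show ?thesis .
  qed
  ultimately show "\<exists>w. chain_on K (Suc (Suc (Suc q))) w \<and> (\<forall>t. chain_bd V w t = z t)" by blast
qed

section \<open>Links in triangulated spheres\<close>

lemma face_subset_finite:
  assumes "s \<in> faces S" "finite V" "\<Union>S \<subseteq> V"
  shows "s \<subseteq> V" "finite s"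
proof -
  show "s \<subseteq> V" using assms(1,3) by (auto simp: faces_def)
  then show "finite s" using assms(2) by (rule finite_subset)
qed

lemma realizationD:
  assumes "y \<in> realization S" "finite V" "\<Union>S \<subseteq> V"
  obtains f where "f \<in> S" "\<And>w. w \<notin> f \<Longrightarrow> y w = 0" "sum y V = 1" "\<And>w. 0 \<le> y w"
proof -
  obtain f where f: "f \<in> S" "\<forall>v. v \<notin> f \<longrightarrow> y v = 0" "sum y f = 1" "\<And>w. 0 \<le> y w"
    using assms(1) by (auto simp: realization_def)
  have "sum y V = sum y f"
    using f assms(2,3) by (intro sum.mono_neutral_right) auto
  with f show ?thesis using that by auto
qed

text \<open>The label \<open>w\<close> is allowed at \<open>y\<close> where the coordinate of
  \<open>y - x\<close> at \<open>w\<close> is maximal. These sets are closed and lie in the open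
  sets where \<open>y w > x w\<close>, because both points have coordinate sum 1 and differ.\<close>

lemma punctured_sphere_cycles_bound:
  fixes S :: "'v set set"
  assumes sph: "homeo_sphere n S" and V: "finite V" "\<Union>S \<subseteq> V" and \<sigma>: "\<sigma> \<in> faces S" "\<sigma> \<noteq> {}"
  shows "cycles_bound V {s\<in>faces S. \<not> \<sigma> \<subseteq> s} (Suc (Suc q))"
proof -
  let ?X = "subtopology (powertop_real UNIV) (realization S)"
  let ?K = "{s\<in>faces S. \<not> \<sigma> \<subseteq> s}"
  define x :: "'v \<Rightarrow> real" where "x w = (if w \<in> \<sigma> then 1 / card \<sigma> else 0)" for w
  have \<sigma>V: "\<sigma> \<subseteq> V" using \<sigma> V by (auto simp: faces_def)
  then have "finite \<sigma>" by (rule finite_subset[OF _ V(1)])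
  note \<sigma>V = \<sigma>V this
  have c\<sigma>: "card \<sigma> > 0" using \<sigma> \<sigma>V by (simp add: card_gt_0_iff)
  have x0: "0 \<le> x w" for w by (simp add: x_def)
  have sumx: "sum x F = 1" if "\<sigma> \<subseteq> F" "finite F" for F
  proof -
    have "sum x F = sum x \<sigma>" using that by (intro sum.mono_neutral_right) (auto simp: x_def)
    also have "\<dots> = 1" using c\<sigma> by (simp add: x_def)
    finally show ?thesis .
  qed
  have xX: "x \<in> topspace ?X"
  proof -
    obtain f where f: "f \<in> S" "\<sigma> \<subseteq> f" using \<sigma> by (auto simp: faces_def)
    then have "finite f" using V by (meson Sup_upper finite_subset subset_trans)
    then have "sum x f = 1" using sumx f by auto
    moreover have "\<forall>v. v \<notin> f \<longrightarrow> x v = 0" using f by (auto simp: x_def)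
    ultimately show ?thesis using f x0 by (auto simp: realization_def)
  qed
  define Y where "Y = subtopology ?X (- {x})"
  have topY: "topspace Y = {y \<in> realization S. y \<noteq> x}" by (auto simp: Y_def)
  have contr: "contractible_space Y"
    unfolding Y_def using contractible_homeomorphic_nsphere_minus_point[OF _ xX] sph by (simp add: homeo_sphere_def)
  define F where "F w = {y \<in> topspace Y. \<forall>u\<in>V. y u - x u \<le> y w - x w}" for w
  define lam where "lam y = (SOME w. w \<in> V \<and> (\<forall>u\<in>V. y u - x u \<le> y w - x w))" for y
  have lam: "lam y \<in> V \<and> (\<forall>u\<in>V. y u - x u \<le> y (lam y) - x (lam y))" for y
    unfolding lam_def
  proof (rule someI_ex)
    have ne: "V \<noteq> {}" using \<sigma> \<sigma>V by auto
    let ?m = "Max ((\<lambda>u. y u - x u) ` V)"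
    have "?m \<in> (\<lambda>u. y u - x u) ` V" using V ne by (intro Max_in) auto
    then obtain w where "w \<in> V" "?m = y w - x w" by auto
    moreover have "y u - x u \<le> ?m" if "u \<in> V" for u using V that by (intro Max_ge) auto
    ultimately show "\<exists>w. w \<in> V \<and> (\<forall>u\<in>V. y u - x u \<le> y w - x w)" by auto
  qed
  \<comment> \<open>Otherwise \<open>y\<close> is at most \<open>x\<close> in every coordinate, and
    equal sums force \<open>y = x\<close>.\<close>
  have gt: "y w > x w" if y: "y \<in> F w" for y w
  proof (rule ccontr)
    assume "\<not> y w > x w"
    then have le: "y u \<le> x u" if "u \<in> V" for u using y that by (fastforce simp: F_def)
    have yY: "y \<in> realization S" "y \<noteq> x" using y topY by (auto simp: F_def)
    obtain f where f: "f \<in> S" "\<And>w. w \<notin> f \<Longrightarrow> y w = 0" "sum y V = 1"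
      using realizationD[OF yY(1) V] by metis
    have "y u = x u" for u
    proof (cases "u \<in> V")
      case True
      have "(\<Sum>u\<in>V. x u - y u) = 0" using f(3) sumx[OF \<sigma>V(1) V(1)] by (simp add: sum_subtractf)
      then have "\<forall>u\<in>V. x u - y u = 0"
        using le V(1) by (subst (asm) sum_nonneg_eq_0_iff) auto
      then show ?thesis using True by simp
    next
      case False
      then have "u \<notin> f" "u \<notin> \<sigma>" using f V \<sigma>V by auto
      then show ?thesis using f by (simp add: x_def)
    qed
    then show False using yY(2) by auto
  qed
  show ?thesis
  proof (rule cycles_bound_of_contractible_cover[OF contr V(1)])
    show "\<kappa> \<subseteq> V" if "\<kappa> \<in> ?K" for \<kappa> using that V by (auto simp: faces_def)
    show "t \<in> ?K" if "\<kappa> \<in> ?K" "t \<subseteq> \<kappa>" for \<kappa> t using that by (auto simp: faces_def)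
    show "closedin Y (F w)" if "w \<in> V" for w
    proof -
      have proj: "continuous_map Y euclideanreal (\<lambda>y. y u)" for u
        unfolding Y_def by (intro continuous_map_from_subtopology continuous_map_product_projection) simp
      have "closedin Y {y \<in> topspace Y. (y w - x w) - (y u - x u) \<in> {0..}}" for u
        by (rule closedin_continuous_map_preimage[where Y = euclideanreal])
           (auto intro!: continuous_intros proj)
      then have "closedin Y (\<Inter>u\<in>V. {y \<in> topspace Y. (y w - x w) - (y u - x u) \<in> {0..}})"
        using that by (intro closedin_Inter) auto
      moreover have "F w = (\<Inter>u\<in>V. {y \<in> topspace Y. (y w - x w) - (y u - x u) \<in> {0..}})"
        using that by (auto simp: F_def)
      ultimately show ?thesis by simp
    qed
    show lamF: "lam y \<in> V \<and> y \<in> F (lam y)" if "y \<in> topspace Y" for y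
      using lam that by (auto simp: F_def)
    show "y (lam y) \<noteq> 0" if "y \<in> topspace Y" for y
      using gt[of y "lam y"] lamF[OF that] x0[of "lam y"] by linarith
    \<comment> \<open>Allowed labels have \<open>y w > x w \<ge> 0\<close>, so they belong to the
      facet \<open>f\<close> carrying \<open>y\<close>. They cannot include all of
      \<open>\<sigma>\<close>, on which \<open>x\<close> already has total weight 1.\<close>
    show "{w\<in>V. y \<in> F w} \<in> ?K" if y: "y \<in> topspace Y" for y
    proof -
      have yY: "y \<in> realization S" "y \<noteq> x" using y topY by auto
      obtain f where f: "f \<in> S" "\<And>w. w \<notin> f \<Longrightarrow> y w = 0" "sum y V = 1" "\<And>w. 0 \<le> y w"
        using realizationD[OF yY(1) V] by metis
      have "w \<in> f" if "y \<in> F w" for w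
      proof (rule ccontr)
        assume "w \<notin> f"
        then show False using gt[OF that] f(2)[of w] x0[of w] by simp
      qed
      then have "{w\<in>V. y \<in> F w} \<in> faces S" using f(1) by (auto simp: faces_def)
      moreover have "\<not> \<sigma> \<subseteq> {w\<in>V. y \<in> F w}"
      proof
        assume "\<sigma> \<subseteq> {w\<in>V. y \<in> F w}"
        then have "sum x \<sigma> < sum y \<sigma>" using gt \<sigma> \<sigma>V by (intro sum_strict_mono) auto
        also have "\<dots> \<le> sum y V" using f V \<sigma>V by (intro sum_mono2) auto
        finally show False using f(3) sumx[of \<sigma>] \<sigma>V by simp
      qed
      ultimately show ?thesis by simp
    qed
    show "singular_simplex p Y (affine_simplex a p)" if \<kappa>: "\<kappa> \<in> ?K" and a: "bij_betw a {..p} \<kappa>" for \<kappa> p a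
      unfolding Y_def singular_simplex_subtopology
    proof (intro conjI singular_simplex_affine_simplex)
      obtain f where f: "f \<in> S" "\<kappa> \<subseteq> f" using \<kappa> by (auto simp: faces_def)
      then have finf: "finite f" using V by (meson Sup_upper finite_subset subset_trans)
      have im: "a ` {..p} = \<kappa>" using a by (simp add: bij_betw_def)
      show "affine_simplex a p ` standard_simplex p \<subseteq> realization S"
      proof (intro image_subsetI)
        fix t assume t: "t \<in> standard_simplex p"
        have "affine_simplex a p t w = 0" if "w \<notin> f" for w
          by (rule affine_simplex_support[OF t]) (use im f that in auto)
        moreover have "sum (affine_simplex a p t) f = 1" by (rule affine_simplex_sum[OF t _ finf]) (use im f in simp)
        moreover have "0 \<le> affine_simplex a p t w" for w by (rule affine_simplex_nonneg[OF t])
        ultimately show "affine_simplex a p t \<in> realization S"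
          using f(1) unfolding realization_def by blast
      qed
      \<comment> \<open>The coordinate at such a \<open>w\<close> vanishes on the whole simplex but
        not at the barycentre.\<close>
      obtain w where w: "w \<in> \<sigma>" "w \<notin> \<kappa>" using \<kappa> by auto
      show "affine_simplex a p ` standard_simplex p \<subseteq> - {x}"
      proof (intro image_subsetI)
        fix t assume t: "t \<in> standard_simplex p"
        have "affine_simplex a p t w = 0" by (rule affine_simplex_support[OF t]) (use im w in simp)
        moreover have "x w \<noteq> 0" using w c\<sigma> by (simp add: x_def)
        ultimately have "affine_simplex a p t \<noteq> x" by auto
        then show "affine_simplex a p t \<in> - {x}" by simp
      qed
    qed
  qed
qed

definition join_chain :: "'v set \<Rightarrow> 'v chain \<Rightarrow> 'v chain" where
  "join_chain \<sigma> u = (\<lambda>s. if \<sigma> \<subseteq> s then u (s - \<sigma>) else 0)"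

text \<open>A simplex with \<open>m < r\<close> vertices contains no facet, so the cycle lives in
  the complex without the facet \<open>f\<close> and bounds there.\<close>

lemma sphere_chain_bounds:
  assumes sph: "homeo_sphere n S" and V: "finite V" "\<Union>S \<subseteq> V"
    and card: "\<And>f. f \<in> S \<Longrightarrow> card f = r" and m: "2 \<le> m" "m < r"
  shows "cycles_bound V (faces S) m"
proof (cases "S = {}")
  case True
  then show ?thesis by (auto simp: cycles_bound_def chain_on_def faces_def chain_bd_def)
next
  case False
  then obtain f where f: "f \<in> S" by auto
  then have "f \<in> faces S" "f \<noteq> {}" using card[OF f] m by (auto simp: faces_def)
  then have "cycles_bound V {s\<in>faces S. \<not> f \<subseteq> s} (Suc (Suc (m - 2)))"
    by (rule punctured_sphere_cycles_bound[OF sph V])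
  moreover have "Suc (Suc (m - 2)) = m" using m by simp
  ultimately have ac: "cycles_bound V {s\<in>faces S. \<not> f \<subseteq> s} m" by simp
  show ?thesis
    unfolding cycles_bound_def
  proof (intro allI impI, elim conjE)
    fix z assume z: "chain_on (faces S) m z" "\<forall>t. chain_bd V z t = 0"
    have "chain_on {s\<in>faces S. \<not> f \<subseteq> s} m z"
      unfolding chain_on_def
    proof (intro allI impI)
      fix s assume "z s \<noteq> 0"
      then have s: "s \<in> faces S" "card s = m" using chain_onD[OF z(1)] by auto
      then have "finite s" using face_subset_finite(2)[OF _ V] by blast
      then have "\<not> f \<subseteq> s" using card_mono[of s f] card[OF f] s m by auto
      then show "s \<in> {s\<in>faces S. \<not> f \<subseteq> s} \<and> card s = m" using s by simp
    qed
    then obtain w where "chain_on {s\<in>faces S. \<not> f \<subseteq> s} (Suc m) w" "\<forall>t. chain_bd V w t = z t"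
      using ac z(2) unfolding cycles_bound_def by blast
    then show "\<exists>w. chain_on (faces S) (Suc m) w \<and> (\<forall>t. chain_bd V w t = z t)"
      by (auto simp: chain_on_def)
  qed
qed

text \<open>A cycle with coefficient 0 at some facet \<open>f\<close> lives in the complex without
  \<open>f\<close> and bounds there; no simplex has \<open>r + 1\<close> vertices, so the cycle is
  zero.\<close>

lemma sphere_top_cycle:
  assumes sph: "homeo_sphere n S" and V: "finite V" "\<Union>S \<subseteq> V"
    and card: "\<And>f. f \<in> S \<Longrightarrow> card f = r" and r: "2 \<le> r"
    and z: "chain_on (faces S) r z" "\<And>t. chain_bd V z t = 0"
  shows "(\<forall>t. z t = 0) \<or> (\<forall>t\<in>S. z t = 1)"
proof (rule disjCI)
  assume "\<not> (\<forall>t\<in>S. z t = 1)"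
  then obtain f where f: "f \<in> S" "z f = 0" by auto
  then have "f \<in> faces S" "f \<noteq> {}" using card[OF f(1)] r by (auto simp: faces_def)
  then have ac: "cycles_bound V {s\<in>faces S. \<not> f \<subseteq> s} (Suc (Suc (r - 2)))"
    by (rule punctured_sphere_cycles_bound[OF sph V])
  have fin: "finite s" if "s \<in> faces S" for s
    using face_subset_finite(2)[OF that V] .
  have "chain_on {s\<in>faces S. \<not> f \<subseteq> s} (Suc (Suc (r - 2))) z"
    unfolding chain_on_def
  proof (intro allI impI)
    fix s assume zs: "z s \<noteq> 0"
    then have s: "s \<in> faces S" "card s = r" using chain_onD[OF z(1)] by auto
    have "\<not> f \<subseteq> s"
    proof
      assume "f \<subseteq> s"
      then have "f = s" using card_subset_eq[OF fin[OF s(1)]] card[OF f(1)] s by simp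
      then show False using zs f by simp
    qed
    then show "s \<in> {s\<in>faces S. \<not> f \<subseteq> s} \<and> card s = Suc (Suc (r - 2))" using s r by simp
  qed
  then obtain w where w: "chain_on {s\<in>faces S. \<not> f \<subseteq> s} (Suc (Suc (Suc (r - 2)))) w" "\<forall>t. chain_bd V w t = z t"
    using ac z(2) unfolding cycles_bound_def by blast
  have "w s = 0" for s
  proof (rule ccontr)
    assume "w s \<noteq> 0"
    then have s: "s \<in> faces S" "card s = Suc (Suc (Suc (r - 2)))" using chain_onD[OF w(1)] by auto
    then obtain g where g: "g \<in> S" "s \<subseteq> g" by (auto simp: faces_def)
    then have "g \<in> faces S" by (auto simp: faces_def)
    then have "card s \<le> r" using card_mono[OF fin g(2)] card[OF g(1)] by simp
    then show False using s(2) r by linarith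
  qed
  then have "chain_bd V w t = 0" for t by (simp add: chain_bd_def)
  then show "\<forall>t. z t = 0" using w(2) by simp
qed

text \<open>The boundary of the join of \<open>\<sigma>\<close> and \<open>u\<close> avoids the open star of \<open>\<sigma>\<close>, hence it bounds there.\<close>
lemma join_cycle:
  assumes sph: "homeo_sphere n S" and V: "finite V" "\<Union>S \<subseteq> V"
    and \<sigma>: "\<sigma> \<in> faces S" "\<sigma> \<noteq> {}" and m: "2 \<le> m"
    and u: "chain_on (faces (lk S \<sigma>)) m u" "\<And>t. chain_bd V u t = 0"
  obtains q where "chain_on (faces S) (card \<sigma> + m) q" "\<And>t. chain_bd V q t = 0"
    "\<And>s. s \<inter> \<sigma> = {} \<Longrightarrow> q (\<sigma> \<union> s) = u s"
proof -
  have fin: "finite s" if "s \<in> faces S" for s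
    using face_subset_finite(2)[OF that V] .
  let ?j = "join_chain \<sigma> u"
  have jS: "chain_on (faces S) (card \<sigma> + m) ?j"
    unfolding chain_on_def
  proof (intro allI impI)
    fix s assume "?j s \<noteq> 0"
    then have s: "\<sigma> \<subseteq> s" "u (s - \<sigma>) \<noteq> 0" by (auto simp: join_chain_def split: if_splits)
    then have s': "s - \<sigma> \<in> faces (lk S \<sigma>)" "card (s - \<sigma>) = m" using chain_onD[OF u(1)] by auto
    have "(s - \<sigma>) \<union> \<sigma> = s" using s by auto
    then have "s \<in> faces S" using s'(1) faces_lk by metis
    moreover from this have "card s = card \<sigma> + m"
      using s s' fin card_Diff_subset[of \<sigma> s] card_mono[of s \<sigma>] finite_subset[of \<sigma> s] by auto
    ultimately show "s \<in> faces S \<and> card s = card \<sigma> + m" by simp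
  qed
  \<comment> \<open>On simplices containing \<open>\<sigma>\<close> the boundary of the join is the
    join with the boundary of \<open>u\<close>.\<close>
  have bd0: "chain_bd V ?j t = 0" if "\<sigma> \<subseteq> t" for t
  proof -
    have "chain_bd V ?j t = (\<Sum>v\<in>V-t. u (insert v (t - \<sigma>)))"
      unfolding chain_bd_def join_chain_def using that by (intro sum.cong) (auto simp: insert_Diff_if)
    also have "\<dots> = chain_bd V u (t - \<sigma>)"
      unfolding chain_bd_def
    proof (rule sum.mono_neutral_left)
      show "\<forall>i\<in>(V - (t - \<sigma>)) - (V - t). u (insert i (t - \<sigma>)) = 0"
      proof
        fix i assume "i \<in> (V - (t - \<sigma>)) - (V - t)"
        then have "i \<in> \<sigma>" by auto
        then show "u (insert i (t - \<sigma>)) = 0"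
          using chain_onD[OF u(1), of "insert i (t - \<sigma>)"] by (auto simp: faces_lk)
      qed
    qed (use V in auto)
    finally show ?thesis using u(2) by simp
  qed
  have "chain_on {s\<in>faces S. \<not> \<sigma> \<subseteq> s} (card \<sigma> + m - 1) (chain_bd V ?j)"
    unfolding chain_on_def
  proof (intro allI impI)
    fix t assume t: "chain_bd V ?j t \<noteq> 0"
    then obtain v where v: "v \<in> V - t" "?j (insert v t) \<noteq> 0"
      unfolding chain_bd_def by (metis (no_types, lifting) sum.neutral)
    then have "insert v t \<in> faces S" "card (insert v t) = card \<sigma> + m" using chain_onD[OF jS] by auto
    moreover from this have t': "t \<in> faces S" by (auto intro: faces_mono)
    ultimately have "card t = card \<sigma> + m - 1" using fin[OF t'] v by simp
    then show "t \<in> {s\<in>faces S. \<not> \<sigma> \<subseteq> s} \<and> card t = card \<sigma> + m - 1"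
      using bd0 t t' by auto
  qed
  moreover have "card \<sigma> > 0" using \<sigma> fin by (simp add: card_gt_0_iff)
  then have q: "card \<sigma> + m - 1 = Suc (Suc (card \<sigma> + m - 3))" "Suc (Suc (Suc (card \<sigma> + m - 3))) = card \<sigma> + m"
    using m by linarith+
  moreover have "cycles_bound V {s\<in>faces S. \<not> \<sigma> \<subseteq> s} (Suc (Suc (card \<sigma> + m - 3)))"
    by (rule punctured_sphere_cycles_bound[OF sph V \<sigma>])
  ultimately obtain y where y: "chain_on {s\<in>faces S. \<not> \<sigma> \<subseteq> s} (card \<sigma> + m) y" "\<And>t. chain_bd V y t = chain_bd V ?j t"
    using chain_bd_chain_bd[OF V(1)] unfolding cycles_bound_def q by blast
  \<comment> \<open>The chain \<open>y\<close> closes up the join and has no simplex through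
    \<open>\<sigma>\<close>, so there the coefficients are still those of \<open>u\<close>.\<close>
  show ?thesis
  proof (rule that[of "\<lambda>s. ?j s + y s"])
    show "chain_on (faces S) (card \<sigma> + m) (\<lambda>s. ?j s + y s)"
      unfolding chain_on_def
    proof (intro allI impI)
      fix s assume "?j s + y s \<noteq> 0"
      then have "?j s \<noteq> 0 \<or> y s \<noteq> 0" by auto
      then show "s \<in> faces S \<and> card s = card \<sigma> + m" using chain_onD[OF jS] chain_onD[OF y(1)] by blast
    qed
    show "chain_bd V (\<lambda>s. ?j s + y s) t = 0" for t by (simp add: chain_bd_add y(2))
    show "?j (\<sigma> \<union> s) + y (\<sigma> \<union> s) = u s" if "s \<inter> \<sigma> = {}" for s
    proof -
      have "y (\<sigma> \<union> s) = 0" using chain_onD[OF y(1), of "\<sigma> \<union> s"] by auto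
      moreover have "(\<sigma> \<union> s) - \<sigma> = s" using that by auto
      ultimately show ?thesis by (simp add: join_chain_def)
    qed
  qed
qed

text \<open>The join shifts cycles of the link by \<open>card \<sigma>\<close> vertices into the
  sphere. A filling there, or the dichotomy for top cycles, comes back by removing
  \<open>\<sigma>\<close> from the simplices that contain it. For empty \<open>\<sigma>\<close> the
  link is the sphere itself.\<close>

lemma sphere_links_spherical:
  assumes sph: "homeo_sphere n S" and V: "finite V" "\<Union>S \<subseteq> V"
    and card: "\<And>f. f \<in> S \<Longrightarrow> card f = r" and k: "1 \<le> k"
  shows "links_spherical V S k r"
  unfolding links_spherical_def
proof (intro ballI conjI impI)
  fix \<sigma> assume \<sigma>: "\<sigma> \<in> faces S" and lt: "card \<sigma> + k + 1 < r"
  show "cycles_bound V (faces (lk S \<sigma>)) (Suc k)"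
  proof (cases "\<sigma> = {}")
    case True
    then show ?thesis using sphere_chain_bounds[OF sph V card, of "Suc k"] lt k by simp
  next
    case False
    show ?thesis
      unfolding cycles_bound_def
    proof (intro allI impI, elim conjE)
      fix u assume u: "chain_on (faces (lk S \<sigma>)) (Suc k) u" "\<forall>t. chain_bd V u t = 0"
      obtain q where q: "chain_on (faces S) (card \<sigma> + Suc k) q" "\<And>t. chain_bd V q t = 0"
        "\<And>s. s \<inter> \<sigma> = {} \<Longrightarrow> q (\<sigma> \<union> s) = u s"
        using join_cycle[OF sph V \<sigma> False _ u(1)] u(2) k by auto
      obtain w where w: "chain_on (faces S) (Suc (card \<sigma> + Suc k)) w" "\<And>t. chain_bd V w t = q t"
        using sphere_chain_bounds[OF sph V card, of "card \<sigma> + Suc k"] lt k q unfolding cycles_bound_def by auto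
      let ?t = "\<lambda>s. if s \<inter> \<sigma> = {} then w (\<sigma> \<union> s) else 0"
      have fin: "finite s" if "s \<in> faces S" for s
        using face_subset_finite(2)[OF that V] .
      have "chain_on (faces (lk S \<sigma>)) (Suc (Suc k)) ?t"
        unfolding chain_on_def
      proof (intro allI impI)
        fix s assume "?t s \<noteq> 0"
        then have s: "s \<inter> \<sigma> = {}" "w (\<sigma> \<union> s) \<noteq> 0" by (auto split: if_splits)
        then have "\<sigma> \<union> s \<in> faces S" "card (\<sigma> \<union> s) = Suc (card \<sigma> + Suc k)" using chain_onD[OF w(1)] by auto
        moreover have "card (\<sigma> \<union> s) = card \<sigma> + card s"
          using s fin[OF \<open>\<sigma> \<union> s \<in> faces S\<close>] by (intro card_Un_disjoint) auto
        ultimately show "s \<in> faces (lk S \<sigma>) \<and> card s = Suc (Suc k)" using s by (simp add: faces_lk Un_commute)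
      qed
      moreover have "chain_bd V ?t t = u t" for t
      proof (cases "t \<inter> \<sigma> = {}")
        case True
        have "chain_bd V ?t t = (\<Sum>v\<in>V - (\<sigma> \<union> t). w (insert v (\<sigma> \<union> t)))"
          unfolding chain_bd_def using V True by (intro sum.mono_neutral_cong_right) auto
        also have "\<dots> = q (\<sigma> \<union> t)" using w(2)[of "\<sigma> \<union> t"] by (simp add: chain_bd_def)
        finally show ?thesis using q(3) True by simp
      next
        case False
        then have "chain_bd V ?t t = 0" unfolding chain_bd_def by (intro sum.neutral) auto
        moreover have "u t = 0" using chain_onD[OF u(1), of t] False by (auto simp: faces_lk)
        ultimately show ?thesis by simp
      qed
      ultimately show "\<exists>w. chain_on (faces (lk S \<sigma>)) (Suc (Suc k)) w \<and> (\<forall>t. chain_bd V w t = u t)" by blast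
    qed
  qed
next
  fix \<sigma> assume \<sigma>: "\<sigma> \<in> faces S" and eq: "card \<sigma> + k + 1 = r"
  show "\<forall>z. chain_on (faces (lk S \<sigma>)) (Suc k) z \<and> (\<forall>t. chain_bd V z t = 0) \<longrightarrow>
         (\<forall>t. z t = 0) \<or> (\<forall>t\<in>lk S \<sigma>. z t = 1)"
  proof (intro allI impI, elim conjE)
    fix u assume u: "chain_on (faces (lk S \<sigma>)) (Suc k) u" "\<forall>t. chain_bd V u t = 0"
    show "(\<forall>t. u t = 0) \<or> (\<forall>t\<in>lk S \<sigma>. u t = 1)"
    proof (cases "\<sigma> = {}")
      case True
      then show ?thesis using sphere_top_cycle[OF sph V card, of u] u eq k by auto
    next
      case False
      obtain q where q: "chain_on (faces S) (card \<sigma> + Suc k) q" "\<And>t. chain_bd V q t = 0"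
        "\<And>s. s \<inter> \<sigma> = {} \<Longrightarrow> q (\<sigma> \<union> s) = u s"
        using join_cycle[OF sph V \<sigma> False _ u(1)] u(2) k by auto
      have "(\<forall>t. q t = 0) \<or> (\<forall>t\<in>S. q t = 1)"
        using sphere_top_cycle[OF sph V card, of q] q eq k by auto
      then show ?thesis
      proof
        assume "\<forall>t. q t = 0"
        then have "u t = 0" for t using q(3)[of t] chain_onD[OF u(1), of t] by (cases "t \<inter> \<sigma> = {}") (auto simp: faces_lk)
        then show ?thesis by blast
      next
        assume q1: "\<forall>t\<in>S. q t = 1"
        have "u t = 1" if "t \<in> lk S \<sigma>" for t
        proof -
          obtain f where f: "f \<in> S" "\<sigma> \<subseteq> f" "t = f - \<sigma>" using \<open>t \<in> lk S \<sigma>\<close> by (auto simp: lk_def)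
          then have "\<sigma> \<union> t = f" "t \<inter> \<sigma> = {}" by auto
          then show ?thesis using q(3)[of t] q1 f by metis
        qed
        then show ?thesis by blast
      qed
    qed
  qed
qed

section \<open>Colexes\<close>

lemma sum_fun_apply: "(\<Sum>i\<in>I. f i) x = (\<Sum>i\<in>I. f i x)"
  by (induction I rule: infinite_finite_induct) auto

lemma colex_facets: "colex n L \<Longrightarrow> finite L \<and> (\<forall>f\<in>L. card f = Suc n)"
  by (cases n) auto

text \<open>The realization of a 0-dimensional complex has one point per vertex, and
  \<open>nsphere 0\<close> has two points.\<close>

lemma even_card_homeo_sphere_0:
  fixes K :: "'v set set"
  assumes "homeo_sphere 0 K" "finite K" "\<forall>f\<in>K. card f = 1"
  shows "even (card K)"
proof -
  let ?X = "subtopology (powertop_real UNIV) (realization K)"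
  obtain f g where fg: "homeomorphic_maps ?X (nsphere 0) f g"
    using assms(1) by (auto simp: homeo_sphere_def homeomorphic_space_def)
  have "bij_betw f (topspace ?X) (topspace (nsphere 0))"
    using fg unfolding homeomorphic_maps_def continuous_map_def
    by (intro bij_betw_byWitness[where f' = g]) auto
  then have 1: "card (realization K) = card (topspace (nsphere 0))" by (simp add: bij_betw_same_card)
  let ?i = "\<lambda>s v. if v \<in> s then 1 else (0::real)"
  have "realization K = ?i ` K"
  proof (intro equalityI subsetI)
    fix x assume "x \<in> realization K"
    then obtain s where s: "s \<in> K" "\<forall>v. v \<notin> s \<longrightarrow> x v = 0" "sum x s = 1" by (auto simp: realization_def)
    then obtain v where v: "s = {v}" using assms(3) by (metis card_1_singletonE)
    then have "x = ?i s" using s by (auto simp: fun_eq_iff)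
    then show "x \<in> ?i ` K" using s by auto
  next
    fix x assume "x \<in> ?i ` K"
    then obtain s where s: "s \<in> K" "x = ?i s" by auto
    then obtain v where v: "s = {v}" using assms(3) by (metis card_1_singletonE)
    then show "x \<in> realization K" using s by (auto simp: realization_def intro!: bexI[of _ s])
  qed
  moreover have "inj_on ?i K"
  proof (rule inj_onI)
    fix s t :: "'v set" assume "?i s = ?i t"
    then have "v \<in> s \<longleftrightarrow> v \<in> t" for v by (metis zero_neq_one)
    then show "s = t" by blast
  qed
  ultimately have 2: "card (realization K) = card K" by (simp add: card_image)
  have "topspace (nsphere 0) = {(\<lambda>i. if i = 0 then 1 else 0), (\<lambda>i. if i = 0 then - 1 else 0)}"
  proof -
    have "x = (\<lambda>i. if i = 0 then 1 else 0) \<or> x = (\<lambda>i. if i = 0 then - 1 else 0)"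
      if "(x 0)\<^sup>2 = 1" "\<forall>i>0. x i = 0" for x :: "nat \<Rightarrow> real"
      using that by (auto simp: fun_eq_iff power2_eq_1_iff)
    then show ?thesis by (auto simp: nsphere)
  qed
  moreover have "(\<lambda>i. if i = 0 then 1 else 0) \<noteq> (\<lambda>i::nat. if i = 0 then - 1 else (0::real))"
    by (metis one_neq_neg_one)
  ultimately have "card (topspace (nsphere 0)) = 2" by simp
  then show ?thesis using 1 2 by simp
qed

text \<open>Facets through \<open>t\<close> are counted ball by ball. A ball centred at a vertex of
  \<open>t\<close> contributes an even number, by induction in its boundary sphere. Any other ball
  contributes one facet exactly if \<open>t\<close> lies in its boundary, which happens for two
  balls or none. A 0-colex may have any number of points, hence the extra condition for
  \<open>n = 0\<close>.\<close>

lemma colex_codim1_even: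
  assumes "colex n L" "n = 0 \<longrightarrow> homeo_sphere 0 L" "card t = n" "finite t"
  shows "even (card {f\<in>L. t \<subseteq> f})"
  using assms
proof (induction n arbitrary: L t)
  case 0
  then show ?case using even_card_homeo_sphere_0[of L] by auto
next
  case (Suc m)
  from Suc.prems(1) obtain B :: "('a \<times> 'a set set) set" where finB: "finite B"
    and B: "\<forall>(v,K)\<in>B. colex m K \<and> homeo_sphere m K \<and> v \<notin> vertices K"
    and L: "L = (\<Union>(v,K)\<in>B. cball_set v K)"
    and disj: "\<forall>b1\<in>B. \<forall>b2\<in>B. b1 \<noteq> b2 \<longrightarrow> cball_set (fst b1) (snd b1) \<inter> cball_set (fst b2) (snd b2) = {}"
    and two: "\<forall>\<sigma>. (\<exists>b\<in>B. \<sigma> \<in> snd b) \<longrightarrow> card {b\<in>B. \<sigma> \<in> snd b} = 2"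
    by auto
  have finL: "finite L" using colex_facets[OF Suc.prems(1)] by simp
  let ?A = "\<lambda>b. {f\<in>cball_set (fst b) (snd b). t \<subseteq> f}"
  have "{f\<in>L. t \<subseteq> f} = (\<Union>b\<in>B. ?A b)" unfolding L by auto
  moreover have "finite (?A b)" if "b \<in> B" for b
    using finL that unfolding L by (rule_tac finite_subset[of _ L]) (auto simp: L)
  ultimately have card: "card {f\<in>L. t \<subseteq> f} = (\<Sum>b\<in>B. card (?A b))"
    using finB disj by (simp only:) (intro card_UN_disjoint; blast)
  have par: "even (card (?A b)) \<longleftrightarrow> t \<notin> snd b" if bB: "b \<in> B" for b
  proof -
    obtain v K where b: "b = (v, K)" by (cases b)
    have K: "colex m K" "homeo_sphere m K" "v \<notin> vertices K" using B bB b by auto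
    have vK: "v \<notin> \<delta>" "card \<delta> = Suc m" if "\<delta> \<in> K" for \<delta>
      using K(3) that colex_facets[OF K(1)] by (auto simp: vertices_def)
    show ?thesis
    proof (cases "v \<in> t")
      case True
      have "bij_betw (insert v) {\<delta>\<in>K. t - {v} \<subseteq> \<delta>} (?A b)"
        unfolding bij_betw_def
      proof
        show "inj_on (insert v) {\<delta>\<in>K. t - {v} \<subseteq> \<delta>}"
        proof (rule inj_onI)
          fix x y assume "x \<in> {\<delta>\<in>K. t - {v} \<subseteq> \<delta>}" "y \<in> {\<delta>\<in>K. t - {v} \<subseteq> \<delta>}" "insert v x = insert v y"
          then show "x = y" using vK(1)[of x] vK(1)[of y] insert_ident[of v x y] by simp
        qed
        show "insert v ` {\<delta>\<in>K. t - {v} \<subseteq> \<delta>} = ?A b"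
          using b by (auto simp: cball_set_def)
      qed
      then have "card (?A b) = card {\<delta>\<in>K. t - {v} \<subseteq> \<delta>}" by (simp add: bij_betw_same_card)
      moreover have "even (card {\<delta>\<in>K. t - {v} \<subseteq> \<delta>})"
        using Suc.IH[OF K(1), of "t - {v}"] K(2) Suc.prems True by auto
      moreover have "t \<notin> snd b" using True K(3) b by (auto simp: vertices_def)
      ultimately show ?thesis by simp
    next
      case False
      have "?A b = (if t \<in> K then {insert v t} else {})"
      proof -
        have "t \<subseteq> insert v \<delta> \<longleftrightarrow> \<delta> = t" if "\<delta> \<in> K" for \<delta>
        proof
          assume "t \<subseteq> insert v \<delta>"
          then have "t \<subseteq> \<delta>" using False by auto
          moreover have "finite \<delta>" using vK(2)[OF that] by (metis card.infinite nat.distinct(1))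
          ultimately show "\<delta> = t" using vK(2)[OF that] Suc.prems(3) by (metis card_subset_eq)
        qed auto
        then show ?thesis using b by (auto simp: cball_set_def)
      qed
      then show ?thesis using b by simp
    qed
  qed
  have "even (card {f\<in>L. t \<subseteq> f}) \<longleftrightarrow> even (card {b\<in>B. odd (card (?A b))})"
    unfolding card using finB by (simp add: even_sum_iff)
  also have "{b\<in>B. odd (card (?A b))} = {b\<in>B. t \<in> snd b}" using par by blast
  also have "even (card {b\<in>B. t \<in> snd b})"
  proof (cases "\<exists>b\<in>B. t \<in> snd b")
    case True
    then have "card {b\<in>B. t \<in> snd b} = 2" using two by blast
    then show ?thesis by simp
  next
    case False
    then have "{b\<in>B. t \<in> snd b} = {}" by blast
    then show ?thesis by (simp only: card.empty even_zero)
  qed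
  finally show ?case by simp
qed

text \<open>A face \<open>t\<close> that is not a facet misses some colour \<open>c\<close>. The
  facets through \<open>t\<close> are grouped by their codimension-one face without colour
  \<open>c\<close>, and every group is even.\<close>

lemma colex_even_complex:
  assumes colex: "colex d L" "d \<noteq> 0" and b: "balanced V col N L" and N: "card N = Suc d"
  shows "even_complex L"
  unfolding even_complex_def
proof (intro allI impI)
  fix t assume t: "t \<notin> L"
  show "even (card {f\<in>L. t \<subseteq> f})"
  proof (cases "t \<in> faces L")
    case False
    then have "{f\<in>L. t \<subseteq> f} = {}" by (auto simp: faces_def)
    then show ?thesis by (simp only: card.empty even_zero)
  next
    case True
    note bt = balanced_face[OF b True]
    have "col ` t \<noteq> N"
    proof
      assume "col ` t = N"
      then have ct: "card t = card N" using bt by simp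
      obtain f where f: "f \<in> L" "t \<subseteq> f" using True by (auto simp: faces_def)
      then have "t = f" using card_subset_eq[OF balanced_facet(1)[OF b f(1)] f(2)] balanced_facet(5)[OF b f(1)] ct by simp
      then show False using f t by simp
    qed
    then obtain c where c: "c \<in> N" "c \<notin> col ` t" using bt by auto
    let ?A = "{f\<in>L. t \<subseteq> f}"
    let ?g = "\<lambda>f. {x\<in>f. col x \<noteq> c}"
    have finA: "finite ?A" using balanced_finite[OF b] by simp
    have "card ?A = (\<Sum>f\<in>?A. 1)" by simp
    also have "\<dots> = (\<Sum>\<rho>\<in>?g ` ?A. \<Sum>f\<in>{f\<in>?A. ?g f = \<rho>}. 1)"
      by (rule sum.image_gen[OF finA])
    finally have card: "card ?A = (\<Sum>\<rho>\<in>?g ` ?A. card {f\<in>?A. ?g f = \<rho>})" by simp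
    have gf: "card (?g f) = d" if f: "f \<in> L" for f
    proof -
      obtain v where v: "v \<in> f" "col v = c" "v \<in> V" "\<And>x. x \<in> f \<Longrightarrow> col x = c \<longleftrightarrow> x = v"
        using obtain_vertex_of_colour[OF b f c(1)] by metis
      then have "?g f = f - {v}" by auto
      then show ?thesis using v balanced_facet[OF b f] N by simp
    qed
    have "even (card {f\<in>?A. ?g f = \<rho>})" if \<rho>: "\<rho> \<in> ?g ` ?A" for \<rho>
    proof -
      obtain f0 where f0: "f0 \<in> L" "t \<subseteq> f0" "\<rho> = ?g f0" using \<rho> by blast
      have t\<rho>: "t \<subseteq> \<rho>" using f0 c by auto
      have fin\<rho>: "finite \<rho>" using balanced_facet(1)[OF b f0(1)] f0 by simp
      have c\<rho>: "card \<rho> = d" using gf f0 by simp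
      have "{f\<in>?A. ?g f = \<rho>} = {f\<in>L. \<rho> \<subseteq> f}"
      proof (intro equalityI subsetI)
        fix f assume "f \<in> {f\<in>L. \<rho> \<subseteq> f}"
        then have f: "f \<in> L" "\<rho> \<subseteq> f" by auto
        then have "\<rho> \<subseteq> ?g f" using f0 by auto
        moreover have "finite (?g f)" using balanced_facet(1)[OF b f(1)] by simp
        ultimately have "?g f = \<rho>" using gf[OF f(1)] c\<rho> by (metis card_subset_eq)
        then show "f \<in> {f\<in>?A. ?g f = \<rho>}" using f t\<rho> by auto
      qed auto
      then show ?thesis using colex_codim1_even[OF colex(1) _ c\<rho> fin\<rho>] colex(2) by simp
    qed
    then show ?thesis unfolding card by (intro dvd_sum) auto
  qed
qed

section \<open>Color code maps in terms of facet sums\<close>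

lemma simp_eq_faces: "simp m L = {s\<in>faces L. card s = Suc m}"
  by (auto simp: simp_def faces_def)

lemma star_bdry_eq_lk: "star_bdry L v = lk L {v}"
  by (auto simp: star_bdry_def lk_def)

lemma balanced_colex:
  assumes "colex d L" "proper_colouring d L col"
  shows "balanced (vertices L) col {..d} L"
proof -
  have L: "finite L" "\<And>f. f \<in> L \<Longrightarrow> card f = Suc d" using colex_facets[OF assms(1)] by auto
  have fin: "finite f" if "f \<in> L" for f using L(2)[OF that] by (metis card.infinite nat.distinct(1))
  have "bij_betw col f {..d}" if f: "f \<in> L" for f
  proof -
    have c: "col ` f \<subseteq> {..d}" "inj_on col f" using assms(2) f by (auto simp: proper_colouring_def)
    have "col ` f = {..d}" by (rule card_subset_eq) (use c L(2)[OF f] in \<open>auto simp: card_image\<close>)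
    then show ?thesis using c by (simp add: bij_betw_def)
  qed
  then show ?thesis using L(1) fin by (auto simp: balanced_def vertices_def)
qed

lemma simp_facets:
  assumes "balanced V col N L" "card N = Suc d"
  shows "simp d L = L"
proof (intro equalityI subsetI)
  fix s assume "s \<in> simp d L"
  then obtain f where f: "card s = Suc d" "f \<in> L" "s \<subseteq> f" by (auto simp: simp_def)
  then have "s = f" using card_subset_eq[OF balanced_facet(1)[OF assms(1) f(2)] f(3)] balanced_facet(5)[OF assms(1) f(2)] assms(2) by simp
  then show "s \<in> L" using f by simp
next
  fix f assume "f \<in> L"
  then show "f \<in> simp d L" using balanced_facet(5)[OF assms(1)] assms(2) by (auto simp: simp_def)
qed

lemma gbd_eq_facet_sum:
  assumes "balanced V col N L" "card N = Suc d" "m < d"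
  shows "gbd L d m \<gamma> t = (if t \<in> simp m L then facet_sum L \<gamma> t else 0)"
  using assms(3) simp_facets[OF assms(1,2)] by (simp add: gbd_def facet_sum_def)

lemma pi1_eq_facet_sum:
  assumes b: "balanced V col N L" and N: "card N = Suc d" and D: "card D = Suc k"
  shows "pi1 L col d D \<gamma> \<nu> = (if col ` \<nu> = D then facet_sum L \<gamma> \<nu> else 0)"
proof (cases "\<nu> \<in> simp k L")
  case True
  then show ?thesis using D simp_facets[OF b N] by (simp add: pi1_def facet_sum_def)
next
  case False
  have "facet_sum L \<gamma> \<nu> = 0" if "col ` \<nu> = D"
  proof (rule facet_sum_eq_0_if_not_face, rule notI)
    assume "\<nu> \<in> faces L"
    then show False using False that D balanced_face(5)[OF b] by (auto simp: simp_eq_faces)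
  qed
  then show ?thesis using False D by (simp add: pi1_def)
qed

lemma in_image_iff_face_generated:
  assumes b: "balanced V col N L" and N: "card N = Suc d" and j: "j < d" and \<gamma>: "is_chain L d \<gamma>"
  shows "in_image L j d \<gamma> \<longleftrightarrow> face_generated L (Suc j) \<gamma>"
proof
  have sub: "{\<kappa>\<in>simp j L. \<kappa> \<subseteq> f} = {\<kappa>. \<kappa> \<subseteq> f \<and> card \<kappa> = Suc j}" if "f \<in> L" for f
    using that by (auto simp: simp_def)
  have gb: "gbd L j d \<beta> f = (if f \<in> L then (\<Sum>\<kappa>\<in>{\<kappa>. \<kappa> \<subseteq> f \<and> card \<kappa> = Suc j}. \<beta> \<kappa>) else 0)" for \<beta> f
    using j sub[of f] simp_facets[OF b N] by (simp add: gbd_def)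
  show "face_generated L (Suc j) \<gamma>" if im: "in_image L j d \<gamma>"
  proof -
    obtain \<beta> where "gbd L j d \<beta> = \<gamma>" using im by (auto simp: in_image_def)
    then show ?thesis unfolding face_generated_def using gb by (intro exI[of _ \<beta>]) auto
  qed
  show "in_image L j d \<gamma>" if fg: "face_generated L (Suc j) \<gamma>"
  proof -
    obtain \<beta> where \<beta>: "\<And>f. f \<in> L \<Longrightarrow> \<gamma> f = (\<Sum>\<kappa>\<in>{\<kappa>. \<kappa> \<subseteq> f \<and> card \<kappa> = Suc j}. \<beta> \<kappa>)"
      using fg by (auto simp: face_generated_def)
    let ?\<beta> = "\<lambda>s. if s \<in> simp j L then \<beta> s else 0"
    have "gbd L j d ?\<beta> f = \<gamma> f" for f
    proof (cases "f \<in> L")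
      case True
      then have "gbd L j d ?\<beta> f = (\<Sum>\<kappa>\<in>{\<kappa>. \<kappa> \<subseteq> f \<and> card \<kappa> = Suc j}. ?\<beta> \<kappa>)" using gb by simp
      also have "\<dots> = (\<Sum>\<kappa>\<in>{\<kappa>. \<kappa> \<subseteq> f \<and> card \<kappa> = Suc j}. \<beta> \<kappa>)"
        using True by (intro sum.cong) (auto simp: simp_def)
      finally show ?thesis using \<beta>[OF True] by simp
    next
      case False
      then have "\<gamma> f = 0" using \<gamma> simp_facets[OF b N] unfolding is_chain_def by auto
      then show ?thesis using False gb by simp
    qed
    moreover have "is_chain L j ?\<beta>" by (auto simp: is_chain_def)
    ultimately show ?thesis unfolding in_image_def by blast
  qed
qed

text \<open>For \<open>\<nu>\<close> of colour set \<open>D\<close>, the cells whose link contains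
  \<open>\<nu>\<close> correspond to the facets through \<open>\<nu>\<close>, the cell being the
  complementary face.\<close>

lemma bdXi_eq_facet_sum:
  assumes b: "balanced V col {..d} L" and D: "D \<subseteq> {..d}" "card D = Suc k" and k: "k < d"
  shows "bdXi L col d D \<xi> \<nu> = (if col ` \<nu> = D then facet_sum L (\<lambda>f. \<xi> (colour_part col ({..d} - D) f)) \<nu> else 0)"
proof -
  let ?N = "{..d}"
  let ?A = "{\<delta>\<in>xi_cells L col d D. \<nu> \<in> link L k \<delta>}"
  have finD: "finite D" using D finite_subset by blast
  have cD: "card (?N - D) = d - k" using D finD by (simp add: card_Diff_subset)
  have A: "\<nu> \<in> faces L \<and> col ` \<nu> = D \<and> \<delta> = colour_part col (?N - D) (\<nu> \<union> \<delta>) \<and> \<nu> \<union> \<delta> \<in> L" if \<delta>: "\<delta> \<in> ?A" for \<delta>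
  proof -
    have c\<delta>: "col ` \<delta> = ?N - D" and \<nu>: "\<nu> \<in> faces L" "card \<nu> = Suc k" "\<nu> \<inter> \<delta> = {}"
      using \<delta> by (auto simp: xi_cells_def link_def simp_eq_faces)
    obtain f where f: "f \<in> L" "\<nu> \<union> \<delta> \<subseteq> f" using \<delta> by (auto simp: link_def)
    note bf = balanced_facet[OF b f(1)]
    \<comment> \<open>A vertex of \<open>\<nu>\<close> with a colour outside \<open>D\<close> would
      share it with a vertex of \<open>\<delta>\<close> in the same facet, against
      disjointness.\<close>
    have "col ` \<nu> \<subseteq> D"
    proof
      fix c assume "c \<in> col ` \<nu>"
      then obtain x where x: "x \<in> \<nu>" "c = col x" by auto
      show "c \<in> D"
      proof (rule ccontr)
        assume "c \<notin> D"
        moreover have "c \<in> ?N" using x f bf(4) by auto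
        ultimately obtain y where y: "y \<in> \<delta>" "col y = c" using c\<delta> by (metis DiffI imageE)
        then have "x = y" using bf(3) f x by (auto simp: inj_on_def)
        then show False using x y \<nu> by auto
      qed
    qed
    then have c\<nu>: "col ` \<nu> = D" using balanced_face(5)[OF b \<nu>(1)] \<nu>(2) D finD by (intro card_subset_eq) auto
    have "col ` (\<nu> \<union> \<delta>) = col ` f" using c\<nu> c\<delta> D bf(4) by auto
    then have "\<nu> \<union> \<delta> = f" using f(2) bf(3) by (metis inj_on_image_eq_iff subset_refl)
    moreover have "\<delta> = colour_part col (?N - D) (\<nu> \<union> \<delta>)" using c\<nu> c\<delta> by (auto simp: colour_part_def)
    ultimately show ?thesis using \<nu> c\<nu> f by simp
  qed
  show ?thesis
  proof (cases "col ` \<nu> = D")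
    case False
    have "?A = {}" using A False by blast
    then have "(\<Sum>\<delta>\<in>?A. \<xi> \<delta>) = 0" by (simp only: sum.empty)
    then show ?thesis using False D by (simp add: bdXi_def)
  next
    case True
    have "(\<Sum>\<delta>\<in>?A. \<xi> \<delta>) = (\<Sum>f\<in>{f\<in>L. \<nu> \<subseteq> f}. \<xi> (colour_part col (?N - D) f))"
    proof (rule sum.reindex_bij_witness[where i = "colour_part col (?N - D)" and j = "\<lambda>\<delta>. \<nu> \<union> \<delta>"])
      fix \<delta> assume "\<delta> \<in> ?A"
      note a = A[OF this]
      then show "colour_part col (?N - D) (\<nu> \<union> \<delta>) = \<delta>" "\<nu> \<union> \<delta> \<in> {f\<in>L. \<nu> \<subseteq> f}" by auto
      then show "\<xi> (colour_part col (?N - D) (\<nu> \<union> \<delta>)) = \<xi> \<delta>" by simp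
    next
      fix f assume "f \<in> {f\<in>L. \<nu> \<subseteq> f}"
      then have f: "f \<in> L" "\<nu> \<subseteq> f" by auto
      note bf = balanced_facet[OF b f(1)]
      let ?\<delta> = "colour_part col (?N - D) f"
      have sub: "?\<delta> \<subseteq> f" by (auto simp: colour_part_def)
      have \<nu>: "\<nu> = {x\<in>f. col x \<in> D}"
      proof (rule inj_on_image_eq_iff[OF bf(3), THEN iffD1])
        show "col ` \<nu> = col ` {x\<in>f. col x \<in> D}" using True bf(4) D f by auto
      qed (use f in auto)
      then show "\<nu> \<union> ?\<delta> = f" using bf(4) by (auto simp: colour_part_def)
      have c\<delta>: "col ` ?\<delta> = ?N - D" using bf(4) by (auto simp: colour_part_def)
      have "card ?\<delta> = d - k"
        using card_image[of col ?\<delta>] inj_on_subset[OF bf(3) sub] c\<delta> cD by simp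
      then have "?\<delta> \<in> simp (d - Suc k) L" using f(1) sub k by (auto simp: simp_def)
      then have "?\<delta> \<in> xi_cells L col d D" using c\<delta> D by (simp add: xi_cells_def)
      moreover have "card \<nu> = Suc k" using card_image[of col \<nu>] inj_on_subset[OF bf(3) f(2)] True D by simp
      then have "\<nu> \<in> link L k ?\<delta>" using \<nu> f sub by (auto simp: link_def simp_def colour_part_def)
      ultimately show "?\<delta> \<in> ?A" by simp
    qed
    then show ?thesis using True D by (simp add: bdXi_def facet_sum_def)
  qed
qed

lemma in_image_Xi_iff:
  assumes b: "balanced V col {..d} L" and D: "D \<subseteq> {..d}" "card D = Suc k" and k: "k < d"
  shows "in_image_Xi L col d D \<gamma> \<longleftrightarrow>
    (\<exists>\<xi>. \<forall>\<nu>. \<gamma> \<nu> = (if col ` \<nu> = D then facet_sum L (\<lambda>f. \<xi> (colour_part col ({..d} - D) f)) \<nu> else 0))"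
proof
  assume "in_image_Xi L col d D \<gamma>"
  then obtain \<xi> where "bdXi L col d D \<xi> = \<gamma>" by (auto simp: in_image_Xi_def)
  then show "\<exists>\<xi>. \<forall>\<nu>. \<gamma> \<nu> = (if col ` \<nu> = D then facet_sum L (\<lambda>f. \<xi> (colour_part col ({..d} - D) f)) \<nu> else 0)"
    using bdXi_eq_facet_sum[OF assms, of \<xi>] by (intro exI[of _ \<xi>]) auto
next
  assume "\<exists>\<xi>. \<forall>\<nu>. \<gamma> \<nu> = (if col ` \<nu> = D then facet_sum L (\<lambda>f. \<xi> (colour_part col ({..d} - D) f)) \<nu> else 0)"
  then obtain \<xi> where \<xi>: "\<And>\<nu>. \<gamma> \<nu> = bdXi L col d D \<xi> \<nu>" using bdXi_eq_facet_sum[OF assms] by metis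
  let ?\<xi> = "\<lambda>\<delta>. if \<delta> \<in> xi_cells L col d D then \<xi> \<delta> else 0"
  have "bdXi L col d D ?\<xi> = \<gamma>"
    using \<xi> by (intro ext) (auto simp: bdXi_def intro: sum.cong)
  then show "in_image_Xi L col d D \<gamma>" unfolding in_image_Xi_def by (intro exI[of _ ?\<xi>]) auto
qed

lemma bd_eq_chain_bd:
  assumes "finite (vertices L)" "1 \<le> k" "t \<in> simp (k - 1) L" "\<And>s. z s \<noteq> 0 \<Longrightarrow> s \<in> simp k L"
  shows "bd L k z t = chain_bd (vertices L) z t"
proof -
  have fin: "finite s" "s \<subseteq> vertices L" if "s \<in> simp m L" for s m
    using that assms(1) by (auto simp: simp_def vertices_def intro: finite_subset[of s "\<Union>L"])
  have ct: "card t = k" using assms(2,3) by (auto simp: simp_def)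
  have inj: "inj_on (\<lambda>v. insert v t) (vertices L - t)"
    by (rule inj_onI) blast
  have "chain_bd (vertices L) z t = (\<Sum>s\<in>(\<lambda>v. insert v t) ` (vertices L - t). z s)"
    unfolding chain_bd_def sum.reindex[OF inj] o_def ..
  also have "\<dots> = (\<Sum>\<kappa>\<in>{\<kappa>\<in>simp k L. t \<subseteq> \<kappa>}. z \<kappa>)"
  proof (rule sum.mono_neutral_cong)
    have "{\<kappa>\<in>simp k L. t \<subseteq> \<kappa>} \<subseteq> Pow (vertices L)" using fin(2) by blast
    then show "finite {\<kappa>\<in>simp k L. t \<subseteq> \<kappa>}" using assms(1) by (simp add: finite_subset)
    fix s assume "s \<in> {\<kappa>\<in>simp k L. t \<subseteq> \<kappa>} - (\<lambda>v. insert v t) ` (vertices L - t)"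
    then have s: "s \<in> simp k L" "t \<subseteq> s" "s \<notin> (\<lambda>v. insert v t) ` (vertices L - t)" by auto
    have "card (s - t) = 1" using s fin[OF s(1)] ct card_Diff_subset[of t s] fin(1)[OF assms(3)] by (auto simp: simp_def)
    then obtain v where "s - t = {v}" by (metis card_1_singletonE)
    then have "s = insert v t" "v \<in> vertices L - t" using s(2) fin(2)[OF s(1)] by auto
    then show "z s = 0" using s(3) by auto
  next
    fix s assume "s \<in> (\<lambda>v. insert v t) ` (vertices L - t) - {\<kappa>\<in>simp k L. t \<subseteq> \<kappa>}"
    then show "z s = 0" using assms(4)[of s] by auto
  qed (use assms(1) in auto)
  finally show ?thesis using assms(2,3) by (simp add: bd_def gbd_def)
qed

theorem theorem2:
  fixes L :: "'v set set" and col :: "'v \<Rightarrow> nat" and d k cs :: nat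
    and \<epsilon> :: "'v chain" and \<rho> :: "nat set \<Rightarrow> 'v chain" and \<tau> :: "'v \<Rightarrow> 'v chain"
  assumes colex: "colex d L"
    and col: "proper_colouring d L col"
    and standing: "\<forall>v\<in>vertices L. colex (d - 1) (star_bdry L v) \<and> homeo_sphere (d - 1) (star_bdry L v)"
    and k: "1 \<le> k" "k < d"
    and cs: "cs \<le> d"
    and eps: "is_chain L d \<epsilon>"
    and rho: "\<forall>C\<in>{C. C \<subseteq> {..d} \<and> cs \<notin> C \<and> card C = k}.
                restr_chain L col k (insert cs C) (\<rho> C) \<and>
                bd L k (\<rho> C) = pi0 col (insert cs C) (gbd L d (k - 1) \<epsilon>)"
    and tau: "\<forall>v\<in>verts_of_colour col cs (\<Sum>C\<in>{C. C \<subseteq> {..d} \<and> cs \<notin> C \<and> card C = k}. \<rho> C).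
                is_chain L d (\<tau> v) \<and> (\<forall>s. \<tau> v s \<noteq> 0 \<longrightarrow> v \<in> s) \<and>
                (\<forall>C\<in>{C. C \<subseteq> {..d} \<and> cs \<notin> C \<and> card C = k}.
                   pi1 L col d (insert cs C) (\<tau> v) = restrict_at (\<rho> C) v)"
  shows "gbd L d (k - 1)
           (\<epsilon> + (\<Sum>v\<in>verts_of_colour col cs (\<Sum>C\<in>{C. C \<subseteq> {..d} \<and> cs \<notin> C \<and> card C = k}. \<rho> C). \<tau> v)) = 0
       \<and> (in_image L (d - k - 1) d
           (\<epsilon> + (\<Sum>v\<in>verts_of_colour col cs (\<Sum>C\<in>{C. C \<subseteq> {..d} \<and> cs \<notin> C \<and> card C = k}. \<rho> C). \<tau> v))
          \<longleftrightarrow> (\<forall>C\<in>{C. C \<subseteq> {..d} \<and> cs \<notin> C \<and> card C = k}.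
                in_image_Xi L col d (insert cs C) (pi1 L col d (insert cs C) \<epsilon> + \<rho> C)))"
proof -
  define V where "V = vertices L"
  define CC where "CC = {C. C \<subseteq> {..d} \<and> cs \<notin> C \<and> card C = k}"
  define W where "W = verts_of_colour col cs (\<Sum>C\<in>CC. \<rho> C)"
  define \<phi> where "\<phi> = (\<Sum>v\<in>W. \<tau> v)"
  define \<gamma> where "\<gamma> = \<epsilon> + \<phi>"
  let ?N = "{..d}"
  have N: "card ?N = Suc d" by simp
  have b: "balanced V col ?N L" unfolding V_def by (rule balanced_colex[OF colex col])
  have e: "even_complex L" using colex_even_complex[OF colex _ b N] k by simp
  have finV: "finite V" using b by (simp add: balanced_def)
  have finCC: "finite CC" unfolding CC_def by (rule finite_subset[of _ "Pow ?N"]) auto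
  have CCI: "D - {cs} \<in> CC" "insert cs (D - {cs}) = D" if "cs \<in> D" "D \<subseteq> ?N" "card D = Suc k" for D
  proof -
    have "finite D" using that(2) finite_subset by blast
    then show "D - {cs} \<in> CC" using that by (auto simp: CC_def)
    show "insert cs (D - {cs}) = D" using that by auto
  qed
  have CCD: "insert cs C \<subseteq> ?N" "card (insert cs C) = Suc k" "cs \<notin> C" if "C \<in> CC" for C
  proof -
    have "finite C" using that finite_subset by (auto simp: CC_def)
    then show "insert cs C \<subseteq> ?N" "card (insert cs C) = Suc k" "cs \<notin> C" using that cs by (auto simp: CC_def)
  qed
  have rs: "s \<in> simp k L \<and> col ` s = insert cs C" if C: "C \<in> CC" and s: "\<rho> C s \<noteq> 0" for C s
  proof -
    have s': "s \<in> simp k L" "col ` s \<subseteq> insert cs C"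
      using rho C s unfolding CC_def restr_chain_def by blast+
    have fin: "finite (insert cs C)" by (rule finite_subset[OF CCD(1)[OF C]]) simp
    have "card (col ` s) = card (insert cs C)"
      using s'(1) CCD(2)[OF C] balanced_face(5)[OF b] by (auto simp: simp_eq_faces)
    then show ?thesis using card_subset_eq[OF fin s'(2)] s'(1) by blast
  qed
  \<comment> \<open>The supports for different \<open>C\<close> are separated by their colour sets,
    so nothing cancels in the sum and \<open>W\<close> contains every vertex of colour
    \<open>cs\<close> of every \<open>\<rho> C\<close>.\<close>
  have \<rho>_sum: "(\<Sum>C\<in>CC. \<rho> C) s = \<rho> C s" if C: "C \<in> CC" and s: "\<rho> C s \<noteq> 0" for C s
  proof -
    have "\<rho> C' s = 0" if "C' \<in> CC - {C}" for C'
    proof (rule ccontr)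
      assume "\<rho> C' s \<noteq> 0"
      then have "insert cs C' = insert cs C" using rs[of C' s] rs[OF C s] that by auto
      then show False using CCD(3)[OF C] CCD(3)[of C'] that by (metis DiffE insert_ident singletonI)
    qed
    then have "(\<Sum>C\<in>CC. \<rho> C s) = (\<Sum>C\<in>{C}. \<rho> C s)" using finCC C by (intro sum.mono_neutral_right) auto
    then show ?thesis by (simp add: sum_fun_apply)
  qed
  have in_W: "v \<in> W" if "C \<in> CC" "\<rho> C s \<noteq> 0" "v \<in> s" "col v = cs" for C s v
  proof -
    have "(\<Sum>C\<in>CC. \<rho> C) s \<noteq> 0" using \<rho>_sum[OF that(1,2)] that(2) by metis
    then show ?thesis unfolding W_def verts_of_colour_def using that(3,4) by blast
  qed
  have WV: "W \<subseteq> V"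
  proof
    fix v assume "v \<in> W"
    then obtain s where s: "v \<in> s" "(\<Sum>C\<in>CC. \<rho> C) s \<noteq> 0" by (auto simp: W_def verts_of_colour_def)
    then obtain C where "C \<in> CC" "\<rho> C s \<noteq> 0" unfolding sum_fun_apply by (metis (no_types, lifting) sum.neutral)
    then have "s \<in> faces L" using rs by (auto simp: simp_eq_faces)
    then show "v \<in> V" using balanced_face(2)[OF b] s by auto
  qed
  have finW: "finite W" by (rule finite_subset[OF WV finV])
  have \<tau>: "is_chain L d (\<tau> v)" "\<And>C. C \<in> CC \<Longrightarrow> pi1 L col d (insert cs C) (\<tau> v) = restrict_at (\<rho> C) v"
    if "v \<in> W" for v
    using tau that unfolding W_def CC_def by blast+
  \<comment> \<open>If \<open>\<rho> C\<close> is nonzero at \<open>\<nu>\<close>, exactly one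
    vertex of \<open>\<nu>\<close> has colour \<open>cs\<close>, and only its
    \<open>\<tau> v\<close> contributes.\<close>
  have \<phi>_fsum: "facet_sum L \<phi> \<nu> = \<rho> C \<nu>" if C: "C \<in> CC" and \<nu>: "col ` \<nu> = insert cs C" for C \<nu>
  proof -
    have "facet_sum L \<phi> \<nu> = (\<Sum>v\<in>W. facet_sum L (\<tau> v) \<nu>)"
      unfolding facet_sum_def \<phi>_def sum_fun_apply by (rule sum.swap)
    also have "\<dots> = (\<Sum>v\<in>W. restrict_at (\<rho> C) v \<nu>)"
    proof (intro sum.cong refl)
      fix v assume v: "v \<in> W"
      show "facet_sum L (\<tau> v) \<nu> = restrict_at (\<rho> C) v \<nu>"
        using pi1_eq_facet_sum[OF b N CCD(2)[OF C], of "\<tau> v" \<nu>] \<tau>(2)[OF v C] \<nu> by simp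
    qed
    also have "\<dots> = \<rho> C \<nu>"
    proof (cases "\<rho> C \<nu> = 0")
      case True
      then show ?thesis by (auto simp: restrict_at_def intro: sum.neutral)
    next
      case False
      obtain v where v: "v \<in> \<nu>" "col v = cs" using \<nu> by (metis imageE insertI1)
      have vW: "v \<in> W" by (rule in_W[OF C False v])
      have "\<nu> \<in> faces L" using rs[OF C False] by (simp add: simp_eq_faces)
      then have inj: "inj_on col \<nu>" by (rule balanced_face(3)[OF b])
      have "restrict_at (\<rho> C) x \<nu> = 0" if "x \<in> W - {v}" for x
      proof -
        have "col x = cs" using that by (auto simp: W_def verts_of_colour_def)
        then have "x \<notin> \<nu>" using inj v that by (auto simp: inj_on_def)
        then show ?thesis by (simp add: restrict_at_def)
      qed
      then have "(\<Sum>v\<in>W. restrict_at (\<rho> C) v \<nu>) = (\<Sum>v\<in>{v}. restrict_at (\<rho> C) v \<nu>)"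
        using finW vW by (intro sum.mono_neutral_right) auto
      then show ?thesis using v by (simp add: restrict_at_def)
    qed
    finally show ?thesis .
  qed
  have \<gamma>_fsum: "facet_sum L \<gamma> t = facet_sum L \<epsilon> t + facet_sum L \<phi> t" for t
    by (simp add: \<gamma>_def facet_sum_def sum.distrib)
  have pi1_\<gamma>: "(pi1 L col d (insert cs C) \<epsilon> + \<rho> C) \<nu> = (if col ` \<nu> = insert cs C then facet_sum L \<gamma> \<nu> else 0)"
    if C: "C \<in> CC" for C \<nu>
    using pi1_eq_facet_sum[OF b N CCD(2)[OF C], of \<epsilon> \<nu>] \<phi>_fsum[OF C, of \<nu>] rs[OF C, of \<nu>] \<gamma>_fsum[of \<nu>] by auto
  have \<gamma>_chain: "is_chain L d \<gamma>"
    unfolding is_chain_def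
  proof (intro allI impI)
    fix s assume "\<gamma> s \<noteq> 0"
    then consider "\<epsilon> s \<noteq> 0" | "(\<Sum>v\<in>W. \<tau> v s) \<noteq> 0" 
      unfolding \<gamma>_def \<phi>_def plus_fun_def sum_fun_apply by fastforce
    then show "s \<in> simp d L"
    proof cases
      case 1
      then show ?thesis using eps by (auto simp: is_chain_def)
    next
      case 2
      then obtain v where "v \<in> W" "\<tau> v s \<noteq> 0" by (metis (no_types, lifting) sum.neutral)
      then show ?thesis using \<tau>(1) by (auto simp: is_chain_def)
    qed
  qed
  have ker: "facet_sum L \<gamma> t = 0" if t: "t \<in> simp (k - 1) L" for t
  proof -
    have t': "t \<in> faces L" "card t = k" using t k by (auto simp: simp_eq_faces)
    note bt = balanced_face[OF b t'(1)]
    have "\<not> ?N \<subseteq> col ` t"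
      using card_mono[of "col ` t" ?N] bt(1,5) t'(2) k by auto
    then obtain c0 where c0: "c0 \<in> ?N" "c0 \<notin> col ` t" by auto
    \<comment> \<open>The new colour is chosen so that \<open>?D\<close> contains \<open>cs\<close>
      and is therefore of the form \<open>insert cs C\<close>.\<close>
    define c where "c = (if cs \<in> col ` t then c0 else cs)"
    have c: "c \<in> ?N" "c \<notin> col ` t" "cs \<in> insert c (col ` t)" using c0 cs by (auto simp: c_def)
    let ?D = "insert c (col ` t)"
    have D: "?D \<subseteq> ?N" "card ?D = Suc k" using c bt t' by auto
    let ?C = "?D - {cs}"
    note C = CCI[OF c(3) D]
    \<comment> \<open>Split by the vertices of colour \<open>c\<close>, the facet sum of
      \<open>\<phi>\<close> becomes the boundary of a \<open>\<rho> C\<close>, which is the syndrome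
      of \<open>\<epsilon>\<close> at \<open>t\<close>; mod 2 the two cancel.\<close>
    have "facet_sum L \<phi> t = (\<Sum>x\<in>{x\<in>V. col x = c}. facet_sum L \<phi> (insert x t))"
      by (rule facet_sum_split_colour[OF b c(1,2)])
    also have "\<dots> = (\<Sum>x\<in>{x\<in>V. col x = c}. \<rho> ?C (insert x t))"
      using \<phi>_fsum[OF C(1)] C(2) by (intro sum.cong) auto
    also have "\<dots> = chain_bd V (\<rho> ?C) t"
      unfolding chain_bd_def
    proof (rule sum.mono_neutral_left)
      show "{x\<in>V. col x = c} \<subseteq> V - t" using c(2) by auto
      show "\<forall>i\<in>(V - t) - {x\<in>V. col x = c}. \<rho> ?C (insert i t) = 0"
      proof
        fix i assume i: "i \<in> (V - t) - {x\<in>V. col x = c}"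
        show "\<rho> ?C (insert i t) = 0"
        proof (rule ccontr)
          assume nz: "\<rho> ?C (insert i t) \<noteq> 0"
          have "col ` insert i t = ?D" using rs[OF C(1) nz] C(2) by simp
          then show False using i c(2) by auto
        qed
      qed
    qed (use finV in auto)
    also have "\<dots> = bd L k (\<rho> ?C) t"
      unfolding V_def
    proof (rule bd_eq_chain_bd[symmetric, OF _ k(1) t])
      show "finite (vertices L)" using finV by (simp only: V_def)
      show "s \<in> simp k L" if "\<rho> ?C s \<noteq> 0" for s using rs[OF C(1) that] by blast
    qed
    also have "\<dots> = pi0 col (insert cs ?C) (gbd L d (k - 1) \<epsilon>) t"
      using rho C(1) unfolding CC_def by auto
    also have "\<dots> = facet_sum L \<epsilon> t"
      using t k unfolding C(2) by (auto simp: pi0_def gbd_eq_facet_sum[OF b N])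
    finally show ?thesis by (simp add: \<gamma>_fsum)
  qed
  have part1: "gbd L d (k - 1) \<gamma> = 0"
    using ker k by (intro ext) (auto simp: gbd_eq_facet_sum[OF b N])
  have gen_iff: "in_image L (d - k - 1) d \<gamma> \<longleftrightarrow> face_generated L (d - k) \<gamma>"
  proof -
    have "d - k - 1 < d" "Suc (d - k - 1) = d - k" using k by auto
    then show ?thesis using in_image_iff_face_generated[OF b N _ \<gamma>_chain] by metis
  qed
  have xi_iff: "in_image_Xi L col d (insert cs C) (pi1 L col d (insert cs C) \<epsilon> + \<rho> C) \<longleftrightarrow>
      (\<exists>\<xi>. \<forall>\<nu>. col ` \<nu> = insert cs C \<longrightarrow> facet_sum L \<gamma> \<nu> = facet_sum L (\<lambda>f. \<xi> (colour_part col (?N - insert cs C) f)) \<nu>)"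
    if C: "C \<in> CC" for C
    unfolding in_image_Xi_iff[OF b CCD(1,2)[OF C] k(2)] pi1_\<gamma>[OF C] by auto
  have "face_generated L (d - k) \<gamma> \<longleftrightarrow>
      (\<forall>C\<in>CC. \<exists>\<xi>. \<forall>\<nu>. col ` \<nu> = insert cs C \<longrightarrow> facet_sum L \<gamma> \<nu> = facet_sum L (\<lambda>f. \<xi> (colour_part col (?N - insert cs C) f)) \<nu>)"
    (is "?lhs \<longleftrightarrow> ?rhs")
  proof
    assume ?lhs
    then obtain \<beta> where \<beta>: "\<And>f. f \<in> L \<Longrightarrow> \<gamma> f = (\<Sum>\<kappa>\<in>{\<kappa>. \<kappa> \<subseteq> f \<and> card \<kappa> = d - k}. \<beta> \<kappa>)"
      by (auto simp: face_generated_def)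
    show ?rhs
    \<comment> \<open>One \<open>\<beta>\<close> serves as the chain of cells for every
      \<open>C\<close>: of the colour sets of faces, evenness leaves only the complement of
      \<open>insert cs C\<close>.\<close>
    proof (intro ballI exI[of _ \<beta>] allI impI)
      fix C \<nu> assume C: "C \<in> CC" and \<nu>: "col ` \<nu> = insert cs C"
      let ?D = "insert cs C"
      let ?BB = "{B. B \<subseteq> ?N \<and> card B = d - k}"
      have finD: "finite ?D" by (rule finite_subset[OF CCD(1)[OF C]]) simp
      have cD: "card (?N - ?D) = d - k"
        using CCD(1,2)[OF C] finD card_Diff_subset[of ?D ?N] by simp
      have "facet_sum L \<gamma> \<nu> = (\<Sum>f\<in>{f\<in>L. \<nu> \<subseteq> f}. \<Sum>B\<in>?BB. \<beta> (colour_part col B f))"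
        unfolding facet_sum_def using \<beta> sum_subsets_by_colour[OF b] by (intro sum.cong) auto
      also have "\<dots> = (\<Sum>B\<in>?BB. facet_sum L (\<lambda>f. \<beta> (colour_part col B f)) \<nu>)"
        unfolding facet_sum_def by (rule sum.swap)
      also have "\<dots> = (\<Sum>B\<in>{?N - ?D}. facet_sum L (\<lambda>f. \<beta> (colour_part col B f)) \<nu>)"
      proof (rule sum.mono_neutral_right)
        show "finite ?BB" by (rule finite_subset[of _ "Pow ?N"]) auto
        show "{?N - ?D} \<subseteq> ?BB" using cD by auto
        show "\<forall>B\<in>?BB - {?N - ?D}. facet_sum L (\<lambda>f. \<beta> (colour_part col B f)) \<nu> = 0"
        proof
          fix B assume B: "B \<in> ?BB - {?N - ?D}"
          have "col ` \<nu> \<union> B \<noteq> ?N"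
          proof
            assume "col ` \<nu> \<union> B = ?N"
            then have "?N - ?D \<subseteq> B" using \<nu> by auto
            moreover have "finite B" using B finite_subset[of B ?N] by auto
            ultimately have "?N - ?D = B" using cD B by (intro card_subset_eq) auto
            then show False using B by auto
          qed
          then show "facet_sum L (\<lambda>f. \<beta> (colour_part col B f)) \<nu> = 0"
            using B by (intro facet_sum_colour_part_eq_0[OF b e]) auto
        qed
      qed
      finally show "facet_sum L \<gamma> \<nu> = facet_sum L (\<lambda>f. \<beta> (colour_part col (?N - ?D) f)) \<nu>" by simp
    qed
  next
    assume r: ?rhs
    \<comment> \<open>Localizing at \<open>cs\<close> asks only for the sets \<open>D\<close>
      containing \<open>cs\<close>, exactly those covered by the right side, and leaves problems in
      links of vertices of colour \<open>cs\<close>, which are spheres.\<close>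
    have "face_generated L (card ?N - k - 1) \<gamma>"
    proof (rule face_generated_localize[OF b e, of cs k])
      show "cs \<in> ?N" "k + 2 \<le> card ?N" using cs k by auto
    next
      fix D assume D: "cs \<in> D" "D \<subseteq> ?N" "card D = Suc k"
      show "\<exists>\<xi>. \<forall>\<nu>. col ` \<nu> = D \<longrightarrow> facet_sum L \<gamma> \<nu> = facet_sum L (\<lambda>f. \<xi> (colour_part col (?N - D) f)) \<nu>"
        using bspec[OF r CCI(1)[OF D]] unfolding CCI(2)[OF D] .
    next
      fix v \<gamma>'
      assume v: "col v = cs" and \<gamma>': "\<And>t. card t = k \<Longrightarrow> t \<in> faces (lk L {v}) \<Longrightarrow> facet_sum (lk L {v}) \<gamma>' t = 0"
      have cN: "card (?N - {cs}) = d" using cs by simp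
      have bl: "balanced V col (?N - {cs}) (lk L {v})" by (rule balanced_lk[OF b v])
      have "links_spherical V (lk L {v}) k (card (?N - {cs}))"
      proof (cases "v \<in> vertices L")
        case True
        then have "homeo_sphere (d - 1) (lk L {v})" using standing by (simp add: star_bdry_eq_lk)
        then show ?thesis
          using bl balanced_facet[OF bl] by (intro sphere_links_spherical finV k) auto
      next
        \<comment> \<open>Any \<open>v\<close> of the type may have colour \<open>cs\<close>; one
          outside the complex has an empty link.\<close>
        case False
        then have "faces (lk L {v}) = {}" by (auto simp: faces_def lk_def vertices_def)
        then show ?thesis by (simp add: links_spherical_def)
      qed
      then have "face_generated (lk L {v}) (card (?N - {cs}) - k - 1) \<gamma>'"
        by (rule face_generated_if_facet_sum_0[OF bl _ even_complex_lk[OF e] _ \<gamma>']) (use cN k in auto)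
      moreover have "card (?N - {cs}) - k - 1 = card ?N - k - 2" using cN N by simp
      ultimately show "face_generated (lk L {v}) (card ?N - k - 2) \<gamma>'" by metis
    qed
    then show ?lhs by simp
  qed
  then have part2: "in_image L (d - k - 1) d \<gamma> \<longleftrightarrow>
      (\<forall>C\<in>CC. in_image_Xi L col d (insert cs C) (pi1 L col d (insert cs C) \<epsilon> + \<rho> C))"
    using gen_iff xi_iff by simp
  show ?thesis
    using part1 part2 unfolding \<gamma>_def \<phi>_def W_def CC_def by blast
qed

end
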